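(* Let $n\ge3$ and $m\ge2$ be integers, and consider Algorithm 1 and Algorithm 2 described in the context. The following hold: 1. Algorithm 1 can be implemented, using Algorithm 2 as a subroutine, so that (i) it succeeds in every run, and (ii) its output is correct. Correctness of the output means the following. The output SDP $(P)$ fails strict complementarity with its dual $(D)$; $X^*$ is a maximum rank optimal solution of $(P)$ and $Z^*$ is a maximum rank optimal solution of $(D)$; and $(P)$ together with $Y_1,\dots,Y_\ell$ is in normal form, that is, $b_1=\dots=b_k=0$; $(Z^*,A_1,\dots,A_k)$ is a regular facial reduction sequence which reduces $\mathcal S^n_+$ to $\begin{pmatrix}0&0\\0&\oplus_r\end{pmatrix}$; $\langle A_i,Y_j\rangle=0$ and $\langle C,Y_j\rangle=0$ for all $i=1,\dots,m$ and $j=1,\dots,\ell$; and $(X^*,Y_1,\dots,Y_\ell)$ is a regular facial reduction sequence which reduces $\mathcal S^n_+$ to $\begin{pmatrix}\oplus_s&0\\0&0\end{pmatrix}$. 2. Suppose $(P)$ is an SDP with $m$ constraints (with linearly independent constraint matrices $A_1,\dots,A_m$) over $\mathcal S^n_+$ that fails strict complementarity with its dual $(D)$. Then $(P)$ is obtained as a reformulation of some output of Algorithm 1.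
   Context: Notation. $\mathcal S^n$ is the space of $n\times n$ real symmetric matrices, $\mathcal S^n_+$ the cone of positive semidefinite (psd) ones, $\langle S,T\rangle=\mathrm{trace}(ST)$, and $S\preceq T$ means $T-S$ is psd. $[n]=\{1,\dots,n\}$. For a matrix $M$ and $R,S\subseteq[n]$, $M(R,S)$ is the submatrix with rows $R$ and columns $S$, called the $(R,S)$ block, and $M(R)=M(R,R)$. Changing the $(R,S)$ block of a symmetric matrix means changing the $(S,R)$ block accordingly. SDP pair. $(P)$: $\inf\langle C,X\rangle$ s.t. $\langle A_i,X\rangle=b_i$ $(i=1,\dots,m)$, $X\succeq0$; $(D)$: $\sup\langle b,y\rangle$ s.t. $\sum_{i}y_iA_i\preceq C$; here $A_i,C\in\mathcal S^n$, $b\in\mathbb R^m$. A matrix $Z$ is feasible (optimal) in $(D)$ if there is $y$ feasible (optimal) in $(D)$ with $Z=C-\sum_i y_iA_i\succeq0$. A maximum rank optimal solution is an optimal solution of largest rank. A pair of optimal solutions means $X$ feasible in $(P)$ and $Z$ feasible in $(D)$ with $\langle X,Z\rangle=0$ (so both are optimal, and $\mathrm{rank}\,X+\mathrm{rank}\,Z\le n$). $(P)$ fails strict complementarity with $(D)$ if such pairs exist, and for a pair of maximum rank optimal solutions $X,Z$ one has $\mathrm{rank}\,X+\mathrm{rank}\,Z<n$. Reformulation. A reformulation of $(P)$ is any SDP obtained from it by applying some of the following operations, in any order: (a) rotating by an invertible matrix $T$, i.e. replacing every $A_i$ by $T^\top A_iT$ and $C$ by $T^\top CT$; (b) exchanging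 two equations; (c) for some $i$ and $y\in\mathbb R^m$ with $y_i\ne0$, replacing $\langle A_i,X\rangle=b_i$ by $\langle\sum_t y_tA_t,X\rangle=\langle b,y\rangle$. Regular facial reduction sequence. A sequence $(Y_1,\dots,Y_t)$ in $\mathcal S^n$ is a regular facial reduction sequence for $\mathcal S^n_+$ with structure $(R_1,\dots,R_t)$ if $R_1,\dots,R_t\subseteq[n]$ are pairwise disjoint (possibly empty) and for every $i$: $Y_i(R_i)$ is diagonal positive definite, and all entries of $Y_i([n]\setminus(R_1\cup\dots\cup R_{i-1}))$ outside the block $Y_i(R_i)$ are zero (entries in rows or columns indexed by $R_1\cup\dots\cup R_{i-1}$ are arbitrary). It reduces $\mathcal S^n_+$ to $\mathcal S^n_+\cap Y_1^\perp\cap\dots\cap Y_t^\perp$, where $Y^\perp=\{X\in\mathcal S^n:\langle Y,X\rangle=0\}$. $\begin{pmatrix}0&0\\0&\oplus_r\end{pmatrix}$ and $\begin{pmatrix}\oplus_s&0\\0&0\end{pmatrix}$ denote the sets of matrices in $\mathcal S^n_+$ in which only the lower right $r\times r$ block, respectively only the upper left $s\times s$ block, may be nonzero. Algorithm 1 (input: integers $n\ge3$, $m\ge2$; output: the SDP $(P)$, and $X^*,Z^*,Y_1,\dots,Y_\ell$). Step 1. Choose positive integers $r,s$ with $r+s<n$, and $k,\ell\in\{1,\dots,n-r-s\}$. Step 2. Choose $X^*=\begin{pmatrix}0&0&0\\0&0&0\\0&0&\Lambda\end{pmatrix}$ and $Z^*=\begin{pmatrix}\Gamma&0&0\\0&0&0\\0&0&0\end{pmatrix}$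 with $\Lambda,\Gamma$ diagonal positive definite of order $r$ and $s$, respectively. Step 3. Choose $A_1,\dots,A_k$ and $Y_1,\dots,Y_\ell$ so that $(Z^*,A_1,\dots,A_k)$ is a regular facial reduction sequence which reduces $\mathcal S^n_+$ to $\begin{pmatrix}0&0\\0&\oplus_r\end{pmatrix}$ and $(X^*,Y_1,\dots,Y_\ell)$ is a regular facial reduction sequence which reduces $\mathcal S^n_+$ to $\begin{pmatrix}\oplus_s&0\\0&0\end{pmatrix}$. Step 4. Use Algorithm 2 to make sure that $\langle A_i,Y_j\rangle=0$ for $i=1,\dots,k$, $j=1,\dots,\ell$. Step 5. Choose $A_{k+1},\dots,A_m\in\mathcal S^n$ so that they have zero inner product with $Y_1,\dots,Y_\ell$. Step 6. Set $b_i=\langle A_i,X^*\rangle$ for $i=1,\dots,m$ and $C=Z^*+\sum_{i=1}^m y_iA_i$ for some $y\in\mathbb R^m$. Algorithm 2 (Base Equations Algorithm; input: the sequences chosen in Steps 2 and 3; output: the same sequences with some blocks adjusted so that $\langle A_i,Y_j\rangle=0$ for $i=1,\dots,k$, $j=1,\dots,\ell$). Let $(P_0,\dots,P_k)$ be the structure of $(Z^*,A_1,\dots,A_k)$ and $(Q_0,\dots,Q_\ell)$ the structure of $(X^*,Y_1,\dots,Y_\ell)$. For $i=1,\dots,k$: adjust the $(P_{i-1},Q_0)$ block of $A_i,Y_1,\dots,Y_\ell$ so that $\langle A_i,Y_j\rangle=0$ for all $j=1,\dots,\ell$. An output of Algorithm 1 is the result for some sequence of choices in these steps. *)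

theory Defs
  imports "HOL-Analysis.Analysis"
begin

text \<open>
  Matrices of order \<open>n\<close> are indexed by a finite linearly ordered type \<open>'n\<close> with
  \<open>CARD('n) = n\<close>; the order is what gives ``upper left'' and ``lower right'' a meaning.
  Families \<open>A\<close>, \<open>b\<close>, \<open>Y\<close> are indexed by \<open>nat\<close>, and only the indices \<open>1..m\<close>
  (respectively \<open>1..l\<close>) are relevant.
\<close>

type_synonym 'n sqmat = "real^'n^'n"

definition symmetric_mat :: "'n::finite sqmat \<Rightarrow> bool" where
  "symmetric_mat M \<longleftrightarrow> transpose M = M"

definition psd :: "'n::finite sqmat \<Rightarrow> bool" where
  "psd M \<longleftrightarrow> symmetric_mat M \<and> (\<forall>x. 0 \<le> x \<bullet> (M *v x))"

definition trace_prod :: "'n::finite sqmat \<Rightarrow> 'n sqmat \<Rightarrow> real" where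
  "trace_prod S T = trace (S ** T)"

definition upper_idx :: "nat \<Rightarrow> 'n::{finite,linorder} set" where
  "upper_idx s = {i. card {..<i} < s}"

definition lower_idx :: "nat \<Rightarrow> 'n::{finite,linorder} set" where
  "lower_idx r = {i. card {i<..} < r}"


section \<open>The primal-dual pair\<close>

definition primal_feasible ::
  "nat \<Rightarrow> (nat \<Rightarrow> 'n::finite sqmat) \<Rightarrow> (nat \<Rightarrow> real) \<Rightarrow> 'n sqmat \<Rightarrow> bool" where
  "primal_feasible m A b X \<longleftrightarrow> psd X \<and> (\<forall>i\<in>{1..m}. trace_prod (A i) X = b i)"

definition primal_optimal ::
  "nat \<Rightarrow> (nat \<Rightarrow> 'n::finite sqmat) \<Rightarrow> (nat \<Rightarrow> real) \<Rightarrow> 'n sqmat \<Rightarrow> 'n sqmat \<Rightarrow> bool" where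
  "primal_optimal m A b C X \<longleftrightarrow> primal_feasible m A b X \<and>
     (\<forall>X'. primal_feasible m A b X' \<longrightarrow> trace_prod C X \<le> trace_prod C X')"

definition slack ::
  "nat \<Rightarrow> (nat \<Rightarrow> 'n::finite sqmat) \<Rightarrow> 'n sqmat \<Rightarrow> (nat \<Rightarrow> real) \<Rightarrow> 'n sqmat" where
  "slack m A C y = C - (\<Sum>i=1..m. y i *\<^sub>R A i)"

definition dual_feasible_vec ::
  "nat \<Rightarrow> (nat \<Rightarrow> 'n::finite sqmat) \<Rightarrow> 'n sqmat \<Rightarrow> (nat \<Rightarrow> real) \<Rightarrow> bool" where
  "dual_feasible_vec m A C y \<longleftrightarrow> psd (slack m A C y)"

definition dual_optimal_vec ::
  "nat \<Rightarrow> (nat \<Rightarrow> 'n::finite sqmat) \<Rightarrow> (nat \<Rightarrow> real) \<Rightarrow> 'n sqmat \<Rightarrow> (nat \<Rightarrow> real) \<Rightarrow> bool" where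
  "dual_optimal_vec m A b C y \<longleftrightarrow> dual_feasible_vec m A C y \<and>
     (\<forall>y'. dual_feasible_vec m A C y' \<longrightarrow> (\<Sum>i=1..m. b i * y' i) \<le> (\<Sum>i=1..m. b i * y i))"

definition dual_feasible ::
  "nat \<Rightarrow> (nat \<Rightarrow> 'n::finite sqmat) \<Rightarrow> 'n sqmat \<Rightarrow> 'n sqmat \<Rightarrow> bool" where
  "dual_feasible m A C Z \<longleftrightarrow> (\<exists>y. dual_feasible_vec m A C y \<and> Z = slack m A C y)"

definition dual_optimal ::
  "nat \<Rightarrow> (nat \<Rightarrow> 'n::finite sqmat) \<Rightarrow> (nat \<Rightarrow> real) \<Rightarrow> 'n sqmat \<Rightarrow> 'n sqmat \<Rightarrow> bool" where
  "dual_optimal m A b C Z \<longleftrightarrow> (\<exists>y. dual_optimal_vec m A b C y \<and> Z = slack m A C y)"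

definition max_rank_primal_optimal ::
  "nat \<Rightarrow> (nat \<Rightarrow> 'n::finite sqmat) \<Rightarrow> (nat \<Rightarrow> real) \<Rightarrow> 'n sqmat \<Rightarrow> 'n sqmat \<Rightarrow> bool" where
  "max_rank_primal_optimal m A b C X \<longleftrightarrow> primal_optimal m A b C X \<and>
     (\<forall>X'. primal_optimal m A b C X' \<longrightarrow> rank X' \<le> rank X)"

definition max_rank_dual_optimal ::
  "nat \<Rightarrow> (nat \<Rightarrow> 'n::finite sqmat) \<Rightarrow> (nat \<Rightarrow> real) \<Rightarrow> 'n sqmat \<Rightarrow> 'n sqmat \<Rightarrow> bool" where
  "max_rank_dual_optimal m A b C Z \<longleftrightarrow> dual_optimal m A b C Z \<and>
     (\<forall>Z'. dual_optimal m A b C Z' \<longrightarrow> rank Z' \<le> rank Z)"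

text \<open>Zero inner product is the same as a zero duality gap, so both members are optimal.\<close>

definition optimal_pair ::
  "nat \<Rightarrow> (nat \<Rightarrow> 'n::finite sqmat) \<Rightarrow> (nat \<Rightarrow> real) \<Rightarrow> 'n sqmat \<Rightarrow> 'n sqmat \<Rightarrow> 'n sqmat \<Rightarrow> bool" where
  "optimal_pair m A b C X Z \<longleftrightarrow>
     primal_feasible m A b X \<and> dual_feasible m A C Z \<and> trace_prod X Z = 0"

definition fails_strict_complementarity ::
  "nat \<Rightarrow> (nat \<Rightarrow> 'n::finite sqmat) \<Rightarrow> (nat \<Rightarrow> real) \<Rightarrow> 'n sqmat \<Rightarrow> bool" where
  "fails_strict_complementarity m A b C \<longleftrightarrow>
     (\<exists>X Z. optimal_pair m A b C X Z) \<and>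
     (\<exists>X Z. optimal_pair m A b C X Z \<and>
        max_rank_primal_optimal m A b C X \<and> max_rank_dual_optimal m A b C Z \<and>
        rank X + rank Z < CARD('n))"


section \<open>Reformulations\<close>

inductive reformulation ::
  "nat \<Rightarrow> (nat \<Rightarrow> 'n::finite sqmat) \<Rightarrow> (nat \<Rightarrow> real) \<Rightarrow> 'n sqmat \<Rightarrow>
   (nat \<Rightarrow> 'n sqmat) \<Rightarrow> (nat \<Rightarrow> real) \<Rightarrow> 'n sqmat \<Rightarrow> bool"
  for m A0 b0 C0 where
  same: "(\<And>i. i \<in> {1..m} \<Longrightarrow> A i = A0 i \<and> b i = b0 i) \<Longrightarrow> C = C0 \<Longrightarrow>
     reformulation m A0 b0 C0 A b C"
| rotate: "reformulation m A0 b0 C0 A b C \<Longrightarrow> invertible T \<Longrightarrow>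
     reformulation m A0 b0 C0 (\<lambda>i. transpose T ** A i ** T) b (transpose T ** C ** T)"
| exchange: "reformulation m A0 b0 C0 A b C \<Longrightarrow> i \<in> {1..m} \<Longrightarrow> j \<in> {1..m} \<Longrightarrow>
     reformulation m A0 b0 C0 (A(i := A j, j := A i)) (b(i := b j, j := b i)) C"
| combine: "reformulation m A0 b0 C0 A b C \<Longrightarrow> i \<in> {1..m} \<Longrightarrow> y i \<noteq> 0 \<Longrightarrow>
     reformulation m A0 b0 C0 (A(i := (\<Sum>t=1..m. y t *\<^sub>R A t)))
       (b(i := (\<Sum>t=1..m. b t * y t))) C"


section \<open>Regular facial reduction sequences\<close>

definition diag_pd_block :: "'n::finite set \<Rightarrow> 'n sqmat \<Rightarrow> bool" where
  "diag_pd_block R M \<longleftrightarrow>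
     (\<forall>p\<in>R. \<forall>q\<in>R. p \<noteq> q \<longrightarrow> M $ p $ q = 0) \<and>
     (\<forall>x. x \<noteq> 0 \<and> (\<forall>p. p \<notin> R \<longrightarrow> x $ p = 0) \<longrightarrow> 0 < x \<bullet> (M *v x))"

definition supported_on :: "'n::finite set \<Rightarrow> 'n sqmat \<Rightarrow> bool" where
  "supported_on R M \<longleftrightarrow> (\<forall>p q. \<not> (p \<in> R \<and> q \<in> R) \<longrightarrow> M $ p $ q = 0)"

text \<open>Lists are indexed from 0, so \<open>\<Union>(set (take i Rs))\<close> is the union of the
  members of the structure preceding \<open>Rs ! i\<close>.\<close>

definition regular_fr_seq :: "'n::finite sqmat list \<Rightarrow> 'n set list \<Rightarrow> bool" where
  "regular_fr_seq Ys Rs \<longleftrightarrow>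
     length Ys = length Rs \<and>
     (\<forall>M\<in>set Ys. symmetric_mat M) \<and>
     (\<forall>i<length Rs. \<forall>j<length Rs. i \<noteq> j \<longrightarrow> Rs ! i \<inter> Rs ! j = {}) \<and>
     (\<forall>i<length Rs.
        diag_pd_block (Rs ! i) (Ys ! i) \<and>
        (\<forall>p q. p \<notin> \<Union>(set (take i Rs)) \<and> q \<notin> \<Union>(set (take i Rs)) \<and>
               \<not> (p \<in> Rs ! i \<and> q \<in> Rs ! i) \<longrightarrow> Ys ! i $ p $ q = 0))"

definition reduces_psd_to :: "'n::finite sqmat list \<Rightarrow> 'n sqmat set \<Rightarrow> bool" where
  "reduces_psd_to Ys F \<longleftrightarrow> {X. psd X \<and> (\<forall>M\<in>set Ys. trace_prod M X = 0)} = F"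

definition psd_face :: "'n::finite set \<Rightarrow> 'n sqmat set" where
  "psd_face R = {X. psd X \<and> supported_on R X}"

definition fr_seq :: "'n::finite sqmat \<Rightarrow> (nat \<Rightarrow> 'n sqmat) \<Rightarrow> nat \<Rightarrow> 'n sqmat list" where
  "fr_seq M A k = M # map A [1..<Suc k]"


section \<open>The algorithms\<close>

text \<open>\<open>M'\<close> arises from \<open>M\<close> by changing its \<open>(R,S)\<close> block, and its \<open>(S,R)\<close> block accordingly.\<close>

definition changes_block :: "'n::finite set \<Rightarrow> 'n set \<Rightarrow> 'n sqmat \<Rightarrow> 'n sqmat \<Rightarrow> bool" where
  "changes_block R S M M' \<longleftrightarrow> symmetric_mat M' \<and>
     (\<forall>p q. \<not> (p \<in> R \<and> q \<in> S) \<and> \<not> (p \<in> S \<and> q \<in> R) \<longrightarrow> M' $ p $ q = M $ p $ q)"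

text \<open>
  Algorithm 1 is a nondeterministic transition system. The arguments of the states are the
  data chosen so far: \<open>r s k l\<close>, then \<open>X\<^sup>*\<close> and \<open>Z\<^sup>*\<close>, and so on.
  \<open>Base_Equations r s k l X Z Ps Qs i A Y\<close> is the state after Step 3 and \<open>i\<close> completed
  iterations of Algorithm 2 (so \<open>i = k\<close> means that Step 4 is done), where \<open>Ps\<close> and \<open>Qs\<close>
  are the structures \<open>(P\<^sub>0,\<dots>,P\<^sub>k)\<close> and \<open>(Q\<^sub>0,\<dots>,Q\<^sub>l)\<close>.
\<close>

datatype ('n::finite) alg_state =
    Start
  | Sizes nat nat nat nat
  | Optimal_Matrices nat nat nat nat "'n sqmat" "'n sqmat"
  | Base_Equations nat nat nat nat "'n sqmat" "'n sqmat" "'n set list" "'n set list" nat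
      "nat \<Rightarrow> 'n sqmat" "nat \<Rightarrow> 'n sqmat"
  | All_Equations nat nat nat nat "'n sqmat" "'n sqmat" "nat \<Rightarrow> 'n sqmat" "nat \<Rightarrow> 'n sqmat"
  | Output nat nat nat nat "'n sqmat" "'n sqmat"
      "nat \<Rightarrow> 'n sqmat" "nat \<Rightarrow> real" "'n sqmat" "nat \<Rightarrow> 'n sqmat"

text \<open>The condition \<open>k \<le> m\<close> in \<open>step1\<close> is implicit in \<open>A\<^sub>1,\<dots>,A\<^sub>k\<close> being among the
  \<open>m\<close> constraint matrices.\<close>

inductive alg1_step :: "nat \<Rightarrow> ('n::{finite,linorder}) alg_state \<Rightarrow> 'n alg_state \<Rightarrow> bool"
  for m where
  step1: "0 < r \<Longrightarrow> 0 < s \<Longrightarrow> r + s < CARD('n) \<Longrightarrow>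
     k \<in> {1..CARD('n) - r - s} \<Longrightarrow> l \<in> {1..CARD('n) - r - s} \<Longrightarrow> k \<le> m \<Longrightarrow>
     alg1_step m (Start :: 'n alg_state) (Sizes r s k l)"
| step2: "supported_on (lower_idx r) X \<Longrightarrow> diag_pd_block (lower_idx r) X \<Longrightarrow>
     supported_on (upper_idx s) Z \<Longrightarrow> diag_pd_block (upper_idx s) Z \<Longrightarrow>
     alg1_step m (Sizes r s k l) (Optimal_Matrices r s k l X Z)"
| step3: "regular_fr_seq (fr_seq Z A k) Ps \<Longrightarrow>
     reduces_psd_to (fr_seq Z A k) (psd_face (lower_idx r)) \<Longrightarrow>
     regular_fr_seq (fr_seq X Y l) Qs \<Longrightarrow>
     reduces_psd_to (fr_seq X Y l) (psd_face (upper_idx s)) \<Longrightarrow>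
     alg1_step m (Optimal_Matrices r s k l X Z) (Base_Equations r s k l X Z Ps Qs 0 A Y)"
| step4: "i \<in> {1..k} \<Longrightarrow>
     (\<forall>t. t \<noteq> i \<longrightarrow> A' t = A t) \<Longrightarrow>
     changes_block (Ps ! (i - 1)) (Qs ! 0) (A i) (A' i) \<Longrightarrow>
     (\<forall>j\<in>{1..l}. changes_block (Ps ! (i - 1)) (Qs ! 0) (Y j) (Y' j)) \<Longrightarrow>
     (\<forall>j\<in>{1..l}. trace_prod (A' i) (Y' j) = 0) \<Longrightarrow>
     alg1_step m (Base_Equations r s k l X Z Ps Qs (i - 1) A Y)
                 (Base_Equations r s k l X Z Ps Qs i A' Y')"
| step5: "(\<forall>i\<in>{1..k}. A' i = A i) \<Longrightarrow>
     (\<forall>i\<in>{k<..m}. symmetric_mat (A' i) \<and> (\<forall>j\<in>{1..l}. trace_prod (A' i) (Y j) = 0)) \<Longrightarrow>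
     alg1_step m (Base_Equations r s k l X Z Ps Qs k A Y) (All_Equations r s k l X Z A' Y)"
| step6: "(\<forall>i\<in>{1..m}. b i = trace_prod (A i) X) \<Longrightarrow>
     C = Z + (\<Sum>i=1..m. y i *\<^sub>R A i) \<Longrightarrow>
     alg1_step m (All_Equations r s k l X Z A Y) (Output r s k l X Z A b C Y)"

definition alg1_output ::
  "nat \<Rightarrow> nat \<Rightarrow> nat \<Rightarrow> nat \<Rightarrow> nat \<Rightarrow> ('n::{finite,linorder}) sqmat \<Rightarrow> 'n sqmat \<Rightarrow>
   (nat \<Rightarrow> 'n sqmat) \<Rightarrow> (nat \<Rightarrow> real) \<Rightarrow> 'n sqmat \<Rightarrow> (nat \<Rightarrow> 'n sqmat) \<Rightarrow> bool" where
  "alg1_output m r s k l X Z A b C Y \<longleftrightarrow>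
     (alg1_step m)\<^sup>*\<^sup>* Start (Output r s k l X Z A b C Y)"

text \<open>
  An implementation restricts the choices available in the algorithm. The last clause
  keeps this from being degenerate: the only choices that may be excluded are those, in
  Step 3, where some \<open>P\<^sub>i\<close> with \<open>i < k\<close> is empty. (Then iteration \<open>i + 1\<close> of
  Algorithm 2 has an empty block to adjust, and it may be impossible to carry out.)
\<close>

definition has_empty_block_choice :: "('n::finite) alg_state \<Rightarrow> 'n alg_state \<Rightarrow> bool" where
  "has_empty_block_choice \<sigma> \<sigma>' \<longleftrightarrow>
     (\<exists>r s k l X Z Ps Qs A Y. \<sigma> = Optimal_Matrices r s k l X Z \<and>
        \<sigma>' = Base_Equations r s k l X Z Ps Qs 0 A Y \<and> {} \<in> set (butlast Ps))"

definition alg1_implementation ::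
  "nat \<Rightarrow> (('n::{finite,linorder}) alg_state \<Rightarrow> 'n alg_state \<Rightarrow> bool) \<Rightarrow> bool" where
  "alg1_implementation m impl \<longleftrightarrow>
     (\<forall>\<sigma> \<sigma>'. impl \<sigma> \<sigma>' \<longrightarrow> alg1_step m \<sigma> \<sigma>') \<and>
     (\<forall>\<sigma> \<sigma>'. alg1_step m \<sigma> \<sigma>' \<and> \<not> has_empty_block_choice \<sigma> \<sigma>' \<longrightarrow> impl \<sigma> \<sigma>')"

definition is_output :: "('n::finite) alg_state \<Rightarrow> bool" where
  "is_output \<sigma> \<longleftrightarrow> (\<exists>r s k l X Z A b C Y. \<sigma> = Output r s k l X Z A b C Y)"

text \<open>Every run terminates, and it can only stop at an output.\<close>

definition succeeds_in_every_run ::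
  "(('n::finite) alg_state \<Rightarrow> 'n alg_state \<Rightarrow> bool) \<Rightarrow> bool" where
  "succeeds_in_every_run impl \<longleftrightarrow>
     \<not> (\<exists>f. f 0 = Start \<and> (\<forall>t::nat. impl (f t) (f (Suc t)))) \<and>
     (\<forall>\<sigma>. impl\<^sup>*\<^sup>* Start \<sigma> \<longrightarrow> is_output \<sigma> \<or> (\<exists>\<sigma>'. impl \<sigma> \<sigma>'))"

definition normal_form ::
  "nat \<Rightarrow> nat \<Rightarrow> nat \<Rightarrow> nat \<Rightarrow> nat \<Rightarrow> ('n::{finite,linorder}) sqmat \<Rightarrow> 'n sqmat \<Rightarrow>
   (nat \<Rightarrow> 'n sqmat) \<Rightarrow> (nat \<Rightarrow> real) \<Rightarrow> 'n sqmat \<Rightarrow> (nat \<Rightarrow> 'n sqmat) \<Rightarrow> bool" where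
  "normal_form m r s k l X Z A b C Y \<longleftrightarrow>
     (\<forall>i\<in>{1..k}. b i = 0) \<and>
     (\<exists>Ps. regular_fr_seq (fr_seq Z A k) Ps) \<and>
     reduces_psd_to (fr_seq Z A k) (psd_face (lower_idx r)) \<and>
     (\<forall>j\<in>{1..l}. (\<forall>i\<in>{1..m}. trace_prod (A i) (Y j) = 0) \<and> trace_prod C (Y j) = 0) \<and>
     (\<exists>Qs. regular_fr_seq (fr_seq X Y l) Qs) \<and>
     reduces_psd_to (fr_seq X Y l) (psd_face (upper_idx s))"

definition correct_output ::
  "nat \<Rightarrow> nat \<Rightarrow> nat \<Rightarrow> nat \<Rightarrow> nat \<Rightarrow> ('n::{finite,linorder}) sqmat \<Rightarrow> 'n sqmat \<Rightarrow>
   (nat \<Rightarrow> 'n sqmat) \<Rightarrow> (nat \<Rightarrow> real) \<Rightarrow> 'n sqmat \<Rightarrow> (nat \<Rightarrow> 'n sqmat) \<Rightarrow> bool" where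
  "correct_output m r s k l X Z A b C Y \<longleftrightarrow>
     fails_strict_complementarity m A b C \<and>
     max_rank_primal_optimal m A b C X \<and>
     max_rank_dual_optimal m A b C Z \<and>
     normal_form m r s k l X Z A b C Y"

end

theory Submission
  imports Defs
begin

text \<open>
  A regular facial reduction sequence reduces the psd cone to the face given by the complement of
  the union of its structure, so the reduction property survives every change of entries in rows and
  columns that come earlier in the structure. Iteration \<open>i\<close> of Algorithm 2 only changes such entries.
  It does not disturb the equations already achieved, because the earlier \<open>A\<^sub>t\<close> vanish on the
  \<open>(P\<^sub>i\<^sub>-\<^sub>1, Q\<^sub>0)\<close> block, and it can be carried out as soon as this block is nonempty. Optimality and
  maximality of the ranks are read off from the two sequences.

  For the converse, separating an affine space from the relative interior of a face, repeatedly,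
  yields certificates that shrink the null space of \<open>Z\<close> to the range of \<open>X\<close> and the null space of
  \<open>X\<close> to the range of \<open>Z\<close>. Both sequences of certificates have to be made regular by one rotation.
  Each defines a flag of subspaces with definite forms on the successive quotients, one flag in the
  space and one in its dual. A basis adapted to both flags whose dual basis is orthogonal as well is
  split off vector by vector: the leading singular pair of the pairing between two suitable members of
  the flags is orthogonal to all that remains. Steinitz exchange makes the certificates the leading
  constraints, and all operations are invertible.
\<close>

section \<open>Positive semidefinite forms\<close>

text \<open>Two flags are needed because a rotation by \<open>T\<close> acts on \<open>Z\<close> and
  the constraints through the columns of \<open>T\<close>, but on \<open>X\<close> and the
  \<open>Y j\<close> through the rows of the inverse of \<open>T\<close>. A basis adapted to one
  flag is easy to find, but its dual basis need not be orthogonal for the forms of the other.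
  Choosing flag members that still pair nontrivially and lie as deep as possible makes the pairing
  descend to quotients on which both forms are definite; only there does an extremal pair exist.
  Certificates exist because a point in the relative interior of a larger face would be an optimal
  solution of larger rank. Primal certificates annihilate all feasible directions and so lie in the
  span of the constraints; dual ones are orthogonal to that span, so the equations Algorithm 2 has
  to achieve hold from the start and in the converse its iterations may be idle.\<close>

definition outer :: "real^'n \<Rightarrow> real^'n^'n" where
  "outer v = (\<chi> i j. v $ i * v $ j)"

lemma symmetric_mat_component: "symmetric_mat M \<longleftrightarrow> (\<forall>i j. M $ i $ j = M $ j $ i)"
  by (auto simp: symmetric_mat_def transpose_def vec_eq_iff)

lemma symmetric_inner_commute:
  "symmetric_mat M \<Longrightarrow> x \<bullet> (M *v y) = y \<bullet> (M *v x)"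
  using dot_lmul_matrix[of y M x] transpose_matrix_vector[of M y]
  by (simp add: symmetric_mat_def inner_commute)

lemma inner_matrix: "inner S T = (\<Sum>i\<in>UNIV. \<Sum>j\<in>UNIV. S $ i $ j * T $ i $ j)"
  for S T :: "real^'n^'m"
  by (simp add: inner_vec_def)

lemma trace_prod_commute: "trace_prod S T = trace_prod T S"
  unfolding trace_prod_def by (rule trace_mul_sym)

lemma trace_prod_inner_transpose: "trace_prod S T = inner S (transpose T)"
  by (simp add: trace_prod_def trace_def matrix_matrix_mult_def inner_matrix transpose_def)

text \<open>Makes the Euclidean structure of the matrix space, with its projections and separation
  theorems, available for the trace form.\<close>

lemma trace_prod_inner: "symmetric_mat T \<Longrightarrow> trace_prod S T = inner S T"
  by (simp add: trace_prod_inner_transpose symmetric_mat_def)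

lemma quadratic_form_expand: "x \<bullet> (M *v y) = (\<Sum>i\<in>UNIV. \<Sum>j\<in>UNIV. M $ i $ j * (x $ i * y $ j))"
  for M :: "real^'n^'m"
  by (simp add: inner_vec_def matrix_vector_mult_def sum_distrib_left algebra_simps)

lemma inner_outer: "inner M (outer v) = v \<bullet> (M *v v)"
  by (simp add: quadratic_form_expand inner_matrix outer_def)

lemma symmetric_outer: "symmetric_mat (outer v)"
  by (simp add: symmetric_mat_component outer_def)

lemma outer_vector_mult: "outer v *v x = (v \<bullet> x) *\<^sub>R v"
  by (simp add: vec_eq_iff outer_def matrix_vector_mult_def inner_vec_def sum_distrib_left algebra_simps)

lemma subspace_symmetric_mat: "subspace {M. symmetric_mat M}"
  by (auto simp: subspace_def symmetric_mat_component)

lemma matrix_vector_mult_sum: "(\<Sum>a\<in>A. f a) *v x = (\<Sum>a\<in>A. f a *v x)"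
  for f :: "'a \<Rightarrow> real^'n^'m"
  by (induction A rule: infinite_finite_induct) (auto simp: matrix_vector_mult_add_rdistrib)

text \<open>A null vector minimizes the form on \<open>V\<close>. If it paired nontrivially with
  \<open>y\<close>, the form along the line through \<open>y\<close> in direction \<open>x\<close>
  would be affine and unbounded below.\<close>

lemma psd_kernel_on:
  fixes M :: "real^'n^'n"
  assumes V: "subspace V" and sym: "symmetric_mat M" and psd: "\<And>x. x \<in> V \<Longrightarrow> 0 \<le> x \<bullet> (M *v x)"
    and x: "x \<in> V" "x \<bullet> (M *v x) = 0" and y: "y \<in> V"
  shows "x \<bullet> (M *v y) = 0"
proof (rule ccontr)
  assume nz: "x \<bullet> (M *v y) \<noteq> 0"
  define p where "p = x \<bullet> (M *v y)"
  \<comment> \<open>Solves \<open>y \<bullet> (M *v y) + 2 * t * p = -1\<close>.\<close>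
  define t where "t = - (y \<bullet> (M *v y) + 1) / (2 * p)"
  have "0 \<le> (y + t *\<^sub>R x) \<bullet> (M *v (y + t *\<^sub>R x))"
    by (intro psd subspace_add subspace_scale V x y)
  also have "\<dots> = y \<bullet> (M *v y) + 2 * t * p"
    using symmetric_inner_commute[OF sym, of x y] x(2)
    by (simp add: matrix_vector_right_distrib matrix_vector_mult_scaleR inner_add_left inner_add_right p_def)
  also have "\<dots> = -1"
    using nz by (simp add: t_def p_def field_simps)
  finally show False by simp
qed

text \<open>The null set of a semidefinite form is its radical, which is cut out by linear
  equations.\<close>

lemma subspace_psd_null:
  fixes M :: "real^'n^'n"
  assumes V: "subspace V" and sym: "symmetric_mat M" and psd: "\<And>x. x \<in> V \<Longrightarrow> 0 \<le> x \<bullet> (M *v x)"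
  shows "subspace {x\<in>V. x \<bullet> (M *v x) = 0}"
proof -
  have "{x\<in>V. x \<bullet> (M *v x) = 0} = {x\<in>V. \<forall>y\<in>V. y \<bullet> (M *v x) = 0}"
    using psd_kernel_on[OF V sym psd] symmetric_inner_commute[OF sym] by auto
  then show ?thesis
    using V by (auto simp: subspace_def matrix_vector_right_distrib matrix_vector_mult_scaleR inner_add_right)
qed

lemma psd_nonneg: "psd M \<Longrightarrow> 0 \<le> x \<bullet> (M *v x)"
  by (simp add: psd_def)

lemma psd_null_vector:
  assumes "psd M" "x \<bullet> (M *v x) = 0"
  shows "M *v x = 0"
proof -
  have "x \<bullet> (M *v (M *v x)) = 0"
    by (rule psd_kernel_on[where V = UNIV]) (use assms in \<open>auto simp: psd_def\<close>)
  then show ?thesis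
    using symmetric_inner_commute[of M x "M *v x"] assms by (auto simp: psd_def)
qed

lemma psd_outer: "psd (outer v)"
  by (simp add: psd_def symmetric_outer outer_vector_mult inner_commute)

text \<open>Rank one deflation: subtracting the square of a multiple of \<open>X *v x\<close> keeps
  the matrix psd and shrinks its range. Keeping the vectors in the range is what later allows forms
  that are nonnegative on a subspace only.\<close>

lemma psd_eq_sum_outer:
  fixes X :: "real^'n^'n"
  assumes "psd X"
  obtains vs where "X = (\<Sum>v\<leftarrow>vs. outer v)" "set vs \<subseteq> range ((*v) X)"
  using assms
proof (induction "dim (range ((*v) X))" arbitrary: X thesis rule: less_induct)
  case less
  show ?case
  proof (cases "\<forall>x. x \<bullet> (X *v x) = 0")
    case True
    then have "X = 0"
      using psd_null_vector[OF less.prems(2)] by (metis matrix_eq matrix_vector_mult_0)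
    then show ?thesis by (intro less.prems(1)[of "[]"]) auto
  next
    case False
    then obtain x where x: "x \<bullet> (X *v x) > 0"
      using less.prems(2) by (auto simp: psd_def less_le)
    define q where "q = x \<bullet> (X *v x)"
    \<comment> \<open>Scaled so that \<open>outer w\<close> and \<open>X\<close> agree at
      \<open>x\<close>; hence \<open>X' *v x\<close> vanishes.\<close>
    define w where "w = (1 / sqrt q) *\<^sub>R (X *v x)"
    define X' where "X' = X - outer w"
    have sym: "symmetric_mat X" using less.prems(2) by (simp add: psd_def)
    have q: "q > 0" "sqrt q * sqrt q = q" using x by (auto simp: q_def)
    have X'y: "X' *v y = X *v (y - ((x \<bullet> (X *v y)) / q) *\<^sub>R x)" for y
    proof -
      have "outer w *v y = ((y \<bullet> (X *v x)) / (sqrt q * sqrt q)) *\<^sub>R (X *v x)"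
        by (simp add: outer_vector_mult w_def inner_commute)
      then show ?thesis
        using q symmetric_inner_commute[OF sym, of x y]
        by (simp add: X'_def matrix_vector_mult_diff_rdistrib matrix_vector_mult_diff_distrib matrix_vector_mult_scaleR)
    qed
    have "psd X'"
      unfolding psd_def
    proof (intro conjI allI)
      show "symmetric_mat X'"
        using sym symmetric_outer[of w] by (simp add: symmetric_mat_component X'_def)
      fix y
      \<comment> \<open>The part of \<open>y\<close> that is \<open>X\<close>-orthogonal to
        \<open>x\<close>; the deflated form at \<open>y\<close> is the old form at
        \<open>z\<close>.\<close>
      define z where "z = y - ((x \<bullet> (X *v y)) / q) *\<^sub>R x"
      have "x \<bullet> (X *v z) = 0"
        using q by (simp add: z_def matrix_vector_mult_diff_distrib matrix_vector_mult_scaleR inner_diff_right q_def)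
      then have "y \<bullet> (X' *v y) = z \<bullet> (X *v z)"
        unfolding X'y z_def[symmetric] by (simp add: z_def inner_diff_left)
      then show "0 \<le> y \<bullet> (X' *v y)"
        using less.prems(2) by (simp add: psd_def)
    qed
    have sub: "range ((*v) X') \<subseteq> range ((*v) X)"
      by (auto simp: X'y)
    have "X' *v x = 0"
      using q by (simp add: X'y q_def)
    \<comment> \<open>The deflated range is orthogonal to \<open>x\<close>, whereas this vector
      pairs positively with \<open>x\<close>.\<close>
    have "X *v x \<notin> range ((*v) X')"
    proof
      assume "X *v x \<in> range ((*v) X')"
      then obtain y where "X *v x = X' *v y" by auto
      then have "x \<bullet> (X *v x) = y \<bullet> (X' *v x)"
        using symmetric_inner_commute[of X' x y] \<open>psd X'\<close> by (simp add: psd_def)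
      then show False using x \<open>X' *v x = 0\<close> by simp
    qed
    moreover have subsp: "subspace (range ((*v) M))" for M :: "real^'n^'n"
      by (simp add: linear_subspace_image)
    ultimately have "dim (range ((*v) X')) < dim (range ((*v) X))"
      using sub subspace_dim_equal[OF subsp subsp sub] dim_subset[OF sub] by force
    from less.hyps[OF this _ \<open>psd X'\<close>] obtain vs
      where vs: "X' = (\<Sum>v\<leftarrow>vs. outer v)" "set vs \<subseteq> range ((*v) X')" by blast
    show ?thesis
    proof (rule less.prems(1))
      show "X = (\<Sum>v\<leftarrow>w # vs. outer v)" using vs(1) by (simp add: X'_def algebra_simps)
      have "w \<in> range ((*v) X)"
        unfolding w_def by (metis matrix_vector_mult_scaleR rangeI)
      then show "set (w # vs) \<subseteq> range ((*v) X)" using vs(2) sub by auto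
    qed
  qed
qed

lemma inner_sum_list_outer: "inner M (\<Sum>v\<leftarrow>vs. outer v) = (\<Sum>v\<leftarrow>vs. v \<bullet> (M *v v))"
  by (induction vs) (auto simp: inner_add_right inner_outer)

lemma inner_psd_nonneg_on:
  assumes "psd X" "range ((*v) X) \<subseteq> V" "\<And>v. v \<in> V \<Longrightarrow> 0 \<le> v \<bullet> (M *v v)"
  shows "0 \<le> inner M X"
proof -
  obtain vs where vs: "X = (\<Sum>v\<leftarrow>vs. outer v)" "set vs \<subseteq> range ((*v) X)"
    using psd_eq_sum_outer[OF assms(1)] by blast
  show ?thesis
    unfolding vs(1) inner_sum_list_outer using vs(2) assms(2,3)
    by (intro sum_list_nonneg) auto
qed

text \<open>Equality case: nonnegative terms with sum 0 vanish one by one, and since the null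
  vectors of the form make up a subspace, they carry the whole range.\<close>

lemma inner_psd_zero_on:
  assumes X: "psd X" and R: "range ((*v) X) \<subseteq> V" and V: "subspace V" and M: "symmetric_mat M"
    and pos: "\<And>v. v \<in> V \<Longrightarrow> 0 \<le> v \<bullet> (M *v v)" and z: "inner M X = 0"
  shows "range ((*v) X) \<subseteq> {x\<in>V. x \<bullet> (M *v x) = 0}"
proof -
  obtain vs where vs: "X = (\<Sum>v\<leftarrow>vs. outer v)" "set vs \<subseteq> range ((*v) X)"
    using psd_eq_sum_outer[OF X] by blast
  let ?V = "{x\<in>V. x \<bullet> (M *v x) = 0}"
  have sub: "subspace ?V" by (rule subspace_psd_null[OF V M pos])
  have "(\<Sum>v\<leftarrow>vs. v \<bullet> (M *v v)) = 0"
    using z unfolding vs(1) inner_sum_list_outer .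
  then have "\<forall>v\<in>set vs. v \<bullet> (M *v v) = 0"
    using vs(2) R pos by (subst (asm) sum_list_nonneg_eq_0_iff) auto
  then have *: "set vs \<subseteq> ?V" using vs(2) R by auto
  have "(\<Sum>v\<leftarrow>vs. outer v) *v x \<in> ?V" for x
    using * 
  proof (induction vs)
    case Nil then show ?case using subspace_0[OF sub] by simp
  next
    case (Cons v vs)
    then have "(v \<bullet> x) *\<^sub>R v \<in> ?V" using subspace_scale[OF sub, of v] by auto
    then show ?case using Cons subspace_add[OF sub]
      by (simp add: matrix_vector_mult_add_rdistrib outer_vector_mult)
  qed
  then show ?thesis using vs(1) by auto
qed

lemma trace_prod_psd_nonneg:
  assumes "psd S" "psd T" shows "0 \<le> trace_prod S T"
  using inner_psd_nonneg_on[of T UNIV S] assms by (auto simp: psd_def trace_prod_inner)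

section \<open>Flags cut out by facial reduction sequences\<close>

text \<open>The flag of iterated null spaces. Under \<open>fr_chain\<close> each form is
  semidefinite on the member before it, so the members are subspaces. This is the coordinate-free
  shape of a facial reduction sequence.\<close>

definition fr_space :: "(real^'n) set \<Rightarrow> (real^'n^'n) list \<Rightarrow> nat \<Rightarrow> (real^'n) set" where
  "fr_space N Ss i = {x\<in>N. \<forall>t<i. x \<bullet> (Ss ! t *v x) = 0}"

definition fr_chain :: "(real^'n) set \<Rightarrow> (real^'n^'n) list \<Rightarrow> bool" where
  "fr_chain N Ss \<longleftrightarrow> (\<forall>i<length Ss. symmetric_mat (Ss ! i) \<and>
     (\<forall>x\<in>fr_space N Ss i. 0 \<le> x \<bullet> (Ss ! i *v x)))"

lemma fr_space_0 [simp]: "fr_space N Ss 0 = N"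
  by (simp add: fr_space_def)

lemma fr_space_Suc: "fr_space N Ss (Suc i) = {x\<in>fr_space N Ss i. x \<bullet> (Ss ! i *v x) = 0}"
  by (auto simp: fr_space_def less_Suc_eq)

lemma fr_space_Cons_Suc: "fr_space N (S # Ss) (Suc i) = fr_space {x\<in>N. x \<bullet> (S *v x) = 0} Ss i"
  by (auto simp: fr_space_def less_Suc_eq_0_disj)

lemma fr_space_append: "i \<le> length Ss \<Longrightarrow> fr_space N (Ss @ Ts) i = fr_space N Ss i"
  by (auto simp: fr_space_def nth_append)

lemma fr_space_antimono: "i \<le> j \<Longrightarrow> fr_space N Ss j \<subseteq> fr_space N Ss i"
  by (auto simp: fr_space_def)

lemma fr_space_inter: "fr_space (N \<inter> U) Ss i = fr_space N Ss i \<inter> U"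
  by (auto simp: fr_space_def)

lemma fr_chain_inter: "fr_chain N Ss \<Longrightarrow> fr_chain (N \<inter> U) Ss"
  by (simp add: fr_chain_def fr_space_inter)

lemma fr_chain_Nil [simp]: "fr_chain N []"
  by (simp add: fr_chain_def)

lemma fr_chain_Cons:
  "fr_chain N (S # Ss) \<longleftrightarrow> symmetric_mat S \<and> (\<forall>x\<in>N. 0 \<le> x \<bullet> (S *v x)) \<and>
     fr_chain {x\<in>N. x \<bullet> (S *v x) = 0} Ss"
  unfolding fr_chain_def length_Cons All_less_Suc2
  by (simp add: fr_space_Cons_Suc)

lemma fr_chain_snoc:
  "fr_chain N (Ss @ [S]) \<longleftrightarrow> fr_chain N Ss \<and> symmetric_mat S \<and>
     (\<forall>x\<in>fr_space N Ss (length Ss). 0 \<le> x \<bullet> (S *v x))"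
  by (auto simp: fr_chain_def less_Suc_eq fr_space_append nth_append)

lemma fr_chainD:
  "fr_chain N Ss \<Longrightarrow> i < length Ss \<Longrightarrow> symmetric_mat (Ss ! i)"
  "fr_chain N Ss \<Longrightarrow> i < length Ss \<Longrightarrow> x \<in> fr_space N Ss i \<Longrightarrow> 0 \<le> x \<bullet> (Ss ! i *v x)"
  by (auto simp: fr_chain_def)

lemma subspace_fr_space:
  "subspace N \<Longrightarrow> fr_chain N Ss \<Longrightarrow> i \<le> length Ss \<Longrightarrow> subspace (fr_space N Ss i)"
proof (induction i)
  case (Suc i)
  then show ?case
    unfolding fr_space_Suc by (intro subspace_psd_null) (simp_all add: fr_chainD Suc_le_eq)
qed simp

section \<open>Extremal pairs for the pairing of two subspaces\<close>

text \<open>The form has a positive minimum \<open>d\<close> on the unit sphere of \<open>V\<close>,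
  so it dominates \<open>d\<close> times the squared norm. Compactness supplies the maximizer in
  \<open>singular_pair_pd\<close>.\<close>

lemma compact_psd_ball:
  fixes M :: "real^'n^'n"
  assumes V: "subspace V" and pos: "\<And>x. x \<in> V \<Longrightarrow> x \<noteq> 0 \<Longrightarrow> 0 < x \<bullet> (M *v x)"
  shows "compact {x\<in>V. x \<bullet> (M *v x) \<le> 1}"
proof -
  have cont: "continuous_on U (\<lambda>x. x \<bullet> (M *v x))" for U
    by (intro continuous_intros)
  have "\<exists>d>0. \<forall>x\<in>V. norm x = 1 \<longrightarrow> d \<le> x \<bullet> (M *v x)"
  proof (cases "V \<inter> sphere 0 1 = {}")
    case True
    then show ?thesis by (intro exI[of _ 1]) auto
  next
    case False
    have "compact (V \<inter> sphere 0 1)"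
      using closed_subspace[OF V] by (simp add: closed_Int_compact)
    from continuous_attains_inf[OF this False cont] obtain x0 where
      x0: "x0 \<in> V \<inter> sphere 0 1" "\<And>x. x \<in> V \<inter> sphere 0 1 \<Longrightarrow> x0 \<bullet> (M *v x0) \<le> x \<bullet> (M *v x)"
      by blast
    then have "x0 \<noteq> 0" by auto
    with x0 show ?thesis
      using pos[of x0] by (intro exI[of _ "x0 \<bullet> (M *v x0)"]) auto
  qed
  then obtain d where d: "d > 0" "\<And>x. x \<in> V \<Longrightarrow> norm x = 1 \<Longrightarrow> d \<le> x \<bullet> (M *v x)" by blast
  have bound: "d * (norm x)\<^sup>2 \<le> x \<bullet> (M *v x)" if "x \<in> V" for x
  proof (cases "x = 0")
    case False
    let ?u = "(1 / norm x) *\<^sub>R x"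
    have "d \<le> ?u \<bullet> (M *v ?u)"
      using False that V by (intro d) (auto simp: subspace_scale)
    also have "\<dots> = (x \<bullet> (M *v x)) / (norm x)\<^sup>2"
      by (simp add: matrix_vector_mult_scaleR power2_eq_square)
    finally show ?thesis using False by (simp add: field_simps)
  qed simp
  have "bounded {x\<in>V. x \<bullet> (M *v x) \<le> 1}"
  proof (rule boundedI)
    fix x assume x: "x \<in> {x\<in>V. x \<bullet> (M *v x) \<le> 1}"
    then have "d * (norm x)\<^sup>2 \<le> 1" using bound[of x] by auto
    then have "(norm x)\<^sup>2 \<le> 1 / d" using d(1) by (simp add: field_simps)
    then show "norm x \<le> sqrt (1 / d)" by (rule real_le_rsqrt)
  qed
  moreover have "closed {x\<in>V. x \<bullet> (M *v x) \<le> 1}"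
  proof -
    have "closed {x. x \<bullet> (M *v x) \<le> 1}" 
      by (rule closed_Collect_le) (use cont in auto)
    moreover have "{x\<in>V. x \<bullet> (M *v x) \<le> 1} = V \<inter> {x. x \<bullet> (M *v x) \<le> 1}" by auto
    ultimately show ?thesis using closed_subspace[OF V] by auto
  qed
  ultimately show ?thesis by (simp add: compact_eq_bounded_closed)
qed

text \<open>The leading singular pair of the pairing \<open>x \<bullet> w\<close>, with norms on the two sides given by the
  forms \<open>A\<close> and \<open>C\<close>.\<close>

lemma singular_pair_pd:
  fixes A C :: "real^'n^'n"
  assumes V: "subspace V" and W: "subspace W" and symA: "symmetric_mat A" and symC: "symmetric_mat C"
    and pA: "\<And>x. x \<in> V \<Longrightarrow> x \<noteq> 0 \<Longrightarrow> 0 < x \<bullet> (A *v x)"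
    and pC: "\<And>x. x \<in> W \<Longrightarrow> x \<noteq> 0 \<Longrightarrow> 0 < x \<bullet> (C *v x)"
    and x0: "x0 \<in> V" and w0: "w0 \<in> W" and xw: "x0 \<bullet> w0 \<noteq> 0"
  obtains e f \<mu> where "e \<in> V" "f \<in> W" "\<mu> > 0" "e \<bullet> f = \<mu>"
    "\<And>x. x \<in> V \<Longrightarrow> x \<bullet> f = \<mu> * (e \<bullet> (A *v x))" "\<And>w. w \<in> W \<Longrightarrow> w \<bullet> e = \<mu> * (f \<bullet> (C *v w))"
proof -
  let ?K = "{x\<in>V. x \<bullet> (A *v x) \<le> 1}" and ?L = "{x\<in>W. x \<bullet> (C *v x) \<le> 1}"
  have cp: "compact (?K \<times> ?L)"
    by (intro compact_Times compact_psd_ball V W pA pC)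
  have ne: "?K \<times> ?L \<noteq> {}"
    using subspace_0[OF V] subspace_0[OF W] by (auto intro!: exI[of _ 0])
  have "continuous_on (?K \<times> ?L) (\<lambda>(x, w). x \<bullet> w)"
    by (auto simp: case_prod_unfold intro!: continuous_intros)
  from continuous_attains_sup[OF cp ne this] obtain e f where
    e: "e \<in> ?K" and f: "f \<in> ?L" and mx: "\<And>x w. x \<in> ?K \<Longrightarrow> w \<in> ?L \<Longrightarrow> x \<bullet> w \<le> e \<bullet> f"
    by (auto simp: case_prod_unfold)
  define \<mu> where "\<mu> = e \<bullet> f"
  have nA: "0 \<le> x \<bullet> (A *v x)" if "x \<in> V" for x using pA[OF that] by (cases "x = 0") auto
  have nC: "0 \<le> x \<bullet> (C *v x)" if "x \<in> W" for x using pC[OF that] by (cases "x = 0") auto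
  \<comment> \<open>Homogeneity turns the maximum over the two balls into an inequality of
    Cauchy-Schwarz type.\<close>
  have le: "x \<bullet> w \<le> \<mu> * (sqrt (x \<bullet> (A *v x)) * sqrt (w \<bullet> (C *v w)))" if "x \<in> V" "w \<in> W" for x w
  proof (cases "x = 0 \<or> w = 0")
    case False
    define p q where "p = sqrt (x \<bullet> (A *v x))" and "q = sqrt (w \<bullet> (C *v w))"
    have pq: "p > 0" "q > 0" "p\<^sup>2 = x \<bullet> (A *v x)" "q\<^sup>2 = w \<bullet> (C *v w)"
      using False pA[OF that(1)] pC[OF that(2)] by (auto simp: p_def q_def)
    have "((1/p) *\<^sub>R x) \<bullet> ((1/q) *\<^sub>R w) \<le> e \<bullet> f"
      using pq that V W
      by (intro mx) (auto simp: subspace_scale matrix_vector_mult_scaleR pq(3,4)[symmetric] power2_eq_square)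
    then show ?thesis using pq by (simp add: \<mu>_def field_simps flip: p_def q_def)
  qed auto
  have \<mu>: "\<mu> > 0"
  proof -
    have "x0 \<noteq> 0" "w0 \<noteq> 0" using xw by auto
    then have p: "0 < sqrt (x0 \<bullet> (A *v x0)) * sqrt (w0 \<bullet> (C *v w0))"
      using pA[OF x0] pC[OF w0] by simp
    \<comment> \<open>The sign makes the pairing with \<open>w0\<close> positive.\<close>
    define x where "x = (if x0 \<bullet> w0 > 0 then x0 else - x0)"
    have "x \<in> V" "0 < x \<bullet> w0" "x \<bullet> (A *v x) = x0 \<bullet> (A *v x0)"
      using xw x0 V by (auto simp: x_def subspace_neg vec.neg)
    then have "0 < \<mu> * (sqrt (x0 \<bullet> (A *v x0)) * sqrt (w0 \<bullet> (C *v w0)))"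
      using le[of x w0] w0 by simp
    then show ?thesis using p by (simp add: zero_less_mult_iff)
  qed
  have sq: "(x \<bullet> w)\<^sup>2 \<le> \<mu>\<^sup>2 * ((x \<bullet> (A *v x)) * (w \<bullet> (C *v w)))" if "x \<in> V" "w \<in> W" for x w
  proof -
    have "\<bar>x \<bullet> w\<bar> \<le> \<mu> * (sqrt (x \<bullet> (A *v x)) * sqrt (w \<bullet> (C *v w)))"
      using le[OF that] le[of "-x" w] that V by (auto simp: subspace_neg vec.neg abs_if)
    then have "\<bar>x \<bullet> w\<bar>\<^sup>2 \<le> (\<mu> * (sqrt (x \<bullet> (A *v x)) * sqrt (w \<bullet> (C *v w))))\<^sup>2"
      by (intro power_mono) auto
    then show ?thesis using nA[OF that(1)] nC[OF that(2)] by (simp add: power_mult_distrib)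
  qed
  have eV: "e \<in> V" and fW: "f \<in> W" and e1: "e \<bullet> (A *v e) \<le> 1" and f1: "f \<bullet> (C *v f) \<le> 1"
    using e f by auto
  \<comment> \<open>Two factors of at most 1 whose product is at least 1 both equal 1, so the
    maximum sits on the boundary.\<close>
  have ef: "1 \<le> (e \<bullet> (A *v e)) * (f \<bullet> (C *v f))"
    using sq[OF eV fW] \<mu> by (simp add: \<mu>_def)
  have "(e \<bullet> (A *v e)) * (f \<bullet> (C *v f)) \<le> e \<bullet> (A *v e)" "(e \<bullet> (A *v e)) * (f \<bullet> (C *v f)) \<le> f \<bullet> (C *v f)"
    using mult_left_mono[OF f1 nA[OF eV]] mult_right_mono[OF e1 nC[OF fW]] by auto
  then have eq1: "e \<bullet> (A *v e) = 1" "f \<bullet> (C *v f) = 1"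
    using ef e1 f1 by auto
  \<comment> \<open>First order condition without derivatives: by the bound,
    \<open>\<mu>\<^sup>2 *\<^sub>R M - outer h\<close> is semidefinite on \<open>U\<close>; it
    vanishes at \<open>g\<close>, so \<open>g\<close> lies in its radical.\<close>
  have lagrange: "x \<bullet> h = \<mu> * (g \<bullet> (M *v x))"
    if U: "subspace U" and sym: "symmetric_mat M" and le: "\<And>x. x \<in> U \<Longrightarrow> (x \<bullet> h)\<^sup>2 \<le> \<mu>\<^sup>2 * (x \<bullet> (M *v x))"
      and g: "g \<in> U" "g \<bullet> h = \<mu>" "g \<bullet> (M *v g) = 1" and x: "x \<in> U"
    for U M g h x
  proof -
    let ?B = "\<mu>\<^sup>2 *\<^sub>R M - outer h"
    have B: "u \<bullet> (?B *v v) = \<mu>\<^sup>2 * (u \<bullet> (M *v v)) - (u \<bullet> h) * (v \<bullet> h)" for u v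
      by (simp add: matrix_vector_mult_diff_rdistrib scaleR_matrix_vector_assoc[symmetric] outer_vector_mult
          inner_diff_right inner_commute)
    have "g \<bullet> (?B *v x) = 0"
    proof (rule psd_kernel_on[OF U])
      show "symmetric_mat ?B"
        using sym symmetric_outer[of h] by (simp add: symmetric_mat_component)
      show "0 \<le> x \<bullet> (?B *v x)" if "x \<in> U" for x
        using le[OF that] unfolding B by (simp add: power2_eq_square)
      show "g \<bullet> (?B *v g) = 0" unfolding B by (simp add: g power2_eq_square)
    qed (use g x in auto)
    then show ?thesis using \<mu> g(2) unfolding B by (simp add: power2_eq_square)
  qed
  show ?thesis
  proof (rule that[OF eV fW \<mu>])
    show "e \<bullet> f = \<mu>" by (simp add: \<mu>_def)
    show "x \<bullet> f = \<mu> * (e \<bullet> (A *v x))" if "x \<in> V" for x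
      by (rule lagrange[OF V symA _ eV _ _ that]) (use sq[OF _ fW] eq1 in \<open>auto simp: \<mu>_def\<close>)
    show "w \<bullet> e = \<mu> * (f \<bullet> (C *v w))" if "w \<in> W" for w
      by (rule lagrange[OF W symC _ fW _ _ that]) (use sq[OF eV] eq1 in \<open>auto simp: \<mu>_def inner_commute\<close>)
  qed
qed

lemma subspace_split_orthogonal:
  fixes U V :: "'a::euclidean_space set"
  assumes "subspace U" "subspace V" "U \<subseteq> V" "x \<in> V"
  obtains y z where "x = y + z" "y \<in> U" "z \<in> V" "\<And>u. u \<in> U \<Longrightarrow> z \<bullet> u = 0"
proof -
  obtain y z where yz: "y \<in> span U" "\<And>w. w \<in> span U \<Longrightarrow> orthogonal z w" "x = y + z"
    using orthogonal_subspace_decomp_exists[of U x] by metis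
  have "z \<in> V" 
    using yz(1,3) assms subspace_diff[of V x y] by (auto simp: span_eq_iff[THEN iffD2])
  with yz show ?thesis
    using that[of y z] assms(1) by (auto simp: span_eq_iff[THEN iffD2] orthogonal_def)
qed

text \<open>The two vanishing hypotheses let the pairing descend to the quotients by the radicals,
  where the forms are definite. Orthogonal complements represent the quotients, and the identities
  extend back because the radicals contribute zero on both sides.\<close>

lemma singular_pair:
  fixes A C :: "real^'n^'n"
  assumes V: "subspace V" and W: "subspace W" and symA: "symmetric_mat A" and symC: "symmetric_mat C"
    and pA: "\<And>x. x \<in> V \<Longrightarrow> 0 \<le> x \<bullet> (A *v x)"
    and pC: "\<And>x. x \<in> W \<Longrightarrow> 0 \<le> x \<bullet> (C *v x)"
    and VW': "\<And>x w. x \<in> V \<Longrightarrow> w \<in> W \<Longrightarrow> w \<bullet> (C *v w) = 0 \<Longrightarrow> x \<bullet> w = 0"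
    and V'W: "\<And>x w. x \<in> V \<Longrightarrow> w \<in> W \<Longrightarrow> x \<bullet> (A *v x) = 0 \<Longrightarrow> x \<bullet> w = 0"
    and x0: "x0 \<in> V" and w0: "w0 \<in> W" and xw: "x0 \<bullet> w0 \<noteq> 0"
  obtains e f \<mu> where "e \<in> V" "f \<in> W" "\<mu> > 0" "e \<bullet> f = \<mu>"
    "\<And>x. x \<in> V \<Longrightarrow> x \<bullet> f = \<mu> * (e \<bullet> (A *v x))" "\<And>w. w \<in> W \<Longrightarrow> w \<bullet> e = \<mu> * (f \<bullet> (C *v w))"
proof -
  define V0 where "V0 = {x\<in>V. x \<bullet> (A *v x) = 0}"
  define W0 where "W0 = {x\<in>W. x \<bullet> (C *v x) = 0}"
  define V1 where "V1 = {x\<in>V. \<forall>u\<in>V0. x \<bullet> u = 0}"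
  define W1 where "W1 = {x\<in>W. \<forall>u\<in>W0. x \<bullet> u = 0}"
  have V0: "subspace V0" unfolding V0_def by (rule subspace_psd_null[OF V symA pA])
  have W0: "subspace W0" unfolding W0_def by (rule subspace_psd_null[OF W symC pC])
  have V1: "subspace V1" using V by (auto simp: V1_def subspace_def inner_add_left)
  have W1: "subspace W1" using W by (auto simp: W1_def subspace_def inner_add_left)
  have splitV: "\<exists>y z. x = y + z \<and> y \<in> V0 \<and> z \<in> V1" if "x \<in> V" for x
  proof -
    have "V0 \<subseteq> V" by (auto simp: V0_def)
    from subspace_split_orthogonal[OF V0 V this that] obtain y z
      where "x = y + z" "y \<in> V0" "z \<in> V" "\<And>u. u \<in> V0 \<Longrightarrow> z \<bullet> u = 0" by blast
    then show ?thesis by (intro exI[of _ y] exI[of _ z]) (simp add: V1_def)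
  qed
  have splitW: "\<exists>y z. x = y + z \<and> y \<in> W0 \<and> z \<in> W1" if "x \<in> W" for x
  proof -
    have "W0 \<subseteq> W" by (auto simp: W0_def)
    from subspace_split_orthogonal[OF W0 W this that] obtain y z
      where "x = y + z" "y \<in> W0" "z \<in> W" "\<And>u. u \<in> W0 \<Longrightarrow> z \<bullet> u = 0" by blast
    then show ?thesis by (intro exI[of _ y] exI[of _ z]) (simp add: W1_def)
  qed
  obtain y z where x0': "x0 = y + z" "y \<in> V0" "z \<in> V1" using splitV[OF x0] by blast
  obtain u v where w0': "w0 = u + v" "u \<in> W0" "v \<in> W1" using splitW[OF w0] by blast
  have zv: "z \<bullet> v \<noteq> 0"
    using xw x0' w0' V'W[of y u] V'W[of y v] VW'[of z u] 
    by (auto simp: inner_add_left inner_add_right V0_def V1_def W0_def W1_def)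
  have pA1: "0 < x \<bullet> (A *v x)" if "x \<in> V1" "x \<noteq> 0" for x
  proof (rule ccontr)
    assume "\<not> ?thesis"
    then have "x \<in> V0" using that pA[of x] by (auto simp: V0_def V1_def)
    then have "x \<bullet> x = 0" using that by (auto simp: V1_def)
    then show False using that by simp
  qed
  have pC1: "0 < x \<bullet> (C *v x)" if "x \<in> W1" "x \<noteq> 0" for x
  proof (rule ccontr)
    assume "\<not> ?thesis"
    then have "x \<in> W0" using that pC[of x] by (auto simp: W0_def W1_def)
    then have "x \<bullet> x = 0" using that by (auto simp: W1_def)
    then show False using that by simp
  qed
  obtain e f \<mu> where ef: "e \<in> V1" "f \<in> W1" "\<mu> > 0" "e \<bullet> f = \<mu>"
    "\<And>x. x \<in> V1 \<Longrightarrow> x \<bullet> f = \<mu> * (e \<bullet> (A *v x))" "\<And>w. w \<in> W1 \<Longrightarrow> w \<bullet> e = \<mu> * (f \<bullet> (C *v w))"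
    by (rule singular_pair_pd[OF V1 W1 symA symC pA1 pC1 x0'(3) w0'(3) zv]) auto
  have eV: "e \<in> V" and fW: "f \<in> W" using ef by (auto simp: V1_def W1_def)
  show ?thesis
  proof (rule that[OF eV fW ef(3,4)])
    fix x assume "x \<in> V"
    then obtain y z where x: "x = y + z" "y \<in> V0" "z \<in> V1" using splitV by blast
    have "y \<bullet> f = 0" using V'W[of y f] x fW by (auto simp: V0_def)
    moreover have "y \<bullet> (A *v e) = 0"
      using psd_kernel_on[OF V symA pA _ _ eV, of y] x by (auto simp: V0_def)
    ultimately show "x \<bullet> f = \<mu> * (e \<bullet> (A *v x))"
      using ef(5)[OF x(3)] symmetric_inner_commute[OF symA, of y e]
      by (simp add: x(1) inner_add_left matrix_vector_right_distrib inner_add_right)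
  next
    fix x assume "x \<in> W"
    then obtain y z where x: "x = y + z" "y \<in> W0" "z \<in> W1" using splitW by blast
    have "y \<bullet> e = 0" using VW'[of e y] x eV by (auto simp: W0_def inner_commute)
    moreover have "y \<bullet> (C *v f) = 0"
      using psd_kernel_on[OF W symC pC _ _ fW, of y] x by (auto simp: W0_def)
    ultimately show "x \<bullet> e = \<mu> * (f \<bullet> (C *v x))"
      using ef(6)[OF x(3)] symmetric_inner_commute[OF symC, of y f]
      by (simp add: x(1) inner_add_left matrix_vector_right_distrib inner_add_right)
  qed
qed

section \<open>Bases adapted to two flags in duality\<close>

text \<open>Spanning is asked at every level of the flag, and orthogonality at level
  \<open>i\<close> only of vectors still present there. Independence comes later, from the dual
  vectors.\<close>

definition adapted :: "(real^'n) set \<Rightarrow> (real^'n^'n) list \<Rightarrow> (real^'n) set \<Rightarrow> bool" where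
  "adapted N As E \<longleftrightarrow> E \<subseteq> N \<and>
     (\<forall>i<length As. \<forall>e\<in>E \<inter> fr_space N As i. \<forall>e'\<in>E \<inter> fr_space N As i.
        e \<noteq> e' \<longrightarrow> e \<bullet> (As ! i *v e') = 0) \<and>
     (\<forall>i\<le>length As. fr_space N As i \<subseteq> span (E \<inter> fr_space N As i))"

lemma adapted_subset: "adapted N As E \<Longrightarrow> E \<subseteq> N"
  by (simp add: adapted_def)

lemma adapted_orthogonal:
  assumes "adapted N As E" "i < length As" "e \<in> E" "e' \<in> E"
    "e \<in> fr_space N As i" "e' \<in> fr_space N As i" "e \<noteq> e'"
  shows "e \<bullet> (As ! i *v e') = 0"
  using assms unfolding adapted_def by blast

text \<open>There are three kinds of levels: below \<open>i0\<close> the vector \<open>e\<close>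
  lies in the radical, at \<open>i0\<close> orthogonality to \<open>e\<close> is the same as
  orthogonality to \<open>g\<close>, and above \<open>i0\<close> it has left the flag. The factor
  \<open>\<mu>\<close> accommodates the different normalizations of the two flags.\<close>

lemma adapted_insert:
  fixes As :: "(real^'n^'n) list"
  assumes N: "subspace N" and ch: "fr_chain N As" and i0: "i0 < length As"
    and e: "e \<in> fr_space N As i0" and pos: "e \<bullet> (As ! i0 *v e) > 0" and \<mu>: "\<mu> > 0"
    and g: "\<And>x. x \<in> fr_space N As i0 \<Longrightarrow> x \<bullet> g = \<mu> * (e \<bullet> (As ! i0 *v x))"
    and ad: "adapted (N \<inter> {x. x \<bullet> g = 0}) As E"
  shows "adapted N As (insert e E)"
proof -
  let ?V = "fr_space N As"
  have E: "E \<subseteq> N" "\<And>x. x \<in> E \<Longrightarrow> x \<bullet> g = 0" using ad by (auto simp: adapted_def)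
  have V: "subspace (?V i)" if "i \<le> length As" for i
    by (rule subspace_fr_space[OF N ch that])
  have V': "fr_space (N \<inter> {x. x \<bullet> g = 0}) As i = ?V i \<inter> {x. x \<bullet> g = 0}" for i
    by (rule fr_space_inter)
  have eNotSuc: "e \<notin> ?V i" if "i0 < i" for i
    using fr_space_antimono[of "Suc i0" i N As] that pos by (auto simp: fr_space_Suc)
  have kern: "e \<bullet> (As ! i *v x) = 0" if "i < i0" "x \<in> ?V i" for i x
  proof (rule psd_kernel_on[OF V[of i]])
    have "e \<in> ?V (Suc i)" using fr_space_antimono[of "Suc i" i0 N As] that e by auto
    then show "e \<in> ?V i" "e \<bullet> (As ! i *v e) = 0" by (auto simp: fr_space_Suc)
  qed (use that i0 fr_chainD[OF ch] in auto)
  \<comment> \<open>Above level \<open>i0\<close> the flag already lies in the hyperplane orthogonal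
    to \<open>g\<close>, so the old vectors still span there.\<close>
  have Suc0: "x \<bullet> g = 0" if "x \<in> ?V (Suc i0)" for x
  proof -
    have "x \<bullet> (As ! i0 *v e) = 0"
      by (rule psd_kernel_on[OF V[of i0]]) (use that i0 fr_chainD[OF ch i0] e in \<open>auto simp: fr_space_Suc\<close>)
    then show ?thesis using g[of x] that symmetric_inner_commute[of "As ! i0" x e] fr_chainD[OF ch i0]
      by (auto simp: fr_space_Suc)
  qed
  have key: "e \<bullet> (As ! i *v x) = 0" if "i < length As" "e \<in> ?V i" "x \<in> E" "x \<in> ?V i" for i x
  proof (cases i i0 rule: linorder_cases)
    case less then show ?thesis using kern that by simp
  next
    case equal then show ?thesis using g[of x] E(2)[OF that(3)] that \<mu> by simp
  next
    case greater then show ?thesis using eNotSuc that by simp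
  qed
  show ?thesis
    unfolding adapted_def
  proof (intro conjI allI impI ballI)
    show "insert e E \<subseteq> N" using E e by (auto simp: fr_space_def)
  next
    fix i a b assume i: "i < length As" and ab: "a \<in> insert e E \<inter> ?V i" "b \<in> insert e E \<inter> ?V i" "a \<noteq> b"
    consider "a = e" "b \<in> E" | "b = e" "a \<in> E" | "a \<in> E" "b \<in> E" using ab by auto
    then show "a \<bullet> (As ! i *v b) = 0"
    proof cases
      case 1 then show ?thesis using key i ab by auto
    next
      case 2 then show ?thesis using key[of i a] i ab symmetric_inner_commute[OF fr_chainD(1)[OF ch i], of a e] by auto
    next
      case 3 then show ?thesis using ad i ab E unfolding adapted_def V' by blast
    qed
  next
    fix i assume i: "i \<le> length As"
    let ?S = "insert e E \<inter> ?V i"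
    have sub: "E \<inter> (?V i \<inter> {x. x \<bullet> g = 0}) \<subseteq> ?S" by auto
    have sp: "x \<in> span ?S" if "x \<in> ?V i" "x \<bullet> g = 0" for x
      using ad i that span_mono[OF sub] unfolding adapted_def V' by blast
    show "?V i \<subseteq> span ?S"
    proof
      fix x assume x: "x \<in> ?V i"
      show "x \<in> span ?S"
      proof (cases "i \<le> i0")
        case True
        then have ei: "e \<in> ?V i" using e fr_space_antimono by blast
        \<comment> \<open>Removing this multiple of \<open>e\<close> moves \<open>x\<close> into the
          hyperplane.\<close>
        define c where "c = (x \<bullet> g) / (e \<bullet> g)"
        have "e \<bullet> g \<noteq> 0" using g[OF e] pos \<mu> by simp
        then have "x - c *\<^sub>R e \<in> span ?S"
          using V[OF i] ei x by (intro sp) (auto simp: c_def inner_diff_left subspace_diff subspace_scale)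
        moreover have "c *\<^sub>R e \<in> span ?S" using ei by (auto intro: span_scale span_base)
        ultimately have "(x - c *\<^sub>R e) + c *\<^sub>R e \<in> span ?S" by (rule span_add)
        then show ?thesis by simp
      next
        case False
        then have "x \<in> ?V (Suc i0)" using x fr_space_antimono[of "Suc i0" i N As] by auto
        then show ?thesis using sp x Suc0 by blast
      qed
    qed
  qed
qed

text \<open>Induction on the dimension: a biorthogonal pair is split off, and each space shrinks to
  the hyperplane orthogonal to the vector taken from the other. The last two hypotheses, that the
  pairing is perfect, pass to these hyperplanes.\<close>

lemma biorthogonal_adapted_bases:
  fixes As Cs :: "(real^'n^'n) list"
  assumes "subspace N" "subspace M" "fr_chain N As" "fr_chain M Cs"
    and "fr_space N As (length As) = {0}" "fr_space M Cs (length Cs) = {0}"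
    and "\<And>x. x \<in> N \<Longrightarrow> (\<And>y. y \<in> M \<Longrightarrow> x \<bullet> y = 0) \<Longrightarrow> x = 0"
    and "\<And>y. y \<in> M \<Longrightarrow> (\<And>x. x \<in> N \<Longrightarrow> x \<bullet> y = 0) \<Longrightarrow> y = 0"
  obtains B where "finite B" "\<And>e f. (e, f) \<in> B \<Longrightarrow> e \<bullet> f = 1"
    "\<And>e f e' f'. (e, f) \<in> B \<Longrightarrow> (e', f') \<in> B \<Longrightarrow> (e, f) \<noteq> (e', f') \<Longrightarrow> e \<bullet> f' = 0"
    "adapted N As (fst ` B)" "adapted M Cs (snd ` B)"
  using assms
proof (induction "dim N" arbitrary: N M thesis rule: less_induct)
  case less
  note N = less.prems(2) and M = less.prems(3) and chN = less.prems(4) and chM = less.prems(5)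
    and endN = less.prems(6) and endM = less.prems(7) and pairN = less.prems(8) and pairM = less.prems(9)
  show ?case
  proof (cases "N = {0}")
    case True
    then have M0: "M = {0}" using pairM subspace_0[OF M] by auto
    have "fr_space {0} As i \<subseteq> span {}" for i and As :: "(real^'n^'n) list" 
      by (auto simp: fr_space_def)
    then have "adapted {0} As {}" for As :: "(real^'n^'n) list" by (auto simp: adapted_def)
    then show ?thesis using True M0 by (intro less.prems(1)[of "{}"]) auto
  next
    case False
    let ?V = "fr_space N As" and ?W = "fr_space M Cs"
    \<comment> \<open>Pairs of levels with a nontrivial pairing. When \<open>i + j\<close> is as
      large as possible, one level deeper on either side kills the pairing, which are the vanishing
      hypotheses of \<open>singular_pair\<close>.\<close>
    define P where "P = (\<lambda>(i, j). i \<le> length As \<and> j \<le> length Cs \<and> (\<exists>x\<in>?V i. \<exists>w\<in>?W j. x \<bullet> w \<noteq> 0))"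
    have P0: "P (0, 0)" using False pairN subspace_0[OF N] by (auto simp: P_def)
    have Pb: "\<forall>y. P y \<longrightarrow> fst y + snd y < Suc (length As + length Cs)" by (auto simp: P_def)
    obtain p where p: "P p" "\<forall>y. P y \<longrightarrow> fst y + snd y \<le> fst p + snd p"
      using ex_has_greatest_nat[OF P0 Pb] by blast
    obtain i j where ij: "p = (i, j)" by force
    obtain x0 w0 where xw: "x0 \<in> ?V i" "w0 \<in> ?W j" "x0 \<bullet> w0 \<noteq> 0" and ijle: "i \<le> length As" "j \<le> length Cs"
      using p(1) by (auto simp: P_def ij)
    have "i \<noteq> length As"
    proof
      assume "i = length As"
      then have "x0 = 0" using xw(1) endN by simp
      then show False using xw(3) by simp
    qed
    moreover have "j \<noteq> length Cs"
    proof
      assume "j = length Cs"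
      then have "w0 = 0" using xw(2) endM by simp
      then show False using xw(3) by simp
    qed
    ultimately have il: "i < length As" and jl: "j < length Cs" using ijle by simp_all
    have V: "subspace (?V i)" and W: "subspace (?W j)"
      using subspace_fr_space[OF N chN] subspace_fr_space[OF M chM] ijle by auto
    have nV: "x \<bullet> w = 0" if "x \<in> ?V (Suc i)" "w \<in> ?W j" for x w
      using p(2)[rule_format, of "(Suc i, j)"] that il ijle by (auto simp: ij P_def)
    have nW: "x \<bullet> w = 0" if "x \<in> ?V i" "w \<in> ?W (Suc j)" for x w
      using p(2)[rule_format, of "(i, Suc j)"] that jl ijle by (auto simp: ij P_def)
    have nW': "x \<bullet> w = 0" if "x \<in> ?V i" "w \<in> ?W j" "w \<bullet> (Cs ! j *v w) = 0" for x w
      by (rule nW) (use that in \<open>simp_all add: fr_space_Suc\<close>)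
    have nV': "x \<bullet> w = 0" if "x \<in> ?V i" "w \<in> ?W j" "x \<bullet> (As ! i *v x) = 0" for x w
      by (rule nV) (use that in \<open>simp_all add: fr_space_Suc\<close>)
    have sA: "symmetric_mat (As ! i)" and sC: "symmetric_mat (Cs ! j)"
      using fr_chainD(1)[OF chN il] fr_chainD(1)[OF chM jl] .
    obtain e f \<mu> where ef: "e \<in> ?V i" "f \<in> ?W j" "\<mu> > 0" "e \<bullet> f = \<mu>"
      "\<And>x. x \<in> ?V i \<Longrightarrow> x \<bullet> f = \<mu> * (e \<bullet> (As ! i *v x))" "\<And>w. w \<in> ?W j \<Longrightarrow> w \<bullet> e = \<mu> * (f \<bullet> (Cs ! j *v w))"
      by (rule singular_pair[OF V W sA sC fr_chainD(2)[OF chN il] fr_chainD(2)[OF chM jl] nW' nV' xw]; (assumption | rule that))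
    \<comment> \<open>Normalizes the pairing with \<open>e\<close> to 1; the scale then shows up as
      1 in \<open>gA\<close> and as \<open>\<mu> * \<mu>\<close> in \<open>gC\<close>.\<close>
    define f' where "f' = (1/\<mu>) *\<^sub>R f"
    have f': "f' \<in> ?W j" "e \<bullet> f' = 1" and ff': "f = \<mu> *\<^sub>R f'" 
      using ef W by (auto simp: f'_def subspace_scale)
    have gA: "x \<bullet> f' = 1 * (e \<bullet> (As ! i *v x))" if "x \<in> ?V i" for x
      using ef(5)[OF that] ef(3) by (simp add: f'_def)
    have gC: "w \<bullet> e = (\<mu> * \<mu>) * (f' \<bullet> (Cs ! j *v w))" if "w \<in> ?W j" for w
      using ef(6)[OF that] by (simp add: ff')
    have posA: "e \<bullet> (As ! i *v e) > 0" using gA[OF ef(1)] f'(2) by simp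
    have posC: "f' \<bullet> (Cs ! j *v f') > 0"
      using gC[OF f'(1)] f'(2) ef(3) by (smt (verit) inner_commute zero_less_mult_iff)
    have eN: "e \<in> N" and fM: "f' \<in> M" using ef(1) f'(1) by (auto simp: fr_space_def)
    let ?N = "N \<inter> {x. x \<bullet> f' = 0}" and ?M = "M \<inter> {x. x \<bullet> e = 0}"
    have sN: "subspace ?N" and sM: "subspace ?M"
      using N M by (auto simp: subspace_def inner_add_left)
    have d: "dim ?N < dim N"
    proof -
      have "e \<notin> ?N" using f'(2) by auto
      then have "?N \<noteq> N" using eN by auto
      then show ?thesis using subspace_dim_equal[OF sN N] dim_subset[of ?N N] by force
    qed
    have zN: "fr_space ?N As (length As) = {0}" and zM: "fr_space ?M Cs (length Cs) = {0}"
      using endN endM by (auto simp: fr_space_inter)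
    \<comment> \<open>Subtracting a multiple of \<open>f'\<close> moves \<open>y\<close> into the
      smaller space and does not change its pairing with \<open>x\<close>.\<close>
    have pN: "x = 0" if x: "x \<in> ?N" and o: "\<And>y. y \<in> ?M \<Longrightarrow> x \<bullet> y = 0" for x
    proof (rule pairN)
      show "x \<in> N" using x by auto
      fix y assume "y \<in> M"
      then have "y - (y \<bullet> e) *\<^sub>R f' \<in> ?M"
        using fM M f'(2) by (auto simp: subspace_diff subspace_scale inner_diff_left inner_commute[of f'])
      from o[OF this] show "x \<bullet> y = 0" using x by (simp add: inner_diff_right)
    qed
    have pM: "y = 0" if y: "y \<in> ?M" and o: "\<And>x. x \<in> ?N \<Longrightarrow> x \<bullet> y = 0" for y
    proof (rule pairM)
      show "y \<in> M" using y by auto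
      fix x assume "x \<in> N"
      then have "x - (x \<bullet> f') *\<^sub>R e \<in> ?N"
        using eN N f'(2) by (auto simp: subspace_diff subspace_scale inner_diff_left)
      from o[OF this] show "x \<bullet> y = 0" using y by (simp add: inner_diff_left inner_commute[of e])
    qed
    obtain B where B: "finite B" "\<And>e f. (e, f) \<in> B \<Longrightarrow> e \<bullet> f = 1"
      "\<And>e f e' f'. (e, f) \<in> B \<Longrightarrow> (e', f') \<in> B \<Longrightarrow> (e, f) \<noteq> (e', f') \<Longrightarrow> e \<bullet> f' = 0"
      "adapted ?N As (fst ` B)" "adapted ?M Cs (snd ` B)"
      by (rule less.hyps[OF d _ sN sM fr_chain_inter[OF chN] fr_chain_inter[OF chM] zN zM pN pM]; (assumption | rule that))
    have perp: "u \<bullet> f' = 0" "e \<bullet> v = 0" if "(u, v) \<in> B" for u v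
    proof -
      have "fst (u, v) \<in> ?N" by (rule subsetD[OF adapted_subset[OF B(4)] imageI[OF that]])
      moreover have "snd (u, v) \<in> ?M" by (rule subsetD[OF adapted_subset[OF B(5)] imageI[OF that]])
      ultimately show "u \<bullet> f' = 0" "e \<bullet> v = 0" by (simp_all add: inner_commute)
    qed
    show ?thesis
    proof (rule less.prems(1)[of "insert (e, f') B"])
      show "adapted N As (fst ` insert (e, f') B)"
        using adapted_insert[OF N chN il ef(1) posA _ gA B(4)] by simp
      show "adapted M Cs (snd ` insert (e, f') B)"
        using adapted_insert[OF M chM jl f'(1) posC _ gC B(5)] ef(3) by simp
    qed (use B perp f' in auto)
  qed
qed

section \<open>Existence of facial reduction sequences\<close>

text \<open>The relative interior of the face of psd matrices with range in \<open>V\<close>.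
  Positivity is asked on \<open>V\<close> only; \<open>relint_face_psd\<close> recovers
  semidefiniteness on the whole space.\<close>

definition relint_face :: "(real^'n) set \<Rightarrow> (real^'n^'n) set" where
  "relint_face V = {M. symmetric_mat M \<and> range ((*v) M) \<subseteq> V \<and> (\<forall>x\<in>V. x \<noteq> 0 \<longrightarrow> 0 < x \<bullet> (M *v x))}"

lemma relint_face_psd:
  assumes V: "subspace V" and M: "M \<in> relint_face V"
  shows "psd M"
  unfolding psd_def
proof (intro conjI allI)
  show sym: "symmetric_mat M" using M by (simp add: relint_face_def)
  fix x
  obtain y z where yz: "x = y + z" "y \<in> V" "\<And>u. u \<in> V \<Longrightarrow> z \<bullet> u = 0"
    using subspace_split_orthogonal[OF V subspace_UNIV, of x] by auto
  have z: "z \<bullet> (M *v u) = 0" for u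
    using yz(3) M by (auto simp: relint_face_def)
  have "x \<bullet> (M *v x) = y \<bullet> (M *v y)"
    using z[of y] z[of z] symmetric_inner_commute[OF sym, of y z]
    by (simp add: yz(1) inner_add_left matrix_vector_right_distrib inner_add_right)
  also have "\<dots> \<ge> 0" using M yz(2) by (cases "y = 0") (auto simp: relint_face_def less_imp_le)
  finally show "0 \<le> x \<bullet> (M *v x)" .
qed

lemma dim_le_rank_relint_face:
  assumes V: "subspace V" and M: "M \<in> relint_face V"
  shows "dim V \<le> rank M"
proof -
  have "inj_on ((*v) M) V"
  proof (rule inj_onI)
    fix x y assume xy: "x \<in> V" "y \<in> V" "M *v x = M *v y"
    then have "(x - y) \<bullet> (M *v (x - y)) = 0" "x - y \<in> V"
      using V by (auto simp: matrix_vector_mult_diff_distrib subspace_diff)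
    then show "x = y" using M by (auto simp: relint_face_def)
  qed
  then have "dim V = dim ((*v) M ` V)"
    using V by (intro dim_image_eq[symmetric]) (auto simp: span_eq_iff[THEN iffD2])
  also have "\<dots> \<le> dim (range ((*v) M))" by (intro dim_subset) auto
  finally show ?thesis by (simp add: rank_dim_range)
qed

lemma relint_face_add_psd:
  assumes V: "subspace V" and M: "M \<in> relint_face V" and P: "psd P" "range ((*v) P) \<subseteq> V"
  shows "M + P \<in> relint_face V"
  using assms unfolding relint_face_def
  by (auto simp: psd_def symmetric_mat_component matrix_vector_mult_add_rdistrib inner_add_right
      add_pos_nonneg subspace_add image_subset_iff)

lemma relint_face_scale:
  assumes V: "subspace V" and M: "M \<in> relint_face V" and t: "t > 0"
  shows "t *\<^sub>R M \<in> relint_face V"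
  using assms unfolding relint_face_def
  by (auto simp: symmetric_mat_component scaleR_matrix_vector_assoc[symmetric] subspace_scale image_subset_iff)

lemma relint_face_nonempty:
  fixes V :: "(real^'n) set"
  assumes V: "subspace V"
  shows "relint_face V \<noteq> {}"
proof -
  obtain B where B: "B \<subseteq> V" "independent B" "V \<subseteq> span B"
    using basis_exists[of V] by metis
  have fin: "finite B" using B(2) by (rule independent_imp_finite)
  \<comment> \<open>Its form is a sum of squares of \<open>b \<bullet> x\<close>, and on
    \<open>V\<close> these vanish together only at 0.\<close>
  let ?M = "\<Sum>b\<in>B. outer b"
  have Mx: "?M *v x = (\<Sum>b\<in>B. (b \<bullet> x) *\<^sub>R b)" for x
    by (simp add: matrix_vector_mult_sum outer_vector_mult)
  have "symmetric_mat ?M"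
    using subspace_sum[OF subspace_symmetric_mat, of B outer] symmetric_outer by auto
  moreover have "range ((*v) ?M) \<subseteq> V"
    unfolding Mx using B(1) V by (auto intro!: subspace_sum subspace_scale)
  moreover have "0 < x \<bullet> (?M *v x)" if x: "x \<in> V" "x \<noteq> 0" for x
  proof (rule ccontr)
    have eq: "x \<bullet> (?M *v x) = (\<Sum>b\<in>B. (b \<bullet> x)\<^sup>2)"
      by (simp add: Mx inner_sum_right power2_eq_square inner_commute)
    assume "\<not> ?thesis"
    moreover have "(\<Sum>b\<in>B. (b \<bullet> x)\<^sup>2) \<ge> 0" by (intro sum_nonneg) auto
    ultimately have "(\<Sum>b\<in>B. (b \<bullet> x)\<^sup>2) = 0" using eq by simp
    then have "\<forall>b\<in>B. orthogonal x b"
      using fin by (simp add: sum_nonneg_eq_0_iff orthogonal_def inner_commute)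
    moreover have "x \<in> span B" using B x by auto
    ultimately have "orthogonal x x" by (metis orthogonal_to_span)
    then show False using x by (simp add: orthogonal_def)
  qed
  ultimately have "?M \<in> relint_face V" by (auto simp: relint_face_def)
  then show ?thesis by auto
qed

lemma convex_relint_face: 
  assumes "subspace V" shows "convex (relint_face V)"
  unfolding convex_alt
proof (intro ballI allI impI)
  fix M P u assume MP: "M \<in> relint_face V" "P \<in> relint_face V" and u: "(0::real) \<le> u \<and> u \<le> 1"
  show "(1 - u) *\<^sub>R M + u *\<^sub>R P \<in> relint_face V"
  proof (cases "u = 0 \<or> u = 1")
    case False
    then have "(1 - u) *\<^sub>R M \<in> relint_face V" "u *\<^sub>R P \<in> relint_face V"
      using u MP relint_face_scale[OF assms] by auto
    moreover from this(2) have "psd (u *\<^sub>R P)" "range ((*v) (u *\<^sub>R P)) \<subseteq> V"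
      using relint_face_psd[OF assms] by (auto simp: relint_face_def)
    ultimately show ?thesis using relint_face_add_psd[OF assms] by blast
  qed (use MP in auto)
qed

lemma outer_range: "subspace V \<Longrightarrow> v \<in> V \<Longrightarrow> range ((*v) (outer v)) \<subseteq> V"
  by (auto simp: outer_vector_mult subspace_scale)

lemma nonneg_if_affine_bound:
  fixes a b :: real
  assumes "\<And>t. t > 0 \<Longrightarrow> 0 \<le> a + t * b" shows "0 \<le> b"
proof (rule ccontr)
  assume "\<not> 0 \<le> b"
  then have "0 < (\<bar>a\<bar> + 1) / (-b)" by (intro divide_pos_pos) auto
  moreover have "(\<bar>a\<bar> + 1) / (-b) * b = - (\<bar>a\<bar> + 1)" using \<open>\<not> 0 \<le> b\<close> by (simp add: field_simps)
  ultimately show False using assms[of "(\<bar>a\<bar> + 1) / (-b)"] by linarith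
qed

text \<open>Separates \<open>X + H\<close> from the relative interior of the face. Taking the normal in the span of the
  difference set keeps it from vanishing on \<open>V\<close>.\<close>

lemma facial_reduction_step:
  fixes X :: "real^'n^'n"
  assumes H: "subspace H" and Hsym: "\<And>h. h \<in> H \<Longrightarrow> symmetric_mat h"
    and V: "subspace V" and X: "psd X" "range ((*v) X) \<subseteq> V"
    and disj: "\<And>h. h \<in> H \<Longrightarrow> X + h \<notin> relint_face V"
  obtains S where "symmetric_mat S" "\<And>h. h \<in> H \<Longrightarrow> inner S h = 0" "inner S X = 0"
    "\<And>v. v \<in> V \<Longrightarrow> 0 \<le> v \<bullet> (S *v v)" "\<exists>v\<in>V. v \<bullet> (S *v v) \<noteq> 0"
proof -
  let ?D = "relint_face V"
  define D where "D = (\<Union>M\<in>?D. \<Union>h\<in>H. {M - (X + h)})"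
  have DI: "M - (X + h) \<in> D" if "M \<in> ?D" "h \<in> H" for M h using that by (auto simp: D_def)
  have "convex {(X + h) | h. h \<in> H}"
    using convex_translation[OF subspace_imp_convex[OF H], of X] by (simp add: image_def Bex_def conj_commute)
  moreover have "D = (\<Union>M\<in>?D. \<Union>h\<in>{(X + h) | h. h \<in> H}. {M - h})" by (auto simp: D_def)
  ultimately have "convex D"
    using convex_differences[OF convex_relint_face[OF V]] by simp
  moreover obtain M0 where M0: "M0 \<in> ?D" using relint_face_nonempty[OF V] by auto
  then have "D \<noteq> {}" using DI subspace_0[OF H] by blast
  moreover have "0 \<notin> D" using disj by (auto simp: D_def)
  ultimately obtain S where S: "S \<in> span D" "S \<noteq> 0" "\<And>x. x \<in> D \<Longrightarrow> 0 \<le> S \<bullet> x"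
    using separating_hyperplane_set_0_inspan[of D] by blast
  have "D \<subseteq> {M. symmetric_mat M}"
    using X Hsym by (auto simp: D_def relint_face_def psd_def symmetric_mat_component)
  then have sym: "symmetric_mat S"
    using S(1) span_minimal[OF _ subspace_symmetric_mat] by auto
  have ge: "0 \<le> S \<bullet> M - S \<bullet> X - S \<bullet> h" if "M \<in> ?D" "h \<in> H" for M h
    using S(3)[OF DI[OF that]] by (simp add: inner_diff_right inner_add_right)
  \<comment> \<open>A functional bounded on one side on a subspace vanishes there.\<close>
  have SH: "S \<bullet> h = 0" if h: "h \<in> H" for h
  proof -
    have "0 \<le> - (S \<bullet> h)" if "h \<in> H" for h
      by (rule nonneg_if_affine_bound[where a = "S \<bullet> M0 - S \<bullet> X"])
         (use ge[OF M0 subspace_scale[OF H that]] in \<open>auto simp: algebra_simps\<close>)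
    from this[OF h] this[OF subspace_neg[OF H h]] show ?thesis by simp
  qed
  \<comment> \<open>Adding any positive multiple of \<open>outer v\<close> stays in the relative
    interior, where the functional is bounded below.\<close>
  have pos: "0 \<le> v \<bullet> (S *v v)" if v: "v \<in> V" for v
  proof (rule nonneg_if_affine_bound[where a = "S \<bullet> M0 - S \<bullet> X"])
    fix t :: real assume "t > 0"
    have "outer (sqrt t *\<^sub>R v) = t *\<^sub>R outer v"
      using \<open>t > 0\<close> by (simp add: outer_def vec_eq_iff)
    then have "M0 + t *\<^sub>R outer v \<in> ?D"
      using relint_face_add_psd[OF V M0 psd_outer outer_range[OF V subspace_scale[OF V v, of "sqrt t"]]] by simp
    from ge[OF this subspace_0[OF H]] show "0 \<le> S \<bullet> M0 - S \<bullet> X + t * (v \<bullet> (S *v v))"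
      by (simp add: inner_add_right inner_outer algebra_simps)
  qed
  \<comment> \<open>Shrinking \<open>M0\<close> towards 0 within the relative interior makes its
    contribution negligible.\<close>
  have "0 \<le> - (S \<bullet> X)"
  proof (rule field_le_epsilon)
    fix c :: real assume c: "c > 0"
    define t where "t = c / (\<bar>S \<bullet> M0\<bar> + 1)"
    have t: "t > 0" using c by (simp add: t_def)
    have "t * (S \<bullet> M0) \<le> t * (\<bar>S \<bullet> M0\<bar> + 1)"
      using t by (intro mult_left_mono) auto
    also have "\<dots> = c" by (simp add: t_def)
    finally show "0 \<le> - (S \<bullet> X) + c"
      using ge[OF relint_face_scale[OF V M0 t] subspace_0[OF H]] by simp
  qed
  moreover have "0 \<le> S \<bullet> X" by (rule inner_psd_nonneg_on[OF X pos])
  ultimately have SX: "S \<bullet> X = 0" by simp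
  \<comment> \<open>Otherwise \<open>S\<close> would annihilate the relative interior, hence
    \<open>D\<close>, although it is a nonzero element of the span of \<open>D\<close>.\<close>
  have "\<exists>v\<in>V. v \<bullet> (S *v v) \<noteq> 0"
  proof (rule ccontr)
    assume "\<not> ?thesis"
    then have z: "v \<bullet> (S *v v) = 0" if "v \<in> V" for v using that by auto
    have neg: "(- S) *v v = - (S *v v)" for v
      by (simp add: vec_eq_iff matrix_vector_mult_def sum_negf)
    have "S \<bullet> M = 0" if M: "M \<in> ?D" for M
    proof -
      have r: "psd M" "range ((*v) M) \<subseteq> V"
        using relint_face_psd[OF V M] M by (auto simp: relint_face_def)
      have "0 \<le> S \<bullet> M" "0 \<le> (- S) \<bullet> M"
        by (rule inner_psd_nonneg_on[OF r]; use z in \<open>simp add: neg\<close>)+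
      then show ?thesis by simp
    qed
    then have "D \<subseteq> {x. orthogonal S x}"
      using SH SX by (auto simp: D_def orthogonal_def inner_diff_right inner_add_right)
    then have "orthogonal S S"
      using S(1) span_minimal[OF _ subspace_orthogonal_to_vector] by blast
    then show False using S(2) by (simp add: orthogonal_def)
  qed
  then show ?thesis using that[OF sym SH SX pos] by blast
qed

text \<open>As long as \<open>V\<close> exceeds the range of \<open>X\<close>, a member of
  \<open>X + H\<close> in the relative interior would have rank at least \<open>dim V\<close>, above
  the maximum. So a separating form exists, and \<open>V\<close> shrinks to its null space. The
  dimension drops each time, which bounds the length; the last clause records the drop as the source
  of linear independence.\<close>

lemma facial_reduction_chain:
  fixes X :: "real^'n^'n"
  assumes H: "subspace H" and Hsym: "\<And>h. h \<in> H \<Longrightarrow> symmetric_mat h" and X: "psd X"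
    and "subspace V" "range ((*v) X) \<subseteq> V"
    and "\<And>h. h \<in> H \<Longrightarrow> psd (X + h) \<Longrightarrow> range ((*v) (X + h)) \<subseteq> V \<Longrightarrow> rank (X + h) \<le> rank X"
  obtains Ss where "fr_chain V Ss" "fr_space V Ss (length Ss) = range ((*v) X)"
    "rank X + length Ss \<le> dim V"
    "\<And>S h. S \<in> set Ss \<Longrightarrow> h \<in> H \<Longrightarrow> inner S h = 0" "\<And>S. S \<in> set Ss \<Longrightarrow> inner S X = 0"
    "\<And>i. i < length Ss \<Longrightarrow> \<exists>x\<in>fr_space V Ss i. x \<bullet> (Ss ! i *v x) \<noteq> 0"
  using assms(4-)
proof (induction "dim V" arbitrary: V thesis rule: less_induct)
  case less
  note V = less.prems(2) and R = less.prems(3) and mx = less.prems(4)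
  have subR: "subspace (range ((*v) X))" by (simp add: linear_subspace_image)
  have rk: "rank X = dim (range ((*v) X))" by (simp add: rank_dim_range)
  show ?case
  proof (cases "range ((*v) X) = V")
    case True
    then show ?thesis using rk by (intro less.prems(1)[of "[]"]) auto
  next
    case False
    then have "rank X < dim V"
      using subspace_dim_equal[OF subR V R] dim_subset[OF R] rk by force
    moreover have "dim V \<le> rank X" if "h \<in> H" "X + h \<in> relint_face V" for h
      using dim_le_rank_relint_face[OF V that(2)] mx[OF that(1) relint_face_psd[OF V that(2)]] that(2)
      by (simp add: relint_face_def)
    ultimately have "X + h \<notin> relint_face V" if "h \<in> H" for h using that by force
    from facial_reduction_step[OF H Hsym V X R this] obtain S where
      S: "symmetric_mat S" "\<And>h. h \<in> H \<Longrightarrow> inner S h = 0" "inner S X = 0"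
        "\<And>v. v \<in> V \<Longrightarrow> 0 \<le> v \<bullet> (S *v v)" "\<exists>v\<in>V. v \<bullet> (S *v v) \<noteq> 0" by blast
    let ?V = "{x\<in>V. x \<bullet> (S *v x) = 0}"
    have sub: "subspace ?V" by (rule subspace_psd_null[OF V S(1,4)])
    have R': "range ((*v) X) \<subseteq> ?V" by (rule inner_psd_zero_on[OF X R V S(1,4,3)])
    have "?V \<subseteq> V" "?V \<noteq> V" using S(5) by auto
    then have dim: "dim ?V < dim V"
      using subspace_dim_equal[OF sub V] dim_subset[of ?V V] by force
    have "rank (X + h) \<le> rank X" if "h \<in> H" "psd (X + h)" "range ((*v) (X + h)) \<subseteq> ?V" for h
      using mx[OF that(1,2)] that(3) by auto
    from less.hyps[OF dim _ sub R' this] obtain Ss where Ss: "fr_chain ?V Ss"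
      "fr_space ?V Ss (length Ss) = range ((*v) X)" "rank X + length Ss \<le> dim ?V"
      "\<And>S h. S \<in> set Ss \<Longrightarrow> h \<in> H \<Longrightarrow> inner S h = 0" "\<And>S. S \<in> set Ss \<Longrightarrow> inner S X = 0"
      "\<And>i. i < length Ss \<Longrightarrow> \<exists>x\<in>fr_space ?V Ss i. x \<bullet> (Ss ! i *v x) \<noteq> 0" by blast
    show ?thesis
    proof (rule less.prems(1)[of "S # Ss"])
      show "fr_chain V (S # Ss)" using S Ss(1) by (simp add: fr_chain_Cons)
      show "\<exists>x\<in>fr_space V (S # Ss) i. x \<bullet> ((S # Ss) ! i *v x) \<noteq> 0" if "i < length (S # Ss)" for i
        using that S(5) Ss(6) by (cases i) (auto simp: fr_space_Cons_Suc)
    qed (use S Ss dim in \<open>auto simp: fr_space_Cons_Suc\<close>)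
  qed
qed

section \<open>Reformulations\<close>

lemma invertible_inverse_cancel:
  fixes T :: "real^'n^'n"
  assumes "T ** S = mat 1"
  shows "transpose T ** (transpose S ** M ** S) ** T = M"
proof -
  have "S ** T = mat 1" using assms by (simp add: matrix_left_right_inverse)
  moreover from this have "transpose T ** transpose S = mat 1"
    by (metis matrix_transpose_mul transpose_mat)
  ultimately show ?thesis by (metis matrix_mul_assoc matrix_mul_lid matrix_mul_rid)
qed

text \<open>Only indices in \<open>1..m\<close> are meaningful, but \<open>same\<close> lets the
  others vary only at the start of a derivation. The freedom has to be carried back through every
  operation.\<close>

lemma reformulation_cong:
  fixes A0 :: "nat \<Rightarrow> real^'n^'n"
  assumes "reformulation m A0 b0 C0 A b C"
    and "\<And>i. i \<in> {1..m} \<Longrightarrow> A' i = A i" "\<And>i. i \<in> {1..m} \<Longrightarrow> b' i = b i"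
  shows "reformulation m A0 b0 C0 A' b' C"
  using assms
proof (induction arbitrary: A' b' rule: reformulation.induct)
  case (same A b C)
  then show ?case by (intro reformulation.same) auto
next
  case (rotate A b C T)
  obtain S where S: "T ** S = mat 1" "S ** T = mat 1" using rotate.hyps(2) by (auto simp: invertible_def)
  have "reformulation m A0 b0 C0 (\<lambda>i. transpose S ** A' i ** S) b' C"
    using rotate.prems invertible_inverse_cancel[OF S(2)] by (intro rotate.IH) auto
  from reformulation.rotate[OF this rotate.hyps(2)] show ?case
    by (simp add: invertible_inverse_cancel[OF S(1)])
next
  case (exchange A b C i j)
  let ?A = "A'(i := A' j, j := A' i)" and ?b = "b'(i := b' j, j := b' i)"
  have "reformulation m A0 b0 C0 ?A ?b C"
    using exchange.prems exchange.hyps by (intro exchange.IH) auto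
  from reformulation.exchange[OF this exchange.hyps(2,3)]
  have "reformulation m A0 b0 C0 (?A(i := ?A j, j := ?A i)) (?b(i := ?b j, j := ?b i)) C" .
  moreover have "?A(i := ?A j, j := ?A i) = A'" "?b(i := ?b j, j := ?b i) = b'" by auto
  ultimately show ?case by simp
next
  case (combine A b C i y)
  \<comment> \<open>Position \<open>i\<close> keeps its old value before the operation, which then
    produces \<open>A' i\<close> from it.\<close>
  let ?A = "A'(i := A i)" and ?b = "b'(i := b i)"
  have eq: "?A t = A t" "?b t = b t" if "t \<in> {1..m}" for t
    using combine.prems[OF that] by auto
  then have "reformulation m A0 b0 C0 ?A ?b C"
    by (intro combine.IH) auto
  from reformulation.combine[where y = y, OF this combine.hyps(2,3)]
  have "reformulation m A0 b0 C0 (?A(i := \<Sum>t=1..m. y t *\<^sub>R ?A t)) (?b(i := \<Sum>t=1..m. ?b t * y t)) C" .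
  moreover have "(\<Sum>t=1..m. y t *\<^sub>R ?A t) = A' i" "(\<Sum>t=1..m. ?b t * y t) = b' i"
    using eq combine.prems[OF combine.hyps(2)] by (auto intro!: sum.cong)
  ultimately show ?case by simp
qed

lemma reformulation_refl: "reformulation m A b C A b C"
  by (rule reformulation.same) auto

lemma reformulation_trans:
  assumes "reformulation m A1 b1 C1 A2 b2 C2" "reformulation m A0 b0 C0 A1 b1 C1"
  shows "reformulation m A0 b0 C0 A2 b2 C2"
  using assms
proof (induction rule: reformulation.induct)
  case (same A b C)
  then show ?case by (auto intro: reformulation_cong)
next
  case (rotate A b C T)
  then show ?case by (intro reformulation.rotate) auto
next
  case (exchange A b C i j)
  then show ?case by (intro reformulation.exchange) auto
next
  case (combine A b C i y)
  then show ?case by (intro reformulation.combine) auto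
qed

text \<open>The construction leads from the given problem to an output, while the claim asks for the
  opposite direction.\<close>

lemma reformulation_sym:
  fixes A :: "nat \<Rightarrow> real^'n^'n"
  assumes "reformulation m A0 b0 C0 A b C"
  shows "reformulation m A b C A0 b0 C0"
  using assms
proof (induction rule: reformulation.induct)
  case (same A b C)
  then show ?case by (intro reformulation.same) auto
next
  case (rotate A b C T)
  obtain S where S: "T ** S = mat 1" "S ** T = mat 1" using rotate.hyps(2) by (auto simp: invertible_def)
  then have "invertible S" by (auto simp: invertible_def)
  from reformulation.rotate[OF reformulation_refl this, of m "\<lambda>i. transpose T ** A i ** T" b "transpose T ** C ** T"]
  have "reformulation m (\<lambda>i. transpose T ** A i ** T) b (transpose T ** C ** T) A b C"
    by (simp add: invertible_inverse_cancel[OF S(2)])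
  then show ?case by (rule reformulation_trans[OF rotate.IH])
next
  case (exchange A b C i j)
  let ?A = "A(i := A j, j := A i)" and ?b = "b(i := b j, j := b i)"
  from reformulation.exchange[OF reformulation_refl exchange.hyps(2,3)]
  have "reformulation m ?A ?b C (?A(i := ?A j, j := ?A i)) (?b(i := ?b j, j := ?b i)) C" .
  moreover have "?A(i := ?A j, j := ?A i) = A" "?b(i := ?b j, j := ?b i) = b" by auto
  ultimately have "reformulation m ?A ?b C A b C" by simp
  then show ?case by (rule reformulation_trans[OF exchange.IH])
next
  case (combine A b C i y)
  define SA where "SA = (\<Sum>t=1..m. y t *\<^sub>R A t)"
  define sb where "sb = (\<Sum>t=1..m. b t * y t)"
  let ?A = "A(i := SA)" and ?b = "b(i := sb)"
  \<comment> \<open>The coefficients that result from solving the definition of \<open>SA\<close>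
    for \<open>A i\<close>.\<close>
  define z where "z = (\<lambda>t. if t = i then 1 / y i else - (y t / y i))"
  have zi: "z i \<noteq> 0" using combine.hyps(3) by (simp add: z_def)
  from reformulation.combine[where y = z, OF reformulation_refl combine.hyps(2) zi]
  have r: "reformulation m ?A ?b C (?A(i := \<Sum>t=1..m. z t *\<^sub>R ?A t)) (?b(i := \<Sum>t=1..m. ?b t * z t)) C" .
  have rem: "sum g {1..m} = g i + sum g ({1..m} - {i})" for g :: "nat \<Rightarrow> 'z::comm_monoid_add"
    using combine.hyps(2) by (intro sum.remove) auto
  have "(\<Sum>t=1..m. z t *\<^sub>R ?A t) = (1 / y i) *\<^sub>R SA + (\<Sum>t\<in>{1..m} - {i}. z t *\<^sub>R ?A t)"
    by (subst rem) (simp add: z_def)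
  also have "(\<Sum>t\<in>{1..m} - {i}. z t *\<^sub>R ?A t) = - ((1 / y i) *\<^sub>R (\<Sum>t\<in>{1..m} - {i}. y t *\<^sub>R A t))"
    unfolding scaleR_sum_right sum_negf[symmetric] by (intro sum.cong) (auto simp: z_def)
  also have "(1 / y i) *\<^sub>R SA + \<dots> = A i"
    using combine.hyps(3) unfolding SA_def by (subst rem) (simp add: scaleR_add_right)
  finally have eA: "(\<Sum>t=1..m. z t *\<^sub>R ?A t) = A i" .
  have "(\<Sum>t=1..m. ?b t * z t) = (1 / y i) * sb + (\<Sum>t\<in>{1..m} - {i}. ?b t * z t)"
    by (subst rem) (simp add: z_def)
  also have "(\<Sum>t\<in>{1..m} - {i}. ?b t * z t) = - ((1 / y i) * (\<Sum>t\<in>{1..m} - {i}. b t * y t))"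
    unfolding sum_distrib_left sum_negf[symmetric] by (intro sum.cong) (auto simp: z_def)
  also have "(1 / y i) * sb + \<dots> = b i"
    using combine.hyps(3) unfolding sb_def by (subst rem) (simp add: distrib_left)
  finally have eb: "(\<Sum>t=1..m. ?b t * z t) = b i" .
  have "reformulation m ?A ?b C A b C" using r unfolding eA eb by simp
  then show ?case unfolding SA_def sb_def by (rule reformulation_trans[OF combine.IH])
qed

section \<open>Exchanging constraints while keeping their span\<close>

text \<open>Coefficients are indexed by \<open>S\<close> and not by the image, so \<open>f\<close>
  may take a value several times.\<close>

lemma in_span_image:
  fixes f :: "'a \<Rightarrow> 'b::real_vector"
  assumes fin: "finite S" and x: "x \<in> span (f ` S)"
  obtains c where "x = (\<Sum>t\<in>S. c t *\<^sub>R f t)"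
proof -
  let ?U = "range (\<lambda>c. \<Sum>t\<in>S. c t *\<^sub>R f t)"
  have "subspace ?U"
    unfolding subspace_def
  proof (intro conjI ballI allI)
    show "0 \<in> ?U" by (rule range_eqI[of _ _ "\<lambda>_. 0"]) simp
  next
    fix x y assume "x \<in> ?U" "y \<in> ?U"
    then obtain c d where "x = (\<Sum>t\<in>S. c t *\<^sub>R f t)" "y = (\<Sum>t\<in>S. d t *\<^sub>R f t)" by auto
    then show "x + y \<in> ?U"
      by (intro range_eqI[of _ _ "\<lambda>t. c t + d t"]) (simp add: scaleR_add_left sum.distrib)
  next
    fix a x assume "x \<in> ?U"
    then obtain c where "x = (\<Sum>t\<in>S. c t *\<^sub>R f t)" by auto
    then show "a *\<^sub>R x \<in> ?U"
      by (intro range_eqI[of _ _ "\<lambda>t. a * c t"]) (simp add: scaleR_sum_right)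
  qed
  moreover have "f ` S \<subseteq> ?U"
  proof
    fix y assume "y \<in> f ` S"
    then obtain s where s: "s \<in> S" "y = f s" by auto
    have "(\<Sum>t\<in>S. (if t = s then 1 else 0) *\<^sub>R f t) = (\<Sum>t\<in>S. if t = s then f t else 0)"
      by (intro sum.cong) auto
    then show "y \<in> ?U"
      using s fin by (intro range_eqI[of _ _ "\<lambda>t. if t = s then 1 else 0"]) simp
  qed
  ultimately have "x \<in> ?U" using x span_minimal by blast
  then show ?thesis using that by auto
qed

lemma trace_prod_add_left: "trace_prod (S + T) X = trace_prod S X + trace_prod T X"
  and trace_prod_diff_left: "trace_prod (S - T) X = trace_prod S X - trace_prod T X"
  and trace_prod_scaleR_left: "trace_prod (c *\<^sub>R S) X = c * trace_prod S X"
  and trace_prod_sum_left: "trace_prod (\<Sum>i\<in>I. F i) X = (\<Sum>i\<in>I. trace_prod (F i) X)"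
  by (simp_all add: trace_prod_inner_transpose inner_add_left inner_diff_left inner_sum_left)

lemma span_fun_upd:
  fixes A :: "nat \<Rightarrow> 'b::real_vector"
  assumes t: "t \<in> I" "finite I" and c: "c t \<noteq> 0"
  shows "span ((A(t := (\<Sum>i\<in>I. c i *\<^sub>R A i))) ` I) = span (A ` I)"
proof -
  let ?B = "\<Sum>i\<in>I. c i *\<^sub>R A i"
  let ?A' = "A(t := ?B)"
  have "?A' i \<in> span (A ` I)" if "i \<in> I" for i
  proof (cases "i = t")
    case True
    have "?B \<in> span (A ` I)" by (intro span_sum span_scale span_base imageI)
    then show ?thesis using True by simp
  qed (use that in \<open>simp add: span_base\<close>)
  then have "?A' ` I \<subseteq> span (A ` I)" by blast
  then have 1: "span (?A' ` I) \<subseteq> span (A ` I)" by (intro span_minimal) auto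
  have "A i \<in> span (?A' ` I)" if "i \<in> I" for i
  proof (cases "i = t")
    case False
    then show ?thesis using that by (intro span_base image_eqI[of _ _ i]) auto
  next
    case True
    have "?B = c t *\<^sub>R A t + (\<Sum>i\<in>I - {t}. c i *\<^sub>R A i)" using t by (intro sum.remove) auto
    then have At: "A t = (1 / c t) *\<^sub>R (?B - (\<Sum>i\<in>I - {t}. c i *\<^sub>R ?A' i))"
      using c by simp
    have "?B \<in> span (?A' ` I)" using t by (intro span_base image_eqI[of _ _ t]) auto
    moreover have "(\<Sum>i\<in>I - {t}. c i *\<^sub>R ?A' i) \<in> span (?A' ` I)"
      by (intro span_sum span_scale span_base) (rule imageI, simp)
    ultimately have "(1 / c t) *\<^sub>R (?B - (\<Sum>i\<in>I - {t}. c i *\<^sub>R ?A' i)) \<in> span (?A' ` I)"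
      by (intro span_scale span_diff)
    then show ?thesis unfolding True At[symmetric] .
  qed
  then have "span (A ` I) \<subseteq> span (?A' ` I)" by (intro span_minimal) auto
  with 1 show ?thesis by auto
qed

lemma image_fun_upd_swap:
  assumes "i \<in> I" "j \<in> I"
  shows "(A(i := A j, j := A i)) ` I = A ` I"
proof (intro equalityI subsetI)
  fix y assume "y \<in> A ` I"
  then obtain t where t: "t \<in> I" "y = A t" by auto
  have "y = (A(i := A j, j := A i)) (if t = i then j else if t = j then i else t)"
    using t by auto
  then show "y \<in> (A(i := A j, j := A i)) ` I" using assms t(1) by (metis imageI)
qed (use assms in auto)

text \<open>Steinitz exchange by the operations of a reformulation.\<close>

lemma reformulation_prescribe_first:
  fixes A :: "nat \<Rightarrow> real^'n^'n"
  assumes "\<And>i. i < length Bs \<Longrightarrow> Bs ! i \<in> span (A ` {1..m}) \<and> Bs ! i \<notin> span (set (take i Bs))"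
  shows "length Bs \<le> m \<and> (\<exists>A' b'. reformulation m A b C A' b' C \<and>
    (\<forall>i<length Bs. A' (Suc i) = Bs ! i) \<and> span (A' ` {1..m}) = span (A ` {1..m}) \<and>
    (\<forall>X. (\<forall>i\<in>{1..m}. trace_prod (A i) X = b i) \<longrightarrow> (\<forall>i\<in>{1..m}. trace_prod (A' i) X = b' i)))"
  using assms
proof (induction Bs rule: rev_induct)
  case Nil
  show ?case by (auto intro!: exI[of _ A] exI[of _ b] reformulation_refl)
next
  case (snoc B Bs)
  have "Bs ! i \<in> span (A ` {1..m}) \<and> Bs ! i \<notin> span (set (take i Bs))" if "i < length Bs" for i
    using snoc.prems[of i] that by (simp add: nth_append)
  from snoc.IH[OF this] obtain A' b' where ref: "reformulation m A b C A' b' C"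
    and first: "\<And>i. i < length Bs \<Longrightarrow> A' (Suc i) = Bs ! i"
    and sp: "span (A' ` {1..m}) = span (A ` {1..m})"
    and feas: "\<And>X i. (\<forall>i\<in>{1..m}. trace_prod (A i) X = b i) \<Longrightarrow> i \<in> {1..m} \<Longrightarrow> trace_prod (A' i) X = b' i"
    by blast
  have B: "B \<in> span (A' ` {1..m})" "B \<notin> span (set Bs)"
    using snoc.prems[of "length Bs"] sp by auto
  obtain c where c: "B = (\<Sum>t=1..m. c t *\<^sub>R A' t)" using in_span_image[OF _ B(1)] by auto
  \<comment> \<open>Otherwise \<open>B\<close> would be a combination of the matrices already
    placed.\<close>
  have "\<exists>t\<in>{1..m}. length Bs < t \<and> c t \<noteq> 0"
  proof (rule ccontr)
    assume no: "\<not> ?thesis"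
    have "c t *\<^sub>R A' t \<in> span (set Bs)" if t: "t \<in> {1..m}" for t
    proof (cases "c t = 0")
      case False
      then have "t \<le> length Bs" using no t by (meson not_le)
      then have "A' t = Bs ! (t - 1)" "t - 1 < length Bs" using first[of "t - 1"] t by auto
      then show ?thesis by (metis nth_mem span_base span_scale)
    qed (simp add: span_zero)
    then have "B \<in> span (set Bs)" unfolding c by (intro span_sum) auto
    then show False using B(2) by simp
  qed
  then obtain t where t: "t \<in> {1..m}" "length Bs < t" "c t \<noteq> 0" by blast
  let ?k = "Suc (length Bs)"
  \<comment> \<open>\<open>B\<close> first replaces constraint \<open>t\<close> and is then
    exchanged into the first free position \<open>?k\<close>; constraints before \<open>?k\<close>
    stay in place.\<close>
  define A1 where "A1 = A'(t := B)"
  define b1 where "b1 = b'(t := \<Sum>i=1..m. b' i * c i)"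
  define A2 where "A2 = A1(?k := A1 t, t := A1 ?k)"
  define b2 where "b2 = b1(?k := b1 t, t := b1 ?k)"
  have k: "?k \<in> {1..m}" using t by auto
  have "reformulation m A b C A1 b1 C"
    using reformulation.combine[OF ref t(1), of c] t(3) by (simp add: A1_def b1_def c)
  from reformulation.exchange[OF this k t(1)] have "reformulation m A b C A2 b2 C"
    by (simp add: A2_def b2_def)
  moreover have "A2 (Suc i) = (Bs @ [B]) ! i" if "i < length (Bs @ [B])" for i
    using that first[of i] t(2) by (auto simp: A2_def A1_def nth_append less_Suc_eq)
  moreover have "span (A1 ` {1..m}) = span (A' ` {1..m})"
    unfolding A1_def c by (rule span_fun_upd[where c = c, OF t(1) _ t(3)]) simp
  then have "span (A2 ` {1..m}) = span (A ` {1..m})"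
    unfolding A2_def image_fun_upd_swap[OF k t(1)] sp .
  moreover have "trace_prod (A2 i) X = b2 i"
    if X: "\<forall>i\<in>{1..m}. trace_prod (A i) X = b i" and i: "i \<in> {1..m}" for X i
  proof -
    have "trace_prod (A1 i) X = b1 i" if "i \<in> {1..m}" for i
      using feas[OF X] that
      by (auto simp: A1_def b1_def c trace_prod_sum_left trace_prod_scaleR_left mult.commute intro!: sum.cong)
    then show ?thesis using i k t(1) by (auto simp: A2_def b2_def)
  qed
  ultimately show ?case using k by (intro conjI exI[of _ A2] exI[of _ b2]) auto
qed

section \<open>Regular facial reduction sequences in coordinates\<close>

lemma quadratic_form_axis: "axis p 1 \<bullet> (M *v axis q 1) = M $ p $ q" for M :: "real^'n^'n"
  by (simp add: matrix_vector_mult_basis column_def inner_axis')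

lemma diag_pd_block_iff:
  "diag_pd_block R M \<longleftrightarrow>
     (\<forall>p\<in>R. \<forall>q\<in>R. p \<noteq> q \<longrightarrow> M $ p $ q = 0) \<and> (\<forall>p\<in>R. 0 < M $ p $ p)"
proof (intro iffI conjI)
  assume d: "diag_pd_block R M"
  then show "\<forall>p\<in>R. \<forall>q\<in>R. p \<noteq> q \<longrightarrow> M $ p $ q = 0" by (simp add: diag_pd_block_def)
  show "\<forall>p\<in>R. 0 < M $ p $ p"
  proof
    fix p assume "p \<in> R"
    moreover have "axis p (1::real) \<noteq> 0" by (simp add: axis_eq_0_iff)
    ultimately have "0 < axis p 1 \<bullet> (M *v axis p 1)"
      using d unfolding diag_pd_block_def by (auto simp: axis_def)
    then show "0 < M $ p $ p" by (simp add: quadratic_form_axis)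
  qed
next
  assume d: "(\<forall>p\<in>R. \<forall>q\<in>R. p \<noteq> q \<longrightarrow> M $ p $ q = 0) \<and> (\<forall>p\<in>R. 0 < M $ p $ p)"
  show "diag_pd_block R M"
    unfolding diag_pd_block_def
  proof (intro conjI allI impI)
    fix x :: "real^'a" assume x: "x \<noteq> 0 \<and> (\<forall>p. p \<notin> R \<longrightarrow> x $ p = 0)"
    have "(\<Sum>j\<in>UNIV. M $ i $ j * (x $ i * x $ j)) = M $ i $ i * (x $ i)\<^sup>2" for i
    proof -
      have "M $ i $ j * (x $ i * x $ j) = 0" if "j \<noteq> i" for j
        using that d x by (cases "i \<in> R"; cases "j \<in> R") auto
      then have "(\<Sum>j\<in>UNIV. M $ i $ j * (x $ i * x $ j)) = (\<Sum>j\<in>{i}. M $ i $ j * (x $ i * x $ j))"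
        by (intro sum.mono_neutral_right) auto
      then show ?thesis by (simp add: power2_eq_square)
    qed
    then have eq: "x \<bullet> (M *v x) = (\<Sum>i\<in>UNIV. M $ i $ i * (x $ i)\<^sup>2)"
      by (simp add: quadratic_form_expand)
    obtain p where p: "x $ p \<noteq> 0" using x by (auto simp: vec_eq_iff)
    show "0 < x \<bullet> (M *v x)" unfolding eq
    proof (rule sum_pos2[of _ p])
      show "0 < M $ p $ p * (x $ p)\<^sup>2" using p d x by (intro mult_pos_pos) auto
      show "0 \<le> M $ i $ i * (x $ i)\<^sup>2" for i
      proof (cases "i \<in> R")
        case True
        then have "0 < M $ i $ i" using d by auto
        then show ?thesis by (simp add: less_imp_le)
      qed (use x in simp)
    qed auto
  qed (use d in auto)
qed

lemma psd_diag_nonneg: "psd X \<Longrightarrow> 0 \<le> X $ p $ p"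
  using psd_nonneg[of X "axis p 1"] by (simp add: quadratic_form_axis)

lemma psd_diag_zero:
  assumes "psd X" "X $ p $ p = 0"
  shows "X $ p $ q = 0" "X $ q $ p = 0"
proof -
  have "X *v axis p 1 = 0"
    using assms by (intro psd_null_vector) (auto simp: quadratic_form_axis)
  then show "X $ q $ p = 0"
    by (simp add: matrix_vector_mult_basis column_def vec_eq_iff)
  then show "X $ p $ q = 0"
    using assms(1) by (simp add: psd_def symmetric_mat_component)
qed

text \<open>The hypotheses concern products because the zeros come from either factor: from the
  sequence outside earlier blocks, from \<open>X\<close> in rows and columns already
  cleared.\<close>

lemma inner_diag_block:
  fixes M X :: "real^'n^'n"
  assumes "\<And>p q. \<not> (p \<in> R \<and> q \<in> R) \<Longrightarrow> M $ p $ q * X $ p $ q = 0"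
    and "\<And>p q. p \<in> R \<Longrightarrow> q \<in> R \<Longrightarrow> p \<noteq> q \<Longrightarrow> M $ p $ q * X $ p $ q = 0"
  shows "inner M X = (\<Sum>p\<in>R. M $ p $ p * X $ p $ p)"
proof -
  have "(\<Sum>q\<in>UNIV. M $ p $ q * X $ p $ q) = (if p \<in> R then M $ p $ p * X $ p $ p else 0)" for p
  proof -
    have "(\<Sum>q\<in>UNIV. M $ p $ q * X $ p $ q) = (\<Sum>q\<in>{p}. M $ p $ q * X $ p $ q)"
      using assms by (intro sum.mono_neutral_right) (auto, blast)
    then show ?thesis using assms(1)[of p p] by auto
  qed
  then show ?thesis by (simp add: inner_matrix sum.If_cases)
qed

lemma regular_fr_seqD:
  assumes "regular_fr_seq Ys Rs"
  shows "length Ys = length Rs"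
    and "i < length Rs \<Longrightarrow> symmetric_mat (Ys ! i)"
    and "i < length Rs \<Longrightarrow> diag_pd_block (Rs ! i) (Ys ! i)"
    and "i < length Rs \<Longrightarrow> p \<notin> \<Union>(set (take i Rs)) \<Longrightarrow> q \<notin> \<Union>(set (take i Rs)) \<Longrightarrow>
      \<not> (p \<in> Rs ! i \<and> q \<in> Rs ! i) \<Longrightarrow> Ys ! i $ p $ q = 0"
    and "i < length Rs \<Longrightarrow> j < length Rs \<Longrightarrow> i \<noteq> j \<Longrightarrow> Rs ! i \<inter> Rs ! j = {}"
  using assms by (auto simp: regular_fr_seq_def)

lemma mem_Union_take: "p \<in> \<Union>(set (take i Rs)) \<longleftrightarrow> (\<exists>j<length Rs. j < i \<and> p \<in> Rs ! j)"
proof -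
  have "set (take i Rs) = {Rs ! j | j. j < length Rs \<and> j < i}"
    by (auto simp: set_conv_nth) (metis nth_take)
  then show ?thesis by blast
qed

text \<open>A vanishing diagonal entry of a psd \<open>X\<close> clears its row and column. Earlier
  blocks thus clear exactly the region where the next matrix is arbitrary, and what is left of its
  inner product with \<open>X\<close> is a positive combination of diagonal entries.\<close>

lemma regular_fr_seq_reduces:
  assumes reg: "regular_fr_seq Ys Rs"
  shows "reduces_psd_to Ys (psd_face (- \<Union>(set Rs)))"
  unfolding reduces_psd_to_def
proof (intro equalityI subsetI)
  fix X assume "X \<in> {X. psd X \<and> (\<forall>M\<in>set Ys. trace_prod M X = 0)}"
  then have X: "psd X" and tr: "\<And>M. M \<in> set Ys \<Longrightarrow> inner M X = 0"
    by (auto simp: trace_prod_inner psd_def)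
  have z: "\<forall>p\<in>Rs ! i. X $ p $ p = 0" if "i < length Rs" for i
    using that
  proof (induction i rule: less_induct)
    case (less i)
    have zero: "X $ p $ q = 0 \<and> X $ q $ p = 0" if "p \<in> \<Union>(set (take i Rs))" for p q
      using that less.IH psd_diag_zero[OF X] unfolding mem_Union_take by blast
    have d: "diag_pd_block (Rs ! i) (Ys ! i)" by (rule regular_fr_seqD(3)[OF reg less.prems])
    have "inner (Ys ! i) X = (\<Sum>p\<in>Rs ! i. Ys ! i $ p $ p * X $ p $ p)"
    proof (rule inner_diag_block)
      fix p q assume "\<not> (p \<in> Rs ! i \<and> q \<in> Rs ! i)"
      then show "Ys ! i $ p $ q * X $ p $ q = 0"
        using zero regular_fr_seqD(4)[OF reg less.prems] by (metis mult_zero_left mult_zero_right)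
    qed (use d in \<open>auto simp: diag_pd_block_iff\<close>)
    moreover have "inner (Ys ! i) X = 0"
      using less.prems regular_fr_seqD(1)[OF reg] by (intro tr) auto
    moreover have "0 \<le> Ys ! i $ p $ p * X $ p $ p" if "p \<in> Rs ! i" for p
      using d that psd_diag_nonneg[OF X] by (auto simp: diag_pd_block_iff less_imp_le)
    ultimately have "\<forall>p\<in>Rs ! i. Ys ! i $ p $ p * X $ p $ p = 0"
      by (simp add: sum_nonneg_eq_0_iff)
    then show ?case using d by (fastforce simp: diag_pd_block_iff)
  qed
  have "X $ p $ p = 0" if "p \<in> \<Union>(set Rs)" for p
    using that z by (auto simp: in_set_conv_nth)
  then have "supported_on (- \<Union>(set Rs)) X"
    using psd_diag_zero[OF X] unfolding supported_on_def by blast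
  then show "X \<in> psd_face (- \<Union>(set Rs))" using X by (simp add: psd_face_def)
next
  fix X assume "X \<in> psd_face (- \<Union>(set Rs))"
  then have X: "psd X" "supported_on (- \<Union>(set Rs)) X" by (auto simp: psd_face_def)
  have "inner (Ys ! i) X = 0" if i: "i < length Rs" for i
  proof -
    have z: "Ys ! i $ p $ q * X $ p $ q = 0" for p q
    proof (cases "p \<in> \<Union>(set Rs) \<or> q \<in> \<Union>(set Rs)")
      case True
      then show ?thesis using X(2) by (auto simp: supported_on_def)
    next
      case False
      then have "p \<notin> \<Union>(set (take i Rs))" "q \<notin> \<Union>(set (take i Rs))" "\<not> (p \<in> Rs ! i \<and> q \<in> Rs ! i)"
        using i by (auto dest: in_set_takeD)
      then show ?thesis using regular_fr_seqD(4)[OF reg i] by simp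
    qed
    show ?thesis by (simp only: inner_matrix z sum.neutral_const)
  qed
  then show "X \<in> {X. psd X \<and> (\<forall>M\<in>set Ys. trace_prod M X = 0)}"
    using X(1) regular_fr_seqD(1)[OF reg] by (auto simp: trace_prod_inner psd_def in_set_conv_nth)
qed

lemma outer_axis_in_psd_face: "outer (axis p 1) \<in> psd_face R \<longleftrightarrow> p \<in> R"
  using psd_outer[of "axis p 1"] by (auto simp: psd_face_def supported_on_def outer_def axis_def)

text \<open>Rank one matrices of coordinate vectors tell the faces apart. The reduction property
  becomes an equation for the structure in which the matrices no longer occur.\<close>

lemma reduces_psd_face_iff:
  assumes "regular_fr_seq Ys Rs"
  shows "reduces_psd_to Ys (psd_face R) \<longleftrightarrow> \<Union>(set Rs) = - R"
proof
  assume "reduces_psd_to Ys (psd_face R)"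
  then have "psd_face R = psd_face (- \<Union>(set Rs))"
    using regular_fr_seq_reduces[OF assms] by (simp add: reduces_psd_to_def)
  then have "p \<in> R \<longleftrightarrow> p \<in> - \<Union>(set Rs)" for p
    using outer_axis_in_psd_face[of p] by metis
  then show "\<Union>(set Rs) = - R" by auto
next
  assume "\<Union>(set Rs) = - R"
  then show "reduces_psd_to Ys (psd_face R)"
    using regular_fr_seq_reduces[OF assms] by simp
qed

lemma regular_fr_seq_change:
  assumes reg: "regular_fr_seq Ys Rs" and len: "length Ys' = length Rs"
    and ch: "\<And>i. i < length Rs \<Longrightarrow> symmetric_mat (Ys' ! i)"
      "\<And>i p q. i < length Rs \<Longrightarrow> p \<notin> \<Union>(set (take i Rs)) \<Longrightarrow> q \<notin> \<Union>(set (take i Rs)) \<Longrightarrow>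
        Ys' ! i $ p $ q = Ys ! i $ p $ q"
  shows "regular_fr_seq Ys' Rs"
  unfolding regular_fr_seq_def
proof (intro conjI allI impI)
  show "\<forall>M\<in>set Ys'. symmetric_mat M" using ch(1) len by (auto simp: in_set_conv_nth)
next
  fix i assume i: "i < length Rs"
  have "p \<notin> \<Union>(set (take i Rs))" if "p \<in> Rs ! i" for p
    using that regular_fr_seqD(5)[OF reg i] unfolding mem_Union_take by blast
  then show "diag_pd_block (Rs ! i) (Ys' ! i)"
    using regular_fr_seqD(3)[OF reg i] ch(2)[OF i] by (simp add: diag_pd_block_iff)
next
  fix i p q assume i: "i < length Rs" and pq: "p \<notin> \<Union> (set (take i Rs)) \<and> q \<notin> \<Union> (set (take i Rs)) \<and> \<not> (p \<in> Rs ! i \<and> q \<in> Rs ! i)"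
  then show "Ys' ! i $ p $ q = 0"
    using regular_fr_seqD(4)[OF reg i, of p q] ch(2)[OF i, of p q] by simp
next
  fix i j assume "i < length Rs" "j < length Rs" "i \<noteq> j"
  then show "Rs ! i \<inter> Rs ! j = {}" by (rule regular_fr_seqD(5)[OF reg])
qed (rule len)

lemma length_fr_seq [simp]: "length (fr_seq M A k) = Suc k"
  by (simp add: fr_seq_def)

lemma fr_seq_nth: "i \<le> k \<Longrightarrow> fr_seq M A k ! i = (if i = 0 then M else A i)"
  by (cases i) (auto simp: fr_seq_def simp del: upt_Suc)

lemma set_fr_seq: "set (fr_seq M A k) = insert M (A ` {1..k})"
  by (simp add: fr_seq_def atLeastLessThanSuc_atLeastAtMost del: upt_Suc)

text \<open>Nothing precedes the first member, so its positive diagonal entries determine its block.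
  This identifies the initial blocks of the structures chosen in Step 3.\<close>

lemma fr_seq_first_block:
  assumes reg: "regular_fr_seq (fr_seq M A k) Rs" and M: "supported_on R M" "diag_pd_block R M"
  shows "Rs ! 0 = R"
proof -
  have l: "0 < length Rs" unfolding regular_fr_seqD(1)[OF reg, symmetric] by simp
  have 1: "diag_pd_block (Rs ! 0) M" using regular_fr_seqD(3)[OF reg l] by (simp add: fr_seq_nth)
  have 2: "M $ p $ p = 0" if "p \<notin> Rs ! 0" for p
    using regular_fr_seqD(4)[OF reg l, of p p] that by (simp add: fr_seq_nth)
  show ?thesis using 1 2 M by (fastforce simp: diag_pd_block_iff supported_on_def)
qed

section \<open>Index sets and ranks\<close>

text \<open>An injection of a finite type into as many initial naturals is onto. Applied to the
  number of predecessors and the number of successors.\<close>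

lemma card_less_index:
  fixes f :: "'n::finite \<Rightarrow> nat"
  assumes "inj f" "\<And>i. f i < CARD('n)" "s \<le> CARD('n)"
  shows "card {i. f i < s} = s"
proof -
  have "range f = {..<CARD('n)}"
    using assms by (intro card_subset_eq) (auto simp: card_image)
  then have "f ` {i. f i < s} = {..<s}" using assms(3) by (auto simp: image_iff set_eq_iff) (metis less_le_trans rangeE lessThan_iff)
  then show ?thesis using card_image[OF inj_on_subset[OF assms(1)], of "{i. f i < s}"] by simp
qed

lemma card_upper_idx:
  assumes "s \<le> CARD('n::{finite,linorder})"
  shows "card (upper_idx s :: 'n set) = s"
  unfolding upper_idx_def
proof (rule card_less_index[OF _ _ assms])
  have "card {..<i} < card {..<j}" if "i < j" for i j :: 'n
    using that by (intro psubset_card_mono) auto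
  then show "inj (\<lambda>i::'n. card {..<i})" by (intro linorder_injI) (metis less_irrefl)
  show "card {..<i} < CARD('n)" for i :: 'n
    by (intro psubset_card_mono) auto
qed

lemma card_lower_idx:
  assumes "r \<le> CARD('n::{finite,linorder})"
  shows "card (lower_idx r :: 'n set) = r"
  unfolding lower_idx_def
proof (rule card_less_index[OF _ _ assms])
  have "card {j<..} < card {i<..}" if "i < j" for i j :: 'n
    using that by (intro psubset_card_mono) auto
  then show "inj (\<lambda>i::'n. card {i<..})" by (intro linorder_injI) (metis less_irrefl)
  show "card {i<..} < CARD('n)" for i :: 'n
    by (intro psubset_card_mono) auto
qed

lemma upper_lower_idx_disjoint:
  assumes "r + s \<le> CARD('n::{finite,linorder})"
  shows "(upper_idx s :: 'n set) \<inter> lower_idx r = {}"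
proof -
  have eq: "card {..<i} + card {i<..} + 1 = CARD('n)" for i :: 'n
  proof -
    have "card (UNIV :: 'n set) = card (insert i ({..<i} \<union> {i<..}))"
      by (intro arg_cong[where f = card]) auto
    also have "\<dots> = card ({..<i} \<union> {i<..}) + 1" by simp
    also have "card ({..<i} \<union> {i<..}) = card {..<i} + card {i<..}" by (intro card_Un_disjoint) auto
    finally show ?thesis by simp
  qed
  have "False" if "card {..<i} < s" "card {i<..} < r" for i :: 'n
    using eq[of i] that assms by linarith
  then show ?thesis by (auto simp: upper_idx_def lower_idx_def)
qed

lemma dim_coordinate_subspace: "dim {x::real^'n. \<forall>p. p \<notin> R \<longrightarrow> x $ p = 0} = card R"
  using dim_substandard_cart[of R, where 'a = real] by (simp add: dim_vec_eq)

lemma rank_supported: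
  fixes M :: "real^'n^'n"
  assumes "supported_on R M"
  shows "rank M \<le> card R"
proof -
  have "range ((*v) M) \<subseteq> {x. \<forall>p. p \<notin> R \<longrightarrow> x $ p = 0}"
    using assms by (auto simp: supported_on_def matrix_vector_mult_def)
  from dim_subset[OF this] show ?thesis by (simp add: rank_dim_range dim_coordinate_subspace)
qed

lemma rank_diag_pd_block:
  fixes M :: "real^'n^'n"
  assumes "diag_pd_block R M"
  shows "card R \<le> rank M"
proof -
  let ?V = "{x::real^'n. \<forall>p. p \<notin> R \<longrightarrow> x $ p = 0}"
  have V: "subspace ?V" by (auto simp: subspace_def)
  have "inj_on ((*v) M) ?V"
  proof (rule inj_onI)
    fix x y assume "x \<in> ?V" "y \<in> ?V" "M *v x = M *v y"
    then have "(x - y) \<bullet> (M *v (x - y)) = 0" "\<forall>p. p \<notin> R \<longrightarrow> (x - y) $ p = 0"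
      by (auto simp: matrix_vector_mult_diff_distrib)
    then show "x = y" using assms unfolding diag_pd_block_def by (metis less_irrefl eq_iff_diff_eq_0)
  qed
  then have "dim ((*v) M ` ?V) = dim ?V"
    by (intro dim_image_eq) (auto simp: span_eq_iff[THEN iffD2, OF V])
  moreover have "dim ((*v) M ` ?V) \<le> dim (range ((*v) M))" by (intro dim_subset) auto
  ultimately show ?thesis by (simp add: rank_dim_range dim_coordinate_subspace)
qed

lemma psd_diagonal:
  assumes "supported_on R M" "diag_pd_block R M"
  shows "psd M"
  unfolding psd_def
proof (intro conjI allI)
  have d: "M $ p $ q = 0" if "p \<noteq> q" for p q
    using assms that by (cases "p \<in> R \<and> q \<in> R") (auto simp: supported_on_def diag_pd_block_iff)
  have n: "0 \<le> M $ p $ p" for p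
    using assms by (cases "p \<in> R") (auto simp: supported_on_def diag_pd_block_iff less_imp_le)
  show "symmetric_mat M" using d unfolding symmetric_mat_component by metis
  fix x
  have "0 \<le> M $ i $ j * (x $ i * x $ j)" for i j
    using d n by (cases "i = j") auto
  then show "0 \<le> x \<bullet> (M *v x)" by (simp add: quadratic_form_expand sum_nonneg)
qed

section \<open>The algorithm\<close>

text \<open>Weak duality as an identity: the duality gap is the inner product with the
  slack.\<close>

lemma trace_prod_slack:
  assumes "primal_feasible m A b X"
  shows "trace_prod C X = trace_prod (slack m A C y) X + (\<Sum>i=1..m. b i * y i)"
proof -
  have "(\<Sum>i=1..m. b i * y i) = (\<Sum>i=1..m. trace_prod (y i *\<^sub>R A i) X)"
    using assms by (intro sum.cong) (auto simp: primal_feasible_def trace_prod_scaleR_left)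
  then show ?thesis
    by (simp add: slack_def trace_prod_diff_left trace_prod_sum_left)
qed

text \<open>Zero gap makes the two values equal. Any other optimal solution has the same value,
  hence zero gap with the fixed partner; the last two conclusions later confine all optimal
  solutions to a face.\<close>

lemma optimal_pairD:
  assumes "optimal_pair m A b C X Z"
  shows "primal_optimal m A b C X" "dual_optimal m A b C Z"
    "primal_optimal m A b C X' \<Longrightarrow> trace_prod Z X' = 0"
    "dual_optimal m A b C Z' \<Longrightarrow> trace_prod Z' X = 0"
proof -
  obtain y where X: "primal_feasible m A b X" and y: "dual_feasible_vec m A C y" and Z: "Z = slack m A C y"
    and XZ: "trace_prod Z X = 0"
    using assms unfolding optimal_pair_def dual_feasible_def by (metis trace_prod_commute)
  have eq: "trace_prod C X = (\<Sum>i=1..m. b i * y i)"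
    using trace_prod_slack[OF X, of C y] XZ Z by simp
  have nn: "0 \<le> trace_prod (slack m A C y') X'" if "dual_feasible_vec m A C y'" "primal_feasible m A b X'" for y' X'
    using that by (intro trace_prod_psd_nonneg) (auto simp: dual_feasible_vec_def primal_feasible_def)
  show pX: "primal_optimal m A b C X"
    unfolding primal_optimal_def
  proof (intro conjI allI impI X)
    fix X' assume "primal_feasible m A b X'"
    then show "trace_prod C X \<le> trace_prod C X'"
      using nn[OF y] trace_prod_slack[of m A b X' C y] eq by force
  qed
  have dy: "dual_optimal_vec m A b C y"
    unfolding dual_optimal_vec_def
  proof (intro conjI allI impI y)
    fix y' assume "dual_feasible_vec m A C y'"
    then show "(\<Sum>i=1..m. b i * y' i) \<le> (\<Sum>i=1..m. b i * y i)"
      using nn[OF _ X] trace_prod_slack[OF X, of C y'] eq by force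
  qed
  then show "dual_optimal m A b C Z" using Z by (auto simp: dual_optimal_def)
  show "trace_prod Z X' = 0" if "primal_optimal m A b C X'"
  proof -
    have "primal_feasible m A b X'" "trace_prod C X' = trace_prod C X"
      using that pX by (auto simp: primal_optimal_def intro: antisym)
    then show ?thesis using trace_prod_slack[of m A b X' C y] eq Z by simp
  qed
  show "trace_prod Z' X = 0" if Z': "dual_optimal m A b C Z'"
  proof -
    obtain y' where y': "dual_optimal_vec m A b C y'" "Z' = slack m A C y'"
      using Z' by (auto simp: dual_optimal_def)
    then have "(\<Sum>i=1..m. b i * y' i) = (\<Sum>i=1..m. b i * y i)"
      using dy by (auto simp: dual_optimal_vec_def intro: antisym)
    then show ?thesis using trace_prod_slack[OF X, of C y'] eq y'(2) by simp
  qed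
qed

section \<open>The invariant of a run and the correctness of its output\<close>

definition valid_sizes :: "'n::finite itself \<Rightarrow> nat \<Rightarrow> nat \<Rightarrow> nat \<Rightarrow> nat \<Rightarrow> nat \<Rightarrow> bool" where
  "valid_sizes _ m r s k l \<longleftrightarrow> 0 < r \<and> 0 < s \<and> r + s < CARD('n) \<and>
     k \<in> {1..CARD('n) - r - s} \<and> l \<in> {1..CARD('n) - r - s} \<and> k \<le> m"

definition valid_pair :: "nat \<Rightarrow> nat \<Rightarrow> ('n::{finite,linorder}) sqmat \<Rightarrow> 'n sqmat \<Rightarrow> bool" where
  "valid_pair r s X Z \<longleftrightarrow> supported_on (lower_idx r) X \<and> diag_pd_block (lower_idx r) X \<and>
     supported_on (upper_idx s) Z \<and> diag_pd_block (upper_idx s) Z"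

definition valid_structure ::
  "nat \<Rightarrow> nat \<Rightarrow> nat \<Rightarrow> nat \<Rightarrow> ('n::{finite,linorder}) sqmat \<Rightarrow> 'n sqmat \<Rightarrow> 'n set list \<Rightarrow> 'n set list \<Rightarrow>
   (nat \<Rightarrow> 'n sqmat) \<Rightarrow> (nat \<Rightarrow> 'n sqmat) \<Rightarrow> bool" where
  "valid_structure r s k l X Z Ps Qs A Y \<longleftrightarrow>
     regular_fr_seq (fr_seq Z A k) Ps \<and> \<Union>(set Ps) = - lower_idx r \<and>
     regular_fr_seq (fr_seq X Y l) Qs \<and> \<Union>(set Qs) = - upper_idx s"

text \<open>Invariant of runs that avoid empty blocks. Reduction is stored as an equation for the
  union of the structure, which the block changes do not touch. Nonemptiness is recorded only while
  blocks are still to be adjusted.\<close>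

fun valid_state :: "nat \<Rightarrow> ('n::{finite,linorder}) alg_state \<Rightarrow> bool" where
  "valid_state m Start \<longleftrightarrow> True"
| "valid_state m (Sizes r s k l :: 'n alg_state) \<longleftrightarrow> valid_sizes TYPE('n) m r s k l"
| "valid_state m (Optimal_Matrices r s k l X Z :: 'n alg_state) \<longleftrightarrow>
     valid_sizes TYPE('n) m r s k l \<and> valid_pair r s X Z"
| "valid_state m (Base_Equations r s k l X Z Ps Qs i A Y :: 'n alg_state) \<longleftrightarrow>
     valid_sizes TYPE('n) m r s k l \<and> valid_pair r s X Z \<and>
     valid_structure r s k l X Z Ps Qs A Y \<and> {} \<notin> set (butlast Ps) \<and> i \<le> k \<and>
     (\<forall>t\<in>{1..i}. \<forall>j\<in>{1..l}. trace_prod (A t) (Y j) = 0)"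
| "valid_state m (All_Equations r s k l X Z A Y :: 'n alg_state) \<longleftrightarrow>
     valid_sizes TYPE('n) m r s k l \<and> valid_pair r s X Z \<and>
     (\<exists>Ps Qs. valid_structure r s k l X Z Ps Qs A Y) \<and>
     (\<forall>t\<in>{1..m}. \<forall>j\<in>{1..l}. trace_prod (A t) (Y j) = 0)"
| "valid_state m (Output r s k l X Z A b C Y :: 'n alg_state) \<longleftrightarrow>
     valid_sizes TYPE('n) m r s k l \<and> valid_pair r s X Z \<and>
     (\<exists>Ps Qs. valid_structure r s k l X Z Ps Qs A Y) \<and>
     (\<forall>t\<in>{1..m}. \<forall>j\<in>{1..l}. trace_prod (A t) (Y j) = 0) \<and>
     (\<forall>i\<in>{1..m}. b i = trace_prod (A i) X) \<and> (\<exists>y. C = Z + (\<Sum>i=1..m. y i *\<^sub>R A i))"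

lemma valid_structure_first:
  assumes "valid_pair r s X Z" "valid_structure r s k l X Z Ps Qs A Y"
  shows "Ps ! 0 = upper_idx s" "Qs ! 0 = lower_idx r" "length Ps = Suc k" "length Qs = Suc l"
  using assms fr_seq_first_block[of Z A k Ps "upper_idx s"] fr_seq_first_block[of X Y l Qs "lower_idx r"]
    regular_fr_seqD(1)[of "fr_seq Z A k" Ps] regular_fr_seqD(1)[of "fr_seq X Y l" Qs]
  by (auto simp: valid_structure_def valid_pair_def)

lemma valid_structure_symmetric:
  assumes "valid_structure r s k l X Z Ps Qs A Y"
  shows "t \<in> {1..k} \<Longrightarrow> symmetric_mat (A t)" "j \<in> {1..l} \<Longrightarrow> symmetric_mat (Y j)"
  using assms by (auto simp: valid_structure_def regular_fr_seq_def set_fr_seq)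

text \<open>Yields \<open>b i = 0\<close> for \<open>i\<close> up to \<open>k\<close> and, with the
  two sequences exchanged, the orthogonality of \<open>Z\<close> to the \<open>Y j\<close>.\<close>

lemma fr_seq_orthogonal_first:
  assumes "regular_fr_seq (fr_seq Z A k) Ps" "supported_on (- \<Union>(set Ps)) X" "psd X" "t \<in> {1..k}"
  shows "trace_prod (A t) X = 0"
proof -
  have "X \<in> psd_face (- \<Union>(set Ps))" using assms by (simp add: psd_face_def)
  then have "X \<in> {X. psd X \<and> (\<forall>M\<in>set (fr_seq Z A k). trace_prod M X = 0)}"
    using regular_fr_seq_reduces[OF assms(1)] by (simp add: reduces_psd_to_def)
  then show ?thesis using assms(4) by (simp add: set_fr_seq)
qed

lemma valid_output_correct:
  fixes X :: "('n::{finite,linorder}) sqmat"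
  assumes valid: "valid_state m (Output r s k l X Z A b C Y)"
  shows "correct_output m r s k l X Z A b C Y"
proof -
  have sz: "0 < r" "0 < s" "r + s < CARD('n)" "k \<le> m"
    and pr: "valid_pair r s X Z"
    and orth: "\<And>t j. t \<in> {1..m} \<Longrightarrow> j \<in> {1..l} \<Longrightarrow> trace_prod (A t) (Y j) = 0"
    and b: "\<And>i. i \<in> {1..m} \<Longrightarrow> b i = trace_prod (A i) X"
    using valid by (auto simp: valid_sizes_def)
  obtain Ps Qs where st: "valid_structure r s k l X Z Ps Qs A Y" using valid by auto
  obtain y where C: "C = Z + (\<Sum>i=1..m. y i *\<^sub>R A i)" using valid by auto
  have supX: "supported_on (lower_idx r) X" "diag_pd_block (lower_idx r) X"
    and supZ: "supported_on (upper_idx s) Z" "diag_pd_block (upper_idx s) Z"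
    using pr by (auto simp: valid_pair_def)
  have regP: "regular_fr_seq (fr_seq Z A k) Ps" "\<Union>(set Ps) = - lower_idx r"
    and regQ: "regular_fr_seq (fr_seq X Y l) Qs" "\<Union>(set Qs) = - upper_idx s"
    using st by (auto simp: valid_structure_def)
  have redP: "reduces_psd_to (fr_seq Z A k) (psd_face (lower_idx r))"
    and redQ: "reduces_psd_to (fr_seq X Y l) (psd_face (upper_idx s))"
    using reduces_psd_face_iff regP regQ by blast+
  have psdX: "psd X" and psdZ: "psd Z" using psd_diagonal supX supZ by blast+
  have b0: "b i = 0" if "i \<in> {1..k}" for i
    using fr_seq_orthogonal_first[OF regP(1) _ psdX that] b[of i] that sz(4) supX(1) regP(2) by simp
  have ZY: "trace_prod (Y j) Z = 0" if "j \<in> {1..l}" for j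
    by (rule fr_seq_orthogonal_first[OF regQ(1) _ psdZ that]) (use supZ(1) regQ(2) in simp)
  have CY: "trace_prod C (Y j) = 0" if "j \<in> {1..l}" for j
    using ZY[OF that] orth[OF _ that] trace_prod_commute[of Z "Y j"]
    by (simp add: C trace_prod_add_left trace_prod_sum_left trace_prod_scaleR_left)
  have slackZ: "slack m A C y = Z" by (simp add: slack_def C)
  have XZ: "trace_prod X Z = 0"
  proof -
    have "X $ p $ q * Z $ p $ q = 0" for p q
      using supX(1) supZ(1) upper_lower_idx_disjoint[of r s, where 'n = 'n] sz(3) unfolding supported_on_def
      by (metis IntI empty_iff less_imp_le mult_zero_left mult_zero_right)
    then have "inner X Z = 0" by (simp only: inner_matrix sum.neutral_const)
    then show ?thesis using psdZ by (simp add: trace_prod_inner psd_def)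
  qed
  have pair: "optimal_pair m A b C X Z"
    unfolding optimal_pair_def primal_feasible_def dual_feasible_def dual_feasible_vec_def
    using psdX psdZ b XZ slackZ by auto
  have rX: "rank X = r" and rZ: "rank Z = s"
    using rank_supported[OF supX(1)] rank_diag_pd_block[OF supX(2)] card_lower_idx[of r, where 'n = 'n]
      rank_supported[OF supZ(1)] rank_diag_pd_block[OF supZ(2)] card_upper_idx[of s, where 'n = 'n] sz(3) by auto
  have maxX: "max_rank_primal_optimal m A b C X"
    unfolding max_rank_primal_optimal_def
  proof (intro conjI allI impI)
    show "primal_optimal m A b C X" by (rule optimal_pairD[OF pair])
    fix X' assume X': "primal_optimal m A b C X'"
    \<comment> \<open>Complementarity with \<open>Z\<close> and the first \<open>k\<close>
      equations, whose right-hand sides are 0, place \<open>X'\<close> in the face of order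
      \<open>r\<close>.\<close>
    have "trace_prod Z X' = 0" by (rule optimal_pairD(3)[OF pair X'])
    moreover have "psd X'" "\<And>i. i \<in> {1..m} \<Longrightarrow> trace_prod (A i) X' = b i"
      using X' by (auto simp: primal_optimal_def primal_feasible_def)
    ultimately have "psd X' \<and> (\<forall>M\<in>set (fr_seq Z A k). trace_prod M X' = 0)"
      using b0 sz(4) by (auto simp: set_fr_seq)
    then have "X' \<in> psd_face (lower_idx r)" using redP by (auto simp: reduces_psd_to_def)
    then show "rank X' \<le> rank X"
      using rank_supported[of "lower_idx r" X'] card_lower_idx[of r, where 'n = 'n] sz rX by (simp add: psd_face_def)
  qed
  have maxZ: "max_rank_dual_optimal m A b C Z"
    unfolding max_rank_dual_optimal_def
  proof (intro conjI allI impI)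
    show "dual_optimal m A b C Z" by (rule optimal_pairD[OF pair])
    fix Z' assume Z': "dual_optimal m A b C Z'"
    then obtain y' where y': "psd Z'" "Z' = slack m A C y'"
      by (auto simp: dual_optimal_def dual_optimal_vec_def dual_feasible_vec_def)
    \<comment> \<open>Both \<open>C\<close> and all constraints are orthogonal to
      \<open>Y j\<close>, so every slack is; together with \<open>X\<close> this places
      \<open>Z'\<close> in the face of order \<open>s\<close>.\<close>
    have "trace_prod Z' (Y j) = 0" if "j \<in> {1..l}" for j
      using CY[OF that] orth[OF _ that]
      by (simp add: y'(2) slack_def trace_prod_diff_left trace_prod_sum_left trace_prod_scaleR_left)
    then have "psd Z' \<and> (\<forall>M\<in>set (fr_seq X Y l). trace_prod M Z' = 0)"
      using y'(1) optimal_pairD(4)[OF pair Z'] by (auto simp: set_fr_seq trace_prod_commute[of _ Z'])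
    then have "Z' \<in> psd_face (upper_idx s)" using redQ by (auto simp: reduces_psd_to_def)
    then show "rank Z' \<le> rank Z"
      using rank_supported[of "upper_idx s" Z'] card_upper_idx[of s, where 'n = 'n] sz rZ by (simp add: psd_face_def)
  qed
  have "fails_strict_complementarity m A b C"
    unfolding fails_strict_complementarity_def using pair maxX maxZ rX rZ sz(3) by blast
  moreover have "normal_form m r s k l X Z A b C Y"
    unfolding normal_form_def using b0 regP(1) regQ(1) redP redQ orth CY by blast
  ultimately show ?thesis using maxX maxZ by (simp add: correct_output_def)
qed

section \<open>One iteration of Algorithm 2\<close>

lemma regular_fr_seq_change_block:
  assumes reg: "regular_fr_seq (fr_seq M A k) Rs"
    and B: "\<And>i. i \<in> {1..k} \<Longrightarrow> symmetric_mat (B i)"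
      "\<And>i p q. i \<in> {1..k} \<Longrightarrow> p \<notin> \<Union>(set (take i Rs)) \<Longrightarrow> q \<notin> \<Union>(set (take i Rs)) \<Longrightarrow> B i $ p $ q = A i $ p $ q"
  shows "regular_fr_seq (fr_seq M B k) Rs"
proof (rule regular_fr_seq_change[OF reg])
  have len: "length Rs = Suc k" using regular_fr_seqD(1)[OF reg] by simp
  then show "length (fr_seq M B k) = length Rs" by simp
  fix i assume i: "i < length Rs"
  show "symmetric_mat (fr_seq M B k ! i)"
    using regular_fr_seqD(2)[OF reg i] B(1)[of i] i len by (cases "i = 0") (auto simp: fr_seq_nth)
  fix p q assume "p \<notin> \<Union>(set (take i Rs))" "q \<notin> \<Union>(set (take i Rs))"
  then show "fr_seq M B k ! i $ p $ q = fr_seq M A k ! i $ p $ q"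
    using B(2)[of i p q] i len by (cases "i = 0") (auto simp: fr_seq_nth)
qed

lemma valid_structure_block_step:
  assumes pr: "valid_pair r s X Z" and st: "valid_structure r s k l X Z Ps Qs A Y" and i: "i \<in> {1..k}"
    and A': "\<forall>t. t \<noteq> i \<longrightarrow> A' t = A t" "changes_block (Ps ! (i - 1)) (Qs ! 0) (A i) (A' i)"
    and Y': "\<forall>j\<in>{1..l}. changes_block (Ps ! (i - 1)) (Qs ! 0) (Y j) (Y' j)"
  shows "valid_structure r s k l X Z Ps Qs A' Y'"
    and "t \<in> {1..i - 1} \<Longrightarrow> j \<in> {1..l} \<Longrightarrow> trace_prod (A' t) (Y' j) = trace_prod (A t) (Y j)"
proof -
  note first = valid_structure_first[OF pr st]
  have regP: "regular_fr_seq (fr_seq Z A k) Ps" and UP: "\<Union>(set Ps) = - lower_idx r"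
    and regQ: "regular_fr_seq (fr_seq X Y l) Qs"
    using st by (auto simp: valid_structure_def)
  \<comment> \<open>The block is harmless for both sequences: its \<open>Ps ! (i - 1)\<close>
    indices precede the block of \<open>A i\<close>, its \<open>Qs ! 0\<close> indices precede the
    block of every \<open>Y j\<close>.\<close>
  have inP: "p \<in> \<Union>(set (take i Ps))" if "p \<in> Ps ! (i - 1)" for p
    unfolding mem_Union_take using that i first(3) by (intro exI[of _ "i - 1"]) auto
  have inQ: "q \<in> \<Union>(set (take j Qs))" if "q \<in> Qs ! 0" "j \<in> {1..l}" for q j
    unfolding mem_Union_take using that first(4) by (intro exI[of _ 0]) auto
  have "regular_fr_seq (fr_seq Z A' k) Ps"
  proof (rule regular_fr_seq_change_block[OF regP])
    show "symmetric_mat (A' t)" if "t \<in> {1..k}" for t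
      using A' valid_structure_symmetric(1)[OF st that] by (cases "t = i") (auto simp: changes_block_def)
    show "A' t $ p $ q = A t $ p $ q"
      if "t \<in> {1..k}" "p \<notin> \<Union>(set (take t Ps))" "q \<notin> \<Union>(set (take t Ps))" for t p q
    proof (cases "t = i")
      case True
      have "p \<notin> Ps ! (i - 1)"
        using that(2) unfolding True by (rule contrapos_nn) (rule inP)
      moreover have "q \<notin> Ps ! (i - 1)"
        using that(3) unfolding True by (rule contrapos_nn) (rule inP)
      ultimately show ?thesis using A'(2) unfolding changes_block_def True by blast
    next
      case False
      then show ?thesis using spec[OF A'(1), of t] by simp
    qed
  qed
  moreover have "regular_fr_seq (fr_seq X Y' l) Qs"
  proof (rule regular_fr_seq_change_block[OF regQ])
    show "symmetric_mat (Y' t)" if "t \<in> {1..l}" for t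
      using Y' that by (auto simp: changes_block_def)
    show "Y' t $ p $ q = Y t $ p $ q"
      if "t \<in> {1..l}" "p \<notin> \<Union>(set (take t Qs))" "q \<notin> \<Union>(set (take t Qs))" for t p q
      using Y' inQ[OF _ that(1)] that unfolding changes_block_def by blast
  qed
  ultimately show st': "valid_structure r s k l X Z Ps Qs A' Y'"
    using st by (simp add: valid_structure_def)
  show "trace_prod (A' t) (Y' j) = trace_prod (A t) (Y j)" if t: "t \<in> {1..i - 1}" and j: "j \<in> {1..l}"
  proof -
    have tk: "t < length Ps" "t \<le> k" "t \<noteq> 0" "i - 1 < length Ps" using t i first(3) by auto
    \<comment> \<open>For \<open>t = i - 1\<close> the index \<open>p\<close> lies in the block of
      \<open>A t\<close> itself; the entry still vanishes because \<open>q\<close> is outside every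
      member of \<open>Ps\<close>.\<close>
    have z: "A t $ p $ q = 0 \<and> A t $ q $ p = 0" if p: "p \<in> Ps ! (i - 1)" and q: "q \<in> Qs ! 0" for p q
    proof -
      have qn: "q \<notin> \<Union>(set Ps)" using q first(2) UP by auto
      have "p \<notin> \<Union>(set (take t Ps))"
        unfolding mem_Union_take using p regular_fr_seqD(5)[OF regP tk(4)] t by fastforce
      moreover have "q \<notin> \<Union>(set (take t Ps))" using qn by (auto dest: in_set_takeD)
      moreover have "q \<notin> Ps ! t" using qn tk(1) by auto
      ultimately show ?thesis
        using regular_fr_seqD(4)[OF regP tk(1), of p q] regular_fr_seqD(4)[OF regP tk(1), of q p] tk
        by (simp add: fr_seq_nth)
    qed
    have "A t $ p $ q * Y' j $ p $ q = A t $ p $ q * Y j $ p $ q" for p q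
    proof (cases "p \<in> Ps ! (i - 1) \<and> q \<in> Qs ! 0 \<or> p \<in> Qs ! 0 \<and> q \<in> Ps ! (i - 1)")
      case True
      then have "A t $ p $ q = 0" using z by blast
      then show ?thesis by simp
    next
      case False
      then have "Y' j $ p $ q = Y j $ p $ q" using Y' j unfolding changes_block_def by blast
      then show ?thesis by simp
    qed
    then have "inner (A t) (Y' j) = inner (A t) (Y j)" by (simp only: inner_matrix)
    moreover have "A' t = A t" using A'(1) t by auto
    ultimately show ?thesis
      using valid_structure_symmetric(2)[OF st j] valid_structure_symmetric(2)[OF st' j]
      by (simp add: trace_prod_inner)
  qed
qed

text \<open>One symmetric pair of entries gives enough freedom: once \<open>A i\<close> is nonzero
  there, each equation is solved by the same entry of its own \<open>Y j\<close>.\<close>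

lemma exists_block_step:
  assumes pr: "valid_pair r s X Z" and st: "valid_structure r s k l X Z Ps Qs A Y" and i: "i \<in> {1..k}"
    and p: "p \<in> Ps ! (i - 1)" and q: "q \<in> Qs ! 0"
  shows "\<exists>A' Y'. (\<forall>t. t \<noteq> i \<longrightarrow> A' t = A t) \<and> changes_block (Ps ! (i - 1)) (Qs ! 0) (A i) (A' i) \<and>
    (\<forall>j\<in>{1..l}. changes_block (Ps ! (i - 1)) (Qs ! 0) (Y j) (Y' j)) \<and>
    (\<forall>j\<in>{1..l}. trace_prod (A' i) (Y' j) = 0)"
proof -
  have "Ps ! (i - 1) \<in> set Ps" using i valid_structure_first(3)[OF pr st] by auto
  then have "p \<noteq> q" using p q valid_structure_first(2)[OF pr st] st by (auto simp: valid_structure_def)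
  define E :: "'a sqmat" where "E = axis p (axis q 1) + axis q (axis p 1)"
  have E: "E $ a $ b = (if a = p \<and> b = q \<or> a = q \<and> b = p then 1 else 0)" for a b
    using \<open>p \<noteq> q\<close> by (auto simp: E_def axis_def)
  have symE: "symmetric_mat E" by (auto simp: symmetric_mat_component E)
  have innerE: "inner M E = M $ p $ q + M $ q $ p" for M by (simp add: E_def inner_add_right inner_axis)
  have ch: "changes_block (Ps ! (i - 1)) (Qs ! 0) M (M + c *\<^sub>R E)" if "symmetric_mat M" for M c
    using that symE p q by (auto simp: changes_block_def symmetric_mat_component E)
  \<comment> \<open>Sets the entries at \<open>(p, q)\<close> and \<open>(q, p)\<close> to 1, so
    that \<open>inner M E\<close> is 2, the divisor in \<open>Y'\<close>.\<close>
  define M where "M = A i + (1 - A i $ p $ q) *\<^sub>R E"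
  have symA: "symmetric_mat (A i)" by (rule valid_structure_symmetric(1)[OF st i])
  have "M $ p $ q = 1" "M $ q $ p = 1"
    using symA by (auto simp: M_def E symmetric_mat_component)
  then have ME: "inner M E = 2" by (simp add: innerE)
  define Y' where "Y' = (\<lambda>j. Y j + (- inner M (Y j) / 2) *\<^sub>R E)"
  have chY: "changes_block (Ps ! (i - 1)) (Qs ! 0) (Y j) (Y' j)" if "j \<in> {1..l}" for j
    unfolding Y'_def by (rule ch[OF valid_structure_symmetric(2)[OF st that]])
  have "trace_prod M (Y' j) = 0" if "j \<in> {1..l}" for j
  proof -
    have "symmetric_mat (Y' j)" using chY[OF that] by (simp add: changes_block_def)
    moreover have "inner M (Y' j) = 0" by (simp add: Y'_def inner_diff_right inner_add_right ME)
    ultimately show ?thesis by (simp add: trace_prod_inner)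
  qed
  then show ?thesis
    using chY ch[OF symA] by (intro exI[of _ "A(i := M)"] exI[of _ Y']) (auto simp: M_def)
qed

section \<open>Admissible choices, preservation of the invariant, termination\<close>

lemma exists_nonempty_partition:
  assumes "finite D" "1 \<le> k" "k \<le> card D"
  shows "\<exists>Ds. length Ds = k \<and> {} \<notin> set Ds \<and> \<Union>(set Ds) = D \<and>
    (\<forall>i<k. \<forall>j<k. i \<noteq> j \<longrightarrow> Ds ! i \<inter> Ds ! j = {})"
  using assms(2,1,3)
proof (induction k arbitrary: D rule: dec_induct)
  case base
  then show ?case by (intro exI[of _ "[D]"]) auto
next
  case (step k)
  then obtain d where d: "d \<in> D" by (cases "D = {}") auto
  then have "finite (D - {d})" "k \<le> card (D - {d})" using step.prems by auto
  from step.IH[OF this] obtain Ds where Ds: "length Ds = k" "{} \<notin> set Ds" "\<Union>(set Ds) = D - {d}"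
    "\<forall>i<k. \<forall>j<k. i \<noteq> j \<longrightarrow> Ds ! i \<inter> Ds ! j = {}" by blast
  have dn: "d \<notin> Ds ! i" if "i < k" for i
    using that Ds(1,3) nth_mem[of i Ds] by blast
  show ?case
  proof (intro exI[of _ "{d} # Ds"] conjI allI impI)
    show "\<Union>(set ({d} # Ds)) = D" using Ds(3) d by auto
    fix i j assume "i < Suc k" "j < Suc k" "i \<noteq> j"
    then show "({d} # Ds) ! i \<inter> ({d} # Ds) ! j = {}"
      using Ds(4) dn by (auto simp: nth_Cons split: nat.split)
  qed (use Ds in auto)
qed

definition diag_indicator :: "'n::finite set \<Rightarrow> 'n sqmat" where
  "diag_indicator R = (\<chi> p q. if p = q \<and> p \<in> R then 1 else 0)"

lemma diag_indicator:
  "symmetric_mat (diag_indicator R)" "supported_on R (diag_indicator R)" "diag_pd_block R (diag_indicator R)"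
  by (auto simp: diag_indicator_def symmetric_mat_component supported_on_def diag_pd_block_iff)

text \<open>Shows that Step 3 always has a choice without empty blocks: diagonal 0-1 matrices on a
  partition of the remaining indices, of which there are enough by the bounds of Step 1.\<close>

lemma exists_regular_fr_seq:
  fixes M :: "'n::finite sqmat"
  assumes M: "supported_on R M" "diag_pd_block R M" and R: "R \<noteq> {}" "R \<inter> T = {}"
    and k: "1 \<le> k" "k \<le> CARD('n) - card R - card T"
  shows "\<exists>A Rs. regular_fr_seq (fr_seq M A k) Rs \<and> \<Union>(set Rs) = - T \<and> {} \<notin> set Rs"
proof -
  have "card (- (R \<union> T)) = CARD('n) - card R - card T"
    using R(2) by (simp add: Compl_eq_Diff_UNIV card_Diff_subset card_Un_disjoint)
  then obtain Ds where Ds: "length Ds = k" "{} \<notin> set Ds" "\<Union>(set Ds) = - (R \<union> T)"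
    "\<forall>i<k. \<forall>j<k. i \<noteq> j \<longrightarrow> Ds ! i \<inter> Ds ! j = {}"
    using exists_nonempty_partition[of "- (R \<union> T)" k] k by auto
  define A where "A = (\<lambda>i. diag_indicator (Ds ! (i - 1)))"
  have nth: "fr_seq M A k ! i = (if i = 0 then M else diag_indicator ((R # Ds) ! i))" if "i < Suc k" for i
    using that by (cases i) (auto simp: fr_seq_nth A_def)
  have supp: "supported_on ((R # Ds) ! i) (fr_seq M A k ! i)" "diag_pd_block ((R # Ds) ! i) (fr_seq M A k ! i)"
    "symmetric_mat (fr_seq M A k ! i)" if "i < Suc k" for i
    using M diag_indicator psd_diagonal[OF M] unfolding nth[OF that] by (auto simp: psd_def)
  have RD: "R \<inter> Ds ! i = {}" if "i < k" for i
    using that Ds(1,3) nth_mem[of i Ds] by blast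
  have "regular_fr_seq (fr_seq M A k) (R # Ds)"
    unfolding regular_fr_seq_def
  proof (intro conjI allI impI ballI)
    show "symmetric_mat S" if "S \<in> set (fr_seq M A k)" for S
      using that supp(3) by (auto simp: in_set_conv_nth)
    fix i assume i: "i < length (R # Ds)"
    show "diag_pd_block ((R # Ds) ! i) (fr_seq M A k ! i)" using supp(2) i Ds(1) by simp
    show "fr_seq M A k ! i $ p $ q = 0" if "p \<notin> \<Union>(set (take i (R # Ds))) \<and> q \<notin> \<Union>(set (take i (R # Ds))) \<and> \<not> (p \<in> (R # Ds) ! i \<and> q \<in> (R # Ds) ! i)" for p q
      using supp(1)[of i] that i Ds(1) by (auto simp: supported_on_def)
    show "(R # Ds) ! i \<inter> (R # Ds) ! j = {}" if "j < length (R # Ds)" "i \<noteq> j" for j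
      using that i Ds(1,4) RD by (auto simp: nth_Cons split: nat.split)
  qed (use Ds in simp)
  moreover have "\<Union>(set (R # Ds)) = - T" using Ds(3) R(2) by auto
  moreover have "{} \<notin> set (R # Ds)" using Ds(2) R(1) by auto
  ultimately show ?thesis by blast
qed

text \<open>The smallest relation that \<open>alg1_implementation\<close> admits: exactly the
  excludable choices are excluded.\<close>

definition careful_step :: "nat \<Rightarrow> ('n::{finite,linorder}) alg_state \<Rightarrow> 'n alg_state \<Rightarrow> bool" where
  "careful_step m \<sigma> \<sigma>' \<longleftrightarrow> alg1_step m \<sigma> \<sigma>' \<and> \<not> has_empty_block_choice \<sigma> \<sigma>'"

lemma careful_step_implementation: "alg1_implementation m (careful_step m)"
  by (simp add: alg1_implementation_def careful_step_def)

lemma careful_step_valid: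
  fixes \<sigma> :: "('n::{finite,linorder}) alg_state"
  assumes "careful_step m \<sigma> \<sigma>'" "valid_state m \<sigma>"
  shows "valid_state m \<sigma>'"
proof -
  have ne: "\<not> has_empty_block_choice \<sigma> \<sigma>'" and "alg1_step m \<sigma> \<sigma>'"
    using assms(1) by (auto simp: careful_step_def)
  from this(2,1) assms(2) show ?thesis
  proof (induction rule: alg1_step.induct)
    case (step3 Z A k Ps r X Y l Qs s)
    then have "{} \<notin> set (butlast Ps)" by (auto simp: has_empty_block_choice_def)
    moreover have "\<Union>(set Ps) = - lower_idx r" "\<Union>(set Qs) = - upper_idx s"
      using step3.hyps reduces_psd_face_iff by blast+
    ultimately show ?case using step3 by (simp add: valid_structure_def)
  next
    case (step4 i k A' A Ps Qs l Y Y' r s X Z)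
    have v: "valid_sizes TYPE('n) m r s k l" "valid_pair r s X Z" "valid_structure r s k l X Z Ps Qs A Y"
      "{} \<notin> set (butlast Ps)" "\<And>t j. t \<in> {1..i - 1} \<Longrightarrow> j \<in> {1..l} \<Longrightarrow> trace_prod (A t) (Y j) = 0"
      using step4.prems by auto
    note new = valid_structure_block_step[OF v(2,3) step4.hyps(1-4)]
    have "trace_prod (A' t) (Y' j) = 0" if t: "t \<in> {1..i}" and j: "j \<in> {1..l}" for t j
    proof (cases "t = i")
      case True then show ?thesis using step4.hyps(5) j by simp
    next
      case False
      then have "t \<in> {1..i - 1}" using t by auto
      then show ?thesis using new(2) v(5) j by simp
    qed
    then show ?case using v new(1) step4.hyps(1) by simp
  next
    case (step5 k A' A l Y r s X Z Ps Qs)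
    have st: "valid_structure r s k l X Z Ps Qs A Y" using step5.prems by simp
    have "fr_seq Z A' k = fr_seq Z A k" using step5.hyps(1) by (auto simp: fr_seq_def simp del: upt_Suc)
    then have "valid_structure r s k l X Z Ps Qs A' Y" using st by (simp add: valid_structure_def)
    moreover have "trace_prod (A' t) (Y j) = 0" if "t \<in> {1..m}" "j \<in> {1..l}" for t j
      using that step5 by (cases "t \<le> k") auto
    ultimately show ?case using step5.prems by auto
  qed (auto simp: valid_sizes_def valid_pair_def)
qed

lemma careful_step_exists:
  fixes \<sigma> :: "('n::{finite,linorder}) alg_state"
  assumes n: "CARD('n) \<ge> 3" and m: "m \<ge> 2" and v: "valid_state m \<sigma>"
  shows "is_output \<sigma> \<or> (\<exists>\<sigma>'. careful_step m \<sigma> \<sigma>')"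
proof (cases \<sigma>)
  case Start
  \<comment> \<open>All sizes 1 is possible because the order is at least 3, which leaves room for a
    nonempty middle block.\<close>
  have "alg1_step m \<sigma> (Sizes 1 1 1 1)" unfolding Start by (rule step1) (use n m in auto)
  then show ?thesis unfolding Start careful_step_def has_empty_block_choice_def by blast
next
  case (Sizes r s k l)
  have "alg1_step m \<sigma> (Optimal_Matrices r s k l (diag_indicator (lower_idx r)) (diag_indicator (upper_idx s)))"
    unfolding Sizes by (rule step2) (rule diag_indicator)+
  then show ?thesis unfolding Sizes careful_step_def has_empty_block_choice_def by blast
next
  case (Optimal_Matrices r s k l X Z)
  have sz: "valid_sizes TYPE('n) m r s k l" and pr: "valid_pair r s X Z" using v Optimal_Matrices by auto
  have cr: "card (lower_idx r :: 'n set) = r" and cs: "card (upper_idx s :: 'n set) = s"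
    using card_lower_idx[of r, where 'n = 'n] card_upper_idx[of s, where 'n = 'n] sz by (auto simp: valid_sizes_def)
  have ne: "(lower_idx r :: 'n set) \<noteq> {}" "(upper_idx s :: 'n set) \<noteq> {}"
    using cr cs sz by (auto simp: valid_sizes_def)
  have dj: "(upper_idx s :: 'n set) \<inter> lower_idx r = {}"
    using sz by (intro upper_lower_idx_disjoint) (auto simp: valid_sizes_def)
  have supp: "supported_on (lower_idx r) X" "diag_pd_block (lower_idx r) X"
    "supported_on (upper_idx s) Z" "diag_pd_block (upper_idx s) Z"
    using pr by (auto simp: valid_pair_def)
  have kl: "1 \<le> k" "k \<le> CARD('n) - card (upper_idx s :: 'n set) - card (lower_idx r :: 'n set)"
    "1 \<le> l" "l \<le> CARD('n) - card (lower_idx r :: 'n set) - card (upper_idx s :: 'n set)"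
    using sz cr cs by (auto simp: valid_sizes_def)
  obtain A Ps where A: "regular_fr_seq (fr_seq Z A k) Ps" "\<Union>(set Ps) = - lower_idx r" "{} \<notin> set Ps"
    using exists_regular_fr_seq[OF supp(3,4) ne(2) dj, of k] kl by blast
  obtain Y Qs where Y: "regular_fr_seq (fr_seq X Y l) Qs" "\<Union>(set Qs) = - upper_idx s"
    using exists_regular_fr_seq[OF supp(1,2) ne(1) dj[unfolded Int_commute[of "upper_idx s"]], of l] kl by blast
  have red: "reduces_psd_to (fr_seq Z A k) (psd_face (lower_idx r))"
    "reduces_psd_to (fr_seq X Y l) (psd_face (upper_idx s))"
    using A Y reduces_psd_face_iff by blast+
  have "alg1_step m \<sigma> (Base_Equations r s k l X Z Ps Qs 0 A Y)"
    unfolding Optimal_Matrices using A Y red by (intro step3)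
  moreover have "\<not> has_empty_block_choice \<sigma> (Base_Equations r s k l X Z Ps Qs 0 A Y)"
    using A(3) by (auto simp: has_empty_block_choice_def dest: in_set_butlastD)
  ultimately show ?thesis unfolding careful_step_def by blast
next
  case (Base_Equations r s k l X Z Ps Qs i A Y)
  have sz: "valid_sizes TYPE('n) m r s k l" and pr: "valid_pair r s X Z"
    and st: "valid_structure r s k l X Z Ps Qs A Y" and ne: "{} \<notin> set (butlast Ps)" and ik: "i \<le> k"
    using v Base_Equations by auto
  have nh: "\<not> has_empty_block_choice \<sigma> \<sigma>'" for \<sigma>'
    unfolding Base_Equations has_empty_block_choice_def by blast
  show ?thesis
  proof (cases "i = k")
    case True
    \<comment> \<open>The zero matrix is orthogonal to everything, so it can serve for all the
      remaining constraints.\<close>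
    have "alg1_step m \<sigma> (All_Equations r s k l X Z (\<lambda>t. if t \<in> {1..k} then A t else 0) Y)"
      unfolding Base_Equations True
      by (rule step5) (auto simp: symmetric_mat_component trace_prod_inner_transpose)
    then show ?thesis using nh unfolding careful_step_def by blast
  next
    case False
    note first = valid_structure_first[OF pr st]
    let ?i = "Suc i"
    have i1: "?i \<in> {1..k}" using False ik by auto
    \<comment> \<open>Iteration \<open>Suc i\<close> works on block \<open>i\<close>, which is less
      than \<open>k\<close> and thus among those required to be nonempty.\<close>
    have "i < length (butlast Ps)" using first(3) i1 by simp
    then have "Ps ! i \<noteq> {}" using ne nth_mem[of i "butlast Ps"] by (metis nth_butlast)
    then obtain p where p: "p \<in> Ps ! (?i - 1)" by auto
    have "card (lower_idx r :: 'n set) = r" "0 < r"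
      using card_lower_idx[of r, where 'n = 'n] sz by (auto simp: valid_sizes_def)
    then have "(lower_idx r :: 'n set) \<noteq> {}" by auto
    then obtain q where q: "q \<in> Qs ! 0" using first(2) by blast
    obtain A' Y' where *: "\<forall>t. t \<noteq> ?i \<longrightarrow> A' t = A t" "changes_block (Ps ! (?i - 1)) (Qs ! 0) (A ?i) (A' ?i)"
      "\<forall>j\<in>{1..l}. changes_block (Ps ! (?i - 1)) (Qs ! 0) (Y j) (Y' j)" "\<forall>j\<in>{1..l}. trace_prod (A' ?i) (Y' j) = 0"
      using exists_block_step[OF pr st i1 p q] by blast
    have "alg1_step m \<sigma> (Base_Equations r s k l X Z Ps Qs ?i A' Y')"
      using step4[OF i1 *] unfolding Base_Equations by simp
    then show ?thesis using nh unfolding careful_step_def by blast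
  qed
next
  case (All_Equations r s k l X Z A Y)
  have "alg1_step m \<sigma> (Output r s k l X Z A (\<lambda>i. trace_prod (A i) X) (Z + (\<Sum>i=1..m. 0 *\<^sub>R A i)) Y)"
    unfolding All_Equations by (rule step6[where y = "\<lambda>_. 0"]) auto
  then show ?thesis unfolding All_Equations careful_step_def has_empty_block_choice_def by blast
next
  case (Output r s k l X Z A b C Y)
  then show ?thesis by (auto simp: is_output_def)
qed

text \<open>Termination measure. At the start the number \<open>k\<close> of iterations is not yet
  chosen, so it is replaced by its bound, the order of the matrices.\<close>

fun remaining_steps :: "('n::finite) alg_state \<Rightarrow> nat" where
  "remaining_steps (Start :: 'n alg_state) = CARD('n) + 5"
| "remaining_steps (Sizes r s k l) = k + 4"
| "remaining_steps (Optimal_Matrices r s k l X Z) = k + 3"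
| "remaining_steps (Base_Equations r s k l X Z Ps Qs i A Y) = k - i + 2"
| "remaining_steps (All_Equations r s k l X Z A Y) = 1"
| "remaining_steps (Output r s k l X Z A b C Y) = 0"

lemma alg1_step_decreases:
  "alg1_step m \<sigma> \<sigma>' \<Longrightarrow> remaining_steps \<sigma>' < remaining_steps \<sigma>"
  by (induction rule: alg1_step.induct) auto

lemma careful_step_succeeds:
  assumes "CARD('n::{finite,linorder}) \<ge> 3" "m \<ge> 2"
  shows "succeeds_in_every_run (careful_step m :: 'n alg_state \<Rightarrow> _)"
  unfolding succeeds_in_every_run_def
proof (intro conjI allI impI notI)
  assume "\<exists>f. f 0 = (Start :: 'n alg_state) \<and> (\<forall>t. careful_step m (f t) (f (Suc t)))"
  then obtain f :: "nat \<Rightarrow> 'n alg_state" where f: "\<And>t. careful_step m (f t) (f (Suc t))" by blast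
  have dec: "remaining_steps (f (Suc t)) < remaining_steps (f t)" for t
    using f alg1_step_decreases unfolding careful_step_def by blast
  have "remaining_steps (f t) + t \<le> remaining_steps (f 0)" for t
  proof (induction t)
    case (Suc t)
    then show ?case using dec[of t] by linarith
  qed simp
  from this[of "Suc (remaining_steps (f 0))"] show False by simp
next
  fix \<sigma> :: "'n alg_state" assume "(careful_step m)\<^sup>*\<^sup>* Start \<sigma>"
  then have "valid_state m \<sigma>"
    by (induction rule: rtranclp_induct) (auto intro: careful_step_valid)
  then show "is_output \<sigma> \<or> (\<exists>\<sigma>'. careful_step m \<sigma> \<sigma>')" by (rule careful_step_exists[OF assms])
qed

lemma careful_step_correct:
  assumes "(careful_step m)\<^sup>*\<^sup>* Start (Output r s k l X Z A b C Y)"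
  shows "correct_output m r s k l X Z A b C Y"
proof -
  have "valid_state m \<sigma>" if "(careful_step m)\<^sup>*\<^sup>* Start \<sigma>" for \<sigma>
    using that by (induction rule: rtranclp_induct) (auto intro: careful_step_valid)
  from valid_output_correct[OF this[OF assms]] show ?thesis .
qed

section \<open>Every failure of strict complementarity is an output\<close>

lemma dim_null_space_symmetric:
  fixes M :: "real^'n^'n"
  assumes "symmetric_mat M"
  shows "dim {x. M *v x = 0} + rank M = CARD('n)"
proof -
  have "{x. M *v x = 0} = {y \<in> UNIV. \<forall>x\<in>range ((*v) M). orthogonal x y}"
  proof -
    have "M *v x = 0 \<longleftrightarrow> (\<forall>y. (M *v y) \<bullet> x = 0)" for x
    proof -
      have "(M *v y) \<bullet> x = (M *v x) \<bullet> y" for y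
        using symmetric_inner_commute[OF assms, of x y] by (simp add: inner_commute)
      then show ?thesis by (metis inner_eq_zero_iff inner_zero_left)
    qed
    then show ?thesis by (auto simp: orthogonal_def)
  qed
  moreover have "subspace (range ((*v) M))" by (simp add: linear_subspace_image)
  ultimately show ?thesis
    using dim_subspace_orthogonal_to_vectors[of "range ((*v) M)" UNIV]
    by (simp add: rank_dim_range)
qed

lemma trace_prod_zero_if_range:
  assumes "range ((*v) X) \<subseteq> {x. Z *v x = 0}"
  shows "trace_prod Z X = 0"
proof -
  have "(Z ** X) *v x = 0 *v x" for x
    using assms by (auto simp: matrix_vector_mul_assoc[symmetric])
  then have "Z ** X = 0" by (simp add: matrix_eq)
  then show ?thesis by (simp add: trace_prod_def trace_def)
qed

text \<open>Double orthogonal complement inside the symmetric matrices: the residual of the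
  projection of \<open>S\<close> is again symmetric, so it can be tested as
  \<open>h\<close>.\<close>

lemma span_if_orthogonal_complement:
  fixes A :: "nat \<Rightarrow> real^'n^'n"
  assumes A: "\<And>i. i \<in> I \<Longrightarrow> symmetric_mat (A i)" and S: "symmetric_mat S"
    and orth: "\<And>h. symmetric_mat h \<Longrightarrow> (\<And>i. i \<in> I \<Longrightarrow> inner (A i) h = 0) \<Longrightarrow> inner S h = 0"
  shows "S \<in> span (A ` I)"
proof -
  obtain y z where yz: "y \<in> span (A ` I)" "\<And>w. w \<in> span (A ` I) \<Longrightarrow> orthogonal z w" "S = y + z"
    using orthogonal_subspace_decomp_exists[of "A ` I" S] by metis
  have "span (A ` I) \<subseteq> {M. symmetric_mat M}"
    by (rule span_minimal[OF _ subspace_symmetric_mat]) (use A in auto)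
  then have "symmetric_mat z"
    using yz(1,3) S subspace_diff[OF subspace_symmetric_mat, of S y] by auto
  moreover have "inner (A i) z = 0" if "i \<in> I" for i
    using yz(2)[OF span_base, of "A i"] that by (auto simp: orthogonal_def inner_commute)
  ultimately have "inner S z = 0" by (rule orth)
  moreover have "inner y z = 0" using yz(2)[OF yz(1)] by (simp add: orthogonal_def inner_commute)
  ultimately have "z = 0" by (simp add: yz(3) inner_add_left)
  then show ?thesis using yz by simp
qed

lemma rank_zero_iff: "rank M = 0 \<longleftrightarrow> M = 0" for M :: "real^'n^'n"
proof
  assume "rank M = 0"
  then have "range ((*v) M) \<subseteq> {0}" by (simp add: rank_dim_range)
  then show "M = 0" by (metis UNIV_I image_subset_iff matrix_eq matrix_vector_mult_0 singletonD)
qed (simp add: rank_dim_range image_def)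

text \<open>Both chains come from \<open>facial_reduction_chain\<close>, with \<open>H\<close> the
  directions of the primal feasible set and of the slacks, respectively. These two spaces are
  orthogonal complements in the symmetric matrices, so the first chain lies in the span of the
  constraints and the second is orthogonal to it.\<close>

lemma exists_certificate_chains:
  fixes A :: "nat \<Rightarrow> real^'n^'n"
  assumes A: "\<And>i. i \<in> {1..m} \<Longrightarrow> symmetric_mat (A i)" and pair: "optimal_pair m A b C X Z"
    and maxX: "max_rank_primal_optimal m A b C X" and maxZ: "max_rank_dual_optimal m A b C Z"
    and rk: "rank X + rank Z < CARD('n)"
  obtains Ss Ts where "0 < rank X" "0 < rank Z" "Ss \<noteq> []" "Ts \<noteq> []"
    "length Ss \<le> CARD('n) - rank X - rank Z" "length Ts \<le> CARD('n) - rank X - rank Z"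
    "fr_chain {x. Z *v x = 0} Ss" "fr_space {x. Z *v x = 0} Ss (length Ss) = range ((*v) X)"
    "fr_chain {x. X *v x = 0} Ts" "fr_space {x. X *v x = 0} Ts (length Ts) = range ((*v) Z)"
    "\<And>S. S \<in> set Ss \<Longrightarrow> S \<in> span (A ` {1..m})"
    "\<And>i. i < length Ss \<Longrightarrow> \<exists>x\<in>fr_space {x. Z *v x = 0} Ss i. x \<bullet> (Ss ! i *v x) \<noteq> 0"
    "\<And>T h. T \<in> set Ts \<Longrightarrow> h \<in> span (A ` {1..m}) \<Longrightarrow> inner h T = 0"
proof -
  define HP where "HP = {M. symmetric_mat M \<and> (\<forall>i\<in>{1..m}. inner (A i) M = 0)}"
  let ?HD = "span (A ` {1..m})"
  have HP: "subspace HP"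
    using subspace_symmetric_mat by (auto simp: HP_def subspace_def inner_add_right)
  have HPsym: "symmetric_mat h" if "h \<in> HP" for h using that by (simp add: HP_def)
  have "A ` {1..m} \<subseteq> {M. symmetric_mat M}" using A by auto
  from span_minimal[OF this subspace_symmetric_mat]
  have HDsym: "symmetric_mat h" if "h \<in> ?HD" for h
    using that by blast
  have spanI: "S \<in> ?HD" if "symmetric_mat S" "\<And>h. h \<in> HP \<Longrightarrow> inner S h = 0" for S
    by (rule span_if_orthogonal_complement[OF A that(1)]) (use that(2) in \<open>auto simp: HP_def\<close>)
  obtain y where X: "psd X" and feasX: "\<And>i. i \<in> {1..m} \<Longrightarrow> trace_prod (A i) X = b i"
    and Z: "psd Z" "Z = slack m A C y" and XZ: "trace_prod X Z = 0"
    using pair by (auto simp: optimal_pair_def primal_feasible_def dual_feasible_def dual_feasible_vec_def)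
  have symX: "symmetric_mat X" and symZ: "symmetric_mat Z" using X Z by (auto simp: psd_def)
  \<comment> \<open>Maximality of the rank restated for directions: a psd matrix
    \<open>X + h\<close> that is complementary to \<open>Z\<close> is another optimal
    solution.\<close>
  have P: "rank (X + h) \<le> rank X" if h: "h \<in> HP" and p: "psd (X + h)" and t: "trace_prod (X + h) Z = 0" for h
  proof -
    have "trace_prod (A i) (X + h) = b i" if "i \<in> {1..m}" for i
      using that feasX[OF that] h symX p by (simp add: HP_def trace_prod_inner psd_def inner_add_right)
    then have "optimal_pair m A b C (X + h) Z"
      using pair p t by (auto simp: optimal_pair_def primal_feasible_def)
    from optimal_pairD(1)[OF this] show ?thesis using maxX by (simp add: max_rank_primal_optimal_def)
  qed
  have D: "rank (Z + h) \<le> rank Z" if h: "h \<in> ?HD" and p: "psd (Z + h)" and t: "trace_prod X (Z + h) = 0" for h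
  proof -
    obtain c where c: "h = (\<Sum>i=1..m. c i *\<^sub>R A i)" using in_span_image[OF _ h] by auto
    have "Z + h = slack m A C (\<lambda>i. y i - c i)"
      by (simp add: Z(2) slack_def c scaleR_diff_left sum_subtractf)
    then have "optimal_pair m A b C X (Z + h)"
      using pair p t by (auto simp: optimal_pair_def dual_feasible_def dual_feasible_vec_def)
    from optimal_pairD(2)[OF this] show ?thesis using maxZ by (simp add: max_rank_dual_optimal_def)
  qed
  have innerZX: "inner Z X = 0" and innerXZ: "inner X Z = 0"
    using XZ symZ by (simp_all add: trace_prod_inner inner_commute)
  have RX: "range ((*v) X) \<subseteq> {x. Z *v x = 0}"
    using inner_psd_zero_on[OF X subset_UNIV subspace_UNIV symZ psd_nonneg[OF Z(1)] innerZX]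
      psd_null_vector[OF Z(1)] by auto
  have RZ: "range ((*v) Z) \<subseteq> {x. X *v x = 0}"
    using inner_psd_zero_on[OF Z(1) subset_UNIV subspace_UNIV symX psd_nonneg[OF X] innerXZ]
      psd_null_vector[OF X] by auto
  have subker: "subspace {x. M *v x = 0}" for M :: "real^'n^'n"
    by (auto simp: subspace_def matrix_vector_right_distrib matrix_vector_mult_scaleR)
  \<comment> \<open>With \<open>X = 0\<close> complementarity with \<open>X\<close> is no
    restriction, and maximality keeps every slack singular. Separation then gives a nonzero psd
    matrix in \<open>HP\<close> orthogonal to \<open>Z\<close>, which is an optimal solution of
    positive rank.\<close>
  have posX: "0 < rank X"
  proof (rule ccontr)
    assume "\<not> 0 < rank X"
    then have X0: "X = 0" by (simp add: rank_zero_iff)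
    have "Z + h \<notin> relint_face UNIV" if "h \<in> ?HD" for h
    proof
      assume r: "Z + h \<in> relint_face UNIV"
      have "rank (Z + h) \<le> rank Z"
        using relint_face_psd[OF subspace_UNIV r] by (intro D[OF that]) (auto simp: X0 trace_prod_def trace_def)
      then show False using dim_le_rank_relint_face[OF subspace_UNIV r] rk by simp
    qed
    from facial_reduction_step[OF subspace_span HDsym subspace_UNIV Z(1) subset_UNIV this] obtain Y
      where Y: "symmetric_mat Y" "\<And>h. h \<in> ?HD \<Longrightarrow> inner Y h = 0" "inner Y Z = 0"
        "\<And>v. 0 \<le> v \<bullet> (Y *v v)" "\<exists>v. v \<bullet> (Y *v v) \<noteq> 0" by auto
    have "inner (A i) Y = 0" if "i \<in> {1..m}" for i
      using Y(2)[OF span_base[OF imageI[OF that]]] by (subst inner_commute)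
    then have "Y \<in> HP" using Y(1) by (simp add: HP_def)
    moreover have "psd (X + Y)" using Y by (simp add: X0 psd_def)
    moreover have "trace_prod (X + Y) Z = 0" using Y(3) symZ by (simp add: X0 trace_prod_inner)
    ultimately have "rank (X + Y) \<le> rank X" by (rule P)
    then have "Y = 0" using rank_zero_iff[of Y] rank_zero_iff[of X] X0 by simp
    then show False using Y(5) by simp
  qed
  have posZ: "0 < rank Z"
  proof (rule ccontr)
    assume "\<not> 0 < rank Z"
    then have Z0: "Z = 0" by (simp add: rank_zero_iff)
    have "X + h \<notin> relint_face UNIV" if "h \<in> HP" for h
    proof
      assume r: "X + h \<in> relint_face UNIV"
      have "rank (X + h) \<le> rank X"
        using relint_face_psd[OF subspace_UNIV r] by (intro P[OF that]) (auto simp: Z0 trace_prod_def trace_def)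
      then show False using dim_le_rank_relint_face[OF subspace_UNIV r] rk by simp
    qed
    from facial_reduction_step[OF HP HPsym subspace_UNIV X subset_UNIV this] obtain S
      where S: "symmetric_mat S" "\<And>h. h \<in> HP \<Longrightarrow> inner S h = 0" "inner S X = 0"
        "\<And>v. 0 \<le> v \<bullet> (S *v v)" "\<exists>v. v \<bullet> (S *v v) \<noteq> 0" by auto
    have "S \<in> ?HD" by (rule spanI[OF S(1,2)])
    moreover have "psd (Z + S)" using S by (simp add: Z0 psd_def)
    moreover have "trace_prod X (Z + S) = 0" using S(1,3) by (simp add: Z0 trace_prod_inner inner_commute)
    ultimately have "rank (Z + S) \<le> rank Z" by (rule D)
    then have "S = 0" using rank_zero_iff[of S] rank_zero_iff[of Z] Z0 by simp
    then show False using S(5) by simp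
  qed
  have dimZ: "dim {x. Z *v x = 0} + rank Z = CARD('n)" and dimX: "dim {x. X *v x = 0} + rank X = CARD('n)"
    using dim_null_space_symmetric symX symZ by blast+
  have PR: "rank (X + h) \<le> rank X"
    if "h \<in> HP" "psd (X + h)" "range ((*v) (X + h)) \<subseteq> {x. Z *v x = 0}" for h
    using P[OF that(1,2)] trace_prod_zero_if_range[OF that(3)] by (simp add: trace_prod_commute[of Z])
  obtain Ss where
    Ss: "fr_chain {x. Z *v x = 0} Ss" "fr_space {x. Z *v x = 0} Ss (length Ss) = range ((*v) X)"
      "rank X + length Ss \<le> dim {x. Z *v x = 0}"
      "\<And>S h. S \<in> set Ss \<Longrightarrow> h \<in> HP \<Longrightarrow> inner S h = 0" "\<And>S. S \<in> set Ss \<Longrightarrow> inner S X = 0"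
      "\<And>i. i < length Ss \<Longrightarrow> \<exists>x\<in>fr_space {x. Z *v x = 0} Ss i. x \<bullet> (Ss ! i *v x) \<noteq> 0"
    by (rule facial_reduction_chain[OF HP HPsym X subker RX PR]; (assumption | rule that))
  have DR: "rank (Z + h) \<le> rank Z"
    if "h \<in> ?HD" "psd (Z + h)" "range ((*v) (Z + h)) \<subseteq> {x. X *v x = 0}" for h
    using D[OF that(1,2)] trace_prod_zero_if_range[OF that(3)] by simp
  obtain Ts where
    Ts: "fr_chain {x. X *v x = 0} Ts" "fr_space {x. X *v x = 0} Ts (length Ts) = range ((*v) Z)"
      "rank Z + length Ts \<le> dim {x. X *v x = 0}"
      "\<And>T h. T \<in> set Ts \<Longrightarrow> h \<in> ?HD \<Longrightarrow> inner T h = 0" "\<And>T. T \<in> set Ts \<Longrightarrow> inner T Z = 0"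
      "\<And>i. i < length Ts \<Longrightarrow> \<exists>x\<in>fr_space {x. X *v x = 0} Ts i. x \<bullet> (Ts ! i *v x) \<noteq> 0"
    by (rule facial_reduction_chain[OF subspace_span HDsym Z(1) subker RZ DR]; (assumption | rule that))
  show ?thesis
  proof (rule that[OF posX posZ _ _ _ _ Ss(1,2) Ts(1,2) _ Ss(6)])
    \<comment> \<open>An empty chain would identify the null space of \<open>Z\<close> with the
      range of \<open>X\<close>, and the ranks would add up to the full order.\<close>
    show "Ss \<noteq> []" using Ss(2) rk dimZ by (auto simp: rank_dim_range)
    show "Ts \<noteq> []" using Ts(2) rk dimX by (auto simp: rank_dim_range)
    show "length Ss \<le> CARD('n) - rank X - rank Z" "length Ts \<le> CARD('n) - rank X - rank Z"
      using Ss(3) Ts(3) dimX dimZ by linarith+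
    show "S \<in> ?HD" if "S \<in> set Ss" for S
      using that Ss(4) fr_chainD(1)[OF Ss(1)] by (intro spanI) (auto simp: in_set_conv_nth)
    show "inner h T = 0" if "T \<in> set Ts" "h \<in> ?HD" for T h using Ts(4)[OF that] by (simp add: inner_commute)
  qed
qed

section \<open>Rotations and adapted bases\<close>

lemma congruence_component:
  fixes M T :: "real^'n^'n"
  shows "(transpose T ** M ** T) $ p $ q = column p T \<bullet> (M *v column q T)"
proof -
  have "(transpose T ** M ** T) $ p $ q = axis p 1 \<bullet> (transpose T *v (M *v (T *v axis q 1)))"
    by (simp add: quadratic_form_axis[symmetric] matrix_vector_mul_assoc matrix_mul_assoc)
  also have "\<dots> = (T *v axis p 1) \<bullet> (M *v (T *v axis q 1))"
    by (metis dot_lmul_matrix inner_commute transpose_matrix_vector transpose_transpose)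
  finally show ?thesis by (simp add: matrix_vector_mult_basis)
qed

lemma symmetric_congruence:
  fixes M T :: "real^'n^'n"
  shows "symmetric_mat M \<Longrightarrow> symmetric_mat (transpose T ** M ** T)"
  unfolding symmetric_mat_component[of "transpose T ** M ** T"] congruence_component
  by (auto intro: symmetric_inner_commute)

text \<open>Block \<open>i\<close> consists of the columns that drop out of the flag at step
  \<open>i\<close>. A column that stays is a null vector of the \<open>i\<close>-th form and so lies
  in its radical, which clears the entries outside the block; adaptedness makes the block
  diagonal.\<close>

lemma regular_fr_seq_adapted:
  fixes T :: "real^'n^'n"
  assumes ch: "fr_chain UNIV Ss" and k: "k < length Ss" and len: "length Ys = Suc k"
    and Ys: "\<And>i. i \<le> k \<Longrightarrow> Ys ! i = transpose T ** Ss ! i ** T"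
    and ad: "\<And>i p q. i \<le> k \<Longrightarrow> p \<noteq> q \<Longrightarrow> column p T \<in> fr_space UNIV Ss i \<Longrightarrow>
      column q T \<in> fr_space UNIV Ss i \<Longrightarrow> column p T \<bullet> (Ss ! i *v column q T) = 0"
  shows "\<exists>Rs. regular_fr_seq Ys Rs \<and> \<Union>(set Rs) = {p. column p T \<notin> fr_space UNIV Ss (Suc k)}"
proof -
  let ?V = "fr_space UNIV Ss"
  define R where "R = (\<lambda>i. {p. column p T \<in> ?V i \<and> column p T \<notin> ?V (Suc i)})"
  define Rs where "Rs = map R [0..<Suc k]"
  have lRs: "length Rs = Suc k" by (simp add: Rs_def)
  have nth: "Rs ! i = R i" if "i \<le> k" for i using that by (simp add: Rs_def nth_append del: upt_Suc)
  have un: "(\<Union>j<i. R j) = {p. column p T \<notin> ?V i}" for i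
  proof (induction i)
    case (Suc i)
    have "?V (Suc i) \<subseteq> ?V i" by (rule fr_space_antimono) simp
    then show ?case using Suc by (auto simp: lessThan_Suc R_def)
  qed (simp add: fr_space_def)
  have take: "\<Union>(set (take i Rs)) = {p. column p T \<notin> ?V i}" if "i \<le> Suc k" for i
  proof -
    have "set (take i Rs) = R ` {..<i}"
      using that by (auto simp: Rs_def take_map take_upt simp del: upt_Suc)
    then show ?thesis using un[of i] by simp
  qed
  have sub: "subspace (?V i)" if "i \<le> k" for i
    using that k by (intro subspace_fr_space[OF subspace_UNIV ch]) auto
  have "regular_fr_seq Ys Rs"
    unfolding regular_fr_seq_def
  proof (intro conjI allI impI ballI)
    show "length Ys = length Rs" using len lRs by simp
    show "symmetric_mat M" if "M \<in> set Ys" for M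
      using that len Ys fr_chainD(1)[OF ch] k by (auto simp: in_set_conv_nth less_Suc_eq_le intro!: symmetric_congruence)
  next
    fix i j assume ij: "i < length Rs" "j < length Rs" "i \<noteq> j"
    have "R i \<inter> R j = {}" if "i < j" for i j
      using fr_space_antimono[of "Suc i" j UNIV Ss] that by (auto simp: R_def)
    then show "Rs ! i \<inter> Rs ! j = {}"
      using ij lRs nth[of i] nth[of j] by (metis Int_commute less_Suc_eq_le linorder_neqE_nat)
  next
    fix i assume "i < length Rs"
    then have i: "i \<le> k" "i < length Ss" using lRs k by auto
    have "0 < column p T \<bullet> (Ss ! i *v column p T)" if "p \<in> R i" for p
      using that fr_chainD(2)[OF ch i(2), of "column p T"] by (auto simp: R_def fr_space_Suc less_le)
    then show "diag_pd_block (Rs ! i) (Ys ! i)"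
      unfolding diag_pd_block_iff nth[OF i(1)] Ys[OF i(1)] congruence_component
      using ad[OF i(1)] by (auto simp: R_def)
    fix p q assume pq: "p \<notin> \<Union>(set (take i Rs)) \<and> q \<notin> \<Union>(set (take i Rs)) \<and> \<not> (p \<in> Rs ! i \<and> q \<in> Rs ! i)"
    then have V: "column p T \<in> ?V i" "column q T \<in> ?V i"
      and "column p T \<in> ?V (Suc i) \<or> column q T \<in> ?V (Suc i)"
      using take[of i] i nth[OF i(1)] by (auto simp: R_def)
    then have "column p T \<bullet> (Ss ! i *v column p T) = 0 \<or> column q T \<bullet> (Ss ! i *v column q T) = 0"
      by (auto simp: fr_space_Suc)
    then have "column p T \<bullet> (Ss ! i *v column q T) = 0"
      using psd_kernel_on[OF sub[OF i(1)] fr_chainD[OF ch i(2)]] V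
        symmetric_inner_commute[OF fr_chainD(1)[OF ch i(2)], of "column p T" "column q T"] by metis
    then show "Ys ! i $ p $ q = 0" by (simp add: Ys[OF i(1)] congruence_component)
  qed
  moreover have "\<Union>(set Rs) = {p. column p T \<notin> ?V (Suc k)}"
    using take[of "Suc k"] lRs by simp
  ultimately show ?thesis by blast
qed

lemma bij_betw_prescribed:
  fixes A1 A2 :: "'a::finite set"
  assumes "A1 \<inter> A2 = {}" "B1 \<subseteq> B" "B2 \<subseteq> B" "B1 \<inter> B2 = {}" "finite B"
    and "card A1 = card B1" "card A2 = card B2" "CARD('a) = card B"
  obtains \<beta> where "bij_betw \<beta> UNIV B" "\<And>p. \<beta> p \<in> B1 \<longleftrightarrow> p \<in> A1" "\<And>p. \<beta> p \<in> B2 \<longleftrightarrow> p \<in> A2"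
proof -
  let ?A3 = "- (A1 \<union> A2)" and ?B3 = "B - (B1 \<union> B2)"
  have fin: "finite B1" "finite B2" using assms finite_subset by blast+
  have "card ?A3 = card ?B3"
  proof -
    have "card ?A3 = CARD('a) - (card A1 + card A2)"
      using assms(1) by (simp add: Compl_eq_Diff_UNIV card_Diff_subset card_Un_disjoint)
    moreover have "card ?B3 = card B - (card B1 + card B2)"
      using assms fin by (simp add: card_Diff_subset card_Un_disjoint)
    ultimately show ?thesis using assms by simp
  qed
  then obtain f g h where f: "bij_betw f A1 B1" and g: "bij_betw g A2 B2" and h: "bij_betw h ?A3 ?B3"
    using finite_same_card_bij[of A1 B1] finite_same_card_bij[of A2 B2] finite_same_card_bij[of ?A3 ?B3] assms fin
    by auto
  define \<beta> where "\<beta> = (\<lambda>p. if p \<in> A1 then f p else if p \<in> A2 then g p else h p)"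
  have "bij_betw \<beta> A1 B1" using f by (rule bij_betw_cong[THEN iffD1, rotated]) (simp add: \<beta>_def)
  moreover have "bij_betw \<beta> A2 B2"
    using g by (rule bij_betw_cong[THEN iffD1, rotated]) (use assms(1) in \<open>auto simp: \<beta>_def\<close>)
  ultimately have 12: "bij_betw \<beta> (A1 \<union> A2) (B1 \<union> B2)" using assms by (intro bij_betw_combine)
  have 3: "bij_betw \<beta> ?A3 ?B3"
    using h by (rule bij_betw_cong[THEN iffD1, rotated]) (auto simp: \<beta>_def)
  have "bij_betw \<beta> ((A1 \<union> A2) \<union> ?A3) ((B1 \<union> B2) \<union> ?B3)"
    using 12 3 by (rule bij_betw_combine) auto
  moreover have "(A1 \<union> A2) \<union> ?A3 = UNIV" "(B1 \<union> B2) \<union> ?B3 = B" using assms by auto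
  ultimately have "bij_betw \<beta> UNIV B" by simp
  moreover have "\<beta> p \<in> B1 \<longleftrightarrow> p \<in> A1" "\<beta> p \<in> B2 \<longleftrightarrow> p \<in> A2" for p
    using f g h assms(1,4) by (auto simp: \<beta>_def bij_betw_def)
  ultimately show ?thesis by (rule that)
qed

text \<open>When the orthogonality relations already hold, every iteration of Algorithm 2 may leave
  the matrices as they are. The run uses the unrestricted relation, so empty blocks are no
  obstacle.\<close>

lemma alg1_output_valid:
  fixes X :: "('n::{finite,linorder}) sqmat"
  assumes sz: "valid_sizes TYPE('n) m r s k l" and pr: "valid_pair r s X Z"
    and st: "valid_structure r s k l X Z Ps Qs A Y"
    and sym: "\<And>i. i \<in> {1..m} \<Longrightarrow> symmetric_mat (A i)"
    and orth: "\<And>i j. i \<in> {1..m} \<Longrightarrow> j \<in> {1..l} \<Longrightarrow> trace_prod (A i) (Y j) = 0"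
    and b: "\<And>i. i \<in> {1..m} \<Longrightarrow> b i = trace_prod (A i) X"
    and C: "C = Z + (\<Sum>i=1..m. y i *\<^sub>R A i)"
  shows "alg1_output m r s k l X Z A b C Y"
proof -
  let ?run = "(alg1_step m)\<^sup>*\<^sup>*"
  note sz' = sz[unfolded valid_sizes_def]
  have km: "k \<le> m" using sz' by simp
  have "alg1_step m (Start :: 'n alg_state) (Sizes r s k l)"
    using sz' by (intro step1) auto
  then have "?run Start (Sizes r s k l :: 'n alg_state)" by simp
  also have "alg1_step m (Sizes r s k l) (Optimal_Matrices r s k l X Z)"
    using pr by (intro step2) (auto simp: valid_pair_def)
  also (rtranclp.rtrancl_into_rtrancl) have "alg1_step m (Optimal_Matrices r s k l X Z) (Base_Equations r s k l X Z Ps Qs 0 A Y)"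
  proof (rule step3)
    show "regular_fr_seq (fr_seq Z A k) Ps" "regular_fr_seq (fr_seq X Y l) Qs"
      using st by (auto simp: valid_structure_def)
    then show "reduces_psd_to (fr_seq Z A k) (psd_face (lower_idx r))"
      "reduces_psd_to (fr_seq X Y l) (psd_face (upper_idx s))"
      using st by (simp_all add: reduces_psd_face_iff valid_structure_def)
  qed
  finally (rtranclp.rtrancl_into_rtrancl) have 0: "?run Start (Base_Equations r s k l X Z Ps Qs 0 A Y)" .
  have "?run Start (Base_Equations r s k l X Z Ps Qs i A Y)" if "i \<le> k" for i
    using that
  proof (induction i)
    case 0
    then show ?case using \<open>?run Start (Base_Equations r s k l X Z Ps Qs 0 A Y)\<close> by simp
  next
    case (Suc i)
    have "alg1_step m (Base_Equations r s k l X Z Ps Qs (Suc i - 1) A Y) (Base_Equations r s k l X Z Ps Qs (Suc i) A Y)"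
      using Suc.prems orth km valid_structure_symmetric[OF st]
      by (intro step4) (auto simp: changes_block_def)
    then have "alg1_step m (Base_Equations r s k l X Z Ps Qs i A Y) (Base_Equations r s k l X Z Ps Qs (Suc i) A Y)"
      by simp
    then show ?case using Suc by (meson Suc_leD rtranclp.rtrancl_into_rtrancl)
  qed
  from this[of k] have "?run Start (Base_Equations r s k l X Z Ps Qs k A Y)" by simp
  also have "alg1_step m (Base_Equations r s k l X Z Ps Qs k A Y) (All_Equations r s k l X Z A Y)"
    using sym orth by (intro step5) auto
  also (rtranclp.rtrancl_into_rtrancl) have "alg1_step m (All_Equations r s k l X Z A Y) (Output r s k l X Z A b C Y)"
    using b C by (intro step6) auto
  finally (rtranclp.rtrancl_into_rtrancl) show ?thesis by (simp add: alg1_output_def)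
qed

lemma card_not_in_null_space:
  fixes M :: "real^'n^'n" and f :: "'a \<Rightarrow> real^'n"
  assumes sym: "symmetric_mat M" and fin: "finite B" and inj: "inj_on f B" and ind: "independent (f ` B)"
    and card: "card B = CARD('n)" and sp: "{x. M *v x = 0} \<subseteq> span (f ` B \<inter> {x. M *v x = 0})"
  shows "card {p\<in>B. M *v f p \<noteq> 0} = rank M"
proof -
  let ?N = "f ` B \<inter> {x. M *v x = 0}"
  have "independent ?N" by (rule independent_mono[OF ind]) simp
  then have "dim {x. M *v x = 0} = card ?N"
    by (intro basis_card_eq_dim[symmetric] sp) simp
  moreover have "?N = f ` {p\<in>B. M *v f p = 0}" by auto
  ultimately have "dim {x. M *v x = 0} = card {p\<in>B. M *v f p = 0}"
    using card_image[OF inj_on_subset[OF inj], of "{p\<in>B. M *v f p = 0}"] by simp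
  moreover have "card B = card {p\<in>B. M *v f p = 0} + card {p\<in>B. M *v f p \<noteq> 0}"
    using fin by (subst card_Un_disjoint[symmetric]) (auto intro: arg_cong[where f = card])
  ultimately show ?thesis using dim_null_space_symmetric[OF sym] card by linarith
qed

text \<open>Prepending \<open>M\<close> lets the flag start at the whole space. Appending the
  identity, definite on whatever is left, lets it end at 0, as
  \<open>biorthogonal_adapted_bases\<close> demands.\<close>

lemma null_space_chain:
  fixes M :: "real^'n^'n"
  assumes M: "psd M" and ch: "fr_chain {x. M *v x = 0} Ss"
  shows "fr_chain UNIV (M # Ss @ [mat 1])"
    and "fr_space UNIV (M # Ss @ [mat 1]) (Suc 0) = {x. M *v x = 0}"
    and "i \<le> length Ss \<Longrightarrow> fr_space UNIV (M # Ss @ [mat 1]) (Suc i) = fr_space {x. M *v x = 0} Ss i"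
    and "fr_space UNIV (M # Ss @ [mat 1]) (Suc (Suc (length Ss))) = {0}"
proof -
  have N: "{x\<in>UNIV. x \<bullet> (M *v x) = 0} = {x. M *v x = 0}"
    using psd_null_vector[OF M] by auto
  have "symmetric_mat (mat 1 :: real^'n^'n)" by (simp add: symmetric_mat_def transpose_mat)
  then show "fr_chain UNIV (M # Ss @ [mat 1])"
    unfolding fr_chain_Cons N fr_chain_snoc using M ch by (simp add: psd_def)
  show 1: "fr_space UNIV (M # Ss @ [mat 1]) (Suc i) = fr_space {x. M *v x = 0} Ss i" if "i \<le> length Ss" for i
    unfolding fr_space_Cons_Suc N by (rule fr_space_append[OF that])
  show "fr_space UNIV (M # Ss @ [mat 1]) (Suc 0) = {x. M *v x = 0}"
    using 1[of 0] by simp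
  have sub: "subspace (fr_space {x. M *v x = 0} Ss (length Ss))"
    using ch by (intro subspace_fr_space) (auto simp: subspace_def matrix_vector_right_distrib matrix_vector_mult_scaleR)
  show "fr_space UNIV (M # Ss @ [mat 1]) (Suc (Suc (length Ss))) = {0}"
    unfolding fr_space_Suc[of _ _ "Suc (length Ss)"] 1[OF order_refl]
    using subspace_0[OF sub] by (auto simp: nth_append)
qed

text \<open>Ties the end of one flag, a range, to the beginning of the other, a null space. If
  \<open>e\<close> is outside the range, the basis vectors that span the range are all orthogonal to
  \<open>f\<close>, so \<open>f\<close> lies in the orthogonal complement of the range, the null
  space.\<close>

lemma adapted_range_iff:
  fixes M :: "real^'n^'n"
  assumes sym: "symmetric_mat M"
    and B: "\<And>e f. (e, f) \<in> B \<Longrightarrow> e \<bullet> f = 1"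
      "\<And>e f e' f'. (e, f) \<in> B \<Longrightarrow> (e', f') \<in> B \<Longrightarrow> (e, f) \<noteq> (e', f') \<Longrightarrow> e \<bullet> f' = 0"
    and sp: "range ((*v) M) \<subseteq> span (fst ` B \<inter> range ((*v) M))" and ef: "(e, f) \<in> B"
  shows "e \<in> range ((*v) M) \<longleftrightarrow> M *v f \<noteq> 0"
proof
  assume "e \<in> range ((*v) M)"
  then obtain y where "e = M *v y" by auto
  then have "y \<bullet> (M *v f) = 1"
    using B(1)[OF ef] symmetric_inner_commute[OF sym, of y f] by (simp add: inner_commute)
  then show "M *v f \<noteq> 0" by auto
next
  assume nz: "M *v f \<noteq> 0"
  show "e \<in> range ((*v) M)"
  proof (rule ccontr)
    assume "e \<notin> range ((*v) M)"
    have "x \<bullet> f = 0" if x: "x \<in> fst ` B \<inter> range ((*v) M)" for x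
    proof -
      obtain u where u: "(x, u) \<in> B" using x by auto
      have "x \<noteq> e" using x \<open>e \<notin> range ((*v) M)\<close> by auto
      then show ?thesis by (intro B(2)[OF u ef]) simp
    qed
    then have "fst ` B \<inter> range ((*v) M) \<subseteq> {x. orthogonal f x}"
      by (auto simp: orthogonal_def inner_commute)
    then have "range ((*v) M) \<subseteq> {x. orthogonal f x}"
      using sp span_minimal[OF _ subspace_orthogonal_to_vector] by blast
    then have "f \<bullet> (M *v (M *v f)) = 0" by (auto simp: orthogonal_def)
    then have "(M *v f) \<bullet> (M *v f) = 0" using symmetric_inner_commute[OF sym, of f "M *v f"] by simp
    then show False using nz by simp
  qed
qed

text \<open>Constraints rotate by \<open>T\<close>, solutions and certificates \<open>Y j\<close> by
  its inverse; all equations survive.\<close>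

lemma trace_prod_congruence:
  fixes M N S T :: "real^'n^'n"
  assumes "S ** T = mat 1"
  shows "trace_prod (transpose T ** M ** T) (S ** N ** transpose S) = trace_prod M N"
proof -
  have TS: "T ** S = mat 1" using assms by (simp add: matrix_left_right_inverse)
  have "(transpose T ** M ** T) ** (S ** N ** transpose S) = transpose T ** (M ** (T ** S) ** N ** transpose S)"
    by (simp add: matrix_mul_assoc)
  also have "\<dots> = transpose T ** (M ** N ** transpose S)" by (simp add: TS)
  finally have "trace_prod (transpose T ** M ** T) (S ** N ** transpose S)
      = trace ((M ** N ** transpose S) ** transpose T)"
    unfolding trace_prod_def by (simp only: trace_mul_sym[of "transpose T"])
  also have "(M ** N ** transpose S) ** transpose T = M ** N ** transpose (T ** S)"
    by (simp add: matrix_transpose_mul matrix_mul_assoc)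
  finally show ?thesis by (simp add: TS trace_prod_def transpose_mat)
qed

lemma congruence_add:
  fixes T :: "real^'n^'n"
  shows "transpose T ** (M + N) ** T = transpose T ** M ** T + transpose T ** N ** T"
  by (simp add: vec_eq_iff congruence_component matrix_vector_mult_add_rdistrib inner_add_right)

lemma congruence_scaleR:
  fixes T :: "real^'n^'n"
  shows "transpose T ** (c *\<^sub>R M) ** T = c *\<^sub>R (transpose T ** M ** T)"
  by (simp add: vec_eq_iff congruence_component scaleR_matrix_vector_assoc[symmetric])

lemma congruence_sum:
  fixes T :: "real^'n^'n"
  shows "transpose T ** (\<Sum>i\<in>I. F i) ** T = (\<Sum>i\<in>I. transpose T ** F i ** T)"
proof (induction I rule: infinite_finite_induct)
  case (insert i I)
  then show ?case by (simp add: congruence_add)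
qed (simp_all add: vec_eq_iff congruence_component)

lemma independent_if_dual_vectors:
  fixes G :: "'a::euclidean_space set"
  assumes "\<And>g. g \<in> G \<Longrightarrow> \<exists>h. g \<bullet> h = 1 \<and> (\<forall>g'\<in>G. g' \<noteq> g \<longrightarrow> g' \<bullet> h = 0)"
  shows "independent G"
proof
  assume "dependent G"
  then obtain g where g: "g \<in> G" "g \<in> span (G - {g})" by (auto simp: dependent_def)
  obtain h where h: "g \<bullet> h = 1" "\<forall>g'\<in>G. g' \<noteq> g \<longrightarrow> g' \<bullet> h = 0" using assms[OF g(1)] by blast
  have "G - {g} \<subseteq> {x. orthogonal h x}" using h(2) by (auto simp: orthogonal_def inner_commute)
  moreover have "subspace {x. orthogonal h x}" by (simp add: subspace_def orthogonal_clauses)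
  ultimately have "orthogonal h g" using g(2) span_minimal by blast
  then show False using h(1) by (simp add: orthogonal_def inner_commute)
qed

text \<open>The basis vectors become the columns of \<open>T\<close>. They are ordered so that those outside the
  null space of \<open>Z\<close> come first and those dual to vectors outside the null space of \<open>X\<close> come last.\<close>

lemma exists_adapted_rotation:
  fixes X Z :: "('n::{finite,linorder}) sqmat"
  assumes X: "psd X" and Z: "psd Z" and XZ: "trace_prod X Z = 0" and rk: "rank X + rank Z \<le> CARD('n)"
    and Ss: "fr_chain {x. Z *v x = 0} Ss" "fr_space {x. Z *v x = 0} Ss (length Ss) = range ((*v) X)"
    and Ts: "fr_chain {x. X *v x = 0} Ts" "fr_space {x. X *v x = 0} Ts (length Ts) = range ((*v) Z)"
  obtains S T :: "'n sqmat" where "S ** T = mat 1"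
    "\<And>p. p \<in> upper_idx (rank Z) \<longleftrightarrow> Z *v column p T \<noteq> 0"
    "\<And>p. p \<in> lower_idx (rank X) \<longleftrightarrow> X *v column p (transpose S) \<noteq> 0"
    "\<And>p. p \<in> lower_idx (rank X) \<longleftrightarrow> column p T \<in> range ((*v) X)"
    "\<And>p. p \<in> upper_idx (rank Z) \<longleftrightarrow> column p (transpose S) \<in> range ((*v) Z)"
    "\<And>i p q. i < length (Z # Ss @ [mat 1]) \<Longrightarrow> p \<noteq> q \<Longrightarrow> column p T \<in> fr_space UNIV (Z # Ss @ [mat 1]) i \<Longrightarrow>
      column q T \<in> fr_space UNIV (Z # Ss @ [mat 1]) i \<Longrightarrow> column p T \<bullet> ((Z # Ss @ [mat 1]) ! i *v column q T) = 0"
    "\<And>i p q. i < length (X # Ts @ [mat 1]) \<Longrightarrow> p \<noteq> q \<Longrightarrow> column p (transpose S) \<in> fr_space UNIV (X # Ts @ [mat 1]) i \<Longrightarrow>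
      column q (transpose S) \<in> fr_space UNIV (X # Ts @ [mat 1]) i \<Longrightarrow>
      column p (transpose S) \<bullet> ((X # Ts @ [mat 1]) ! i *v column q (transpose S)) = 0"
proof -
  let ?As = "Z # Ss @ [mat 1]" and ?Cs = "X # Ts @ [mat 1]"
  have symX: "symmetric_mat X" and symZ: "symmetric_mat Z" using X Z by (auto simp: psd_def)
  note chZ = null_space_chain[OF Z Ss(1)] and chX = null_space_chain[OF X Ts(1)]
  have endZ: "fr_space UNIV ?As (length ?As) = {0}" and endX: "fr_space UNIV ?Cs (length ?Cs) = {0}"
    using chZ(4) chX(4) by simp_all
  obtain B where finB: "finite B" and B1: "\<And>e f. (e, f) \<in> B \<Longrightarrow> e \<bullet> f = 1"
    and B0: "\<And>e f e' f'. (e, f) \<in> B \<Longrightarrow> (e', f') \<in> B \<Longrightarrow> (e, f) \<noteq> (e', f') \<Longrightarrow> e \<bullet> f' = 0"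
    and adE: "adapted UNIV ?As (fst ` B)" and adF: "adapted UNIV ?Cs (snd ` B)"
    by (rule biorthogonal_adapted_bases[OF subspace_UNIV subspace_UNIV chZ(1) chX(1) endZ endX])
       (metis UNIV_I inner_eq_zero_iff, metis UNIV_I inner_eq_zero_iff, rule that)
  have spanE: "fr_space UNIV ?As i \<subseteq> span (fst ` B \<inter> fr_space UNIV ?As i)" if "i \<le> length ?As" for i
    using adE that unfolding adapted_def by blast
  have spanF: "fr_space UNIV ?Cs i \<subseteq> span (snd ` B \<inter> fr_space UNIV ?Cs i)" if "i \<le> length ?Cs" for i
    using adF that unfolding adapted_def by blast
  have injE: "inj_on fst B" and injF: "inj_on snd B"
    using B0 B1 by (auto simp: inj_on_def) (metis zero_neq_one)+
  have indE: "independent (fst ` B)" and indF: "independent (snd ` B)"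
  proof -
    show "independent (fst ` B)"
    proof (rule independent_if_dual_vectors)
      fix g assume "g \<in> fst ` B"
      then obtain h where gh: "(g, h) \<in> B" by auto
      then show "\<exists>h. g \<bullet> h = 1 \<and> (\<forall>g'\<in>fst ` B. g' \<noteq> g \<longrightarrow> g' \<bullet> h = 0)"
        using B1[OF gh] B0[OF _ gh] by (intro exI[of _ h]) auto
    qed
    show "independent (snd ` B)"
    proof (rule independent_if_dual_vectors)
      fix g assume "g \<in> snd ` B"
      then obtain h where gh: "(h, g) \<in> B" by auto
      then show "\<exists>h. g \<bullet> h = 1 \<and> (\<forall>g'\<in>snd ` B. g' \<noteq> g \<longrightarrow> g' \<bullet> h = 0)"
        using B1[OF gh] B0[OF gh] by (intro exI[of _ h]) (auto simp: inner_commute)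
    qed
  qed
  \<comment> \<open>Level 0 of the flag is the whole space, so the first components form a
    basis.\<close>
  have "card (fst ` B) = dim (UNIV :: (real, 'n) vec set)"
    by (rule basis_card_eq_dim) (use spanE[of 0] indE in auto)
  then have cardB: "card B = CARD('n)" using card_image[OF injE] by simp
  define BZ BX where "BZ = {p\<in>B. Z *v fst p \<noteq> 0}" and "BX = {p\<in>B. X *v snd p \<noteq> 0}"
  have cBZ: "card BZ = rank Z"
    unfolding BZ_def using spanE[of 1] chZ(2)
    by (intro card_not_in_null_space[OF symZ finB injE indE cardB]) simp
  have cBX: "card BX = rank X"
    unfolding BX_def using spanF[of 1] chX(2)
    by (intro card_not_in_null_space[OF symX finB injF indF cardB]) simp
  have rangeX: "e \<in> range ((*v) X) \<longleftrightarrow> X *v f \<noteq> 0" if "(e, f) \<in> B" for e f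
    by (rule adapted_range_iff[OF symX B1 B0 _ that])
       (use spanE[of "Suc (length Ss)"] chZ(3)[of "length Ss"] Ss(2) in simp_all)
  \<comment> \<open>The roles of basis and dual basis are symmetric; swapping the pairs reuses the
    same lemma.\<close>
  have rangeZ: "f \<in> range ((*v) Z) \<longleftrightarrow> Z *v e \<noteq> 0" if "(e, f) \<in> B" for e f
  proof (rule adapted_range_iff[OF symZ, of "prod.swap ` B"])
    show "range ((*v) Z) \<subseteq> span (fst ` prod.swap ` B \<inter> range ((*v) Z))"
      using spanF[of "Suc (length Ts)"] chX(3)[of "length Ts"] Ts(2) by (simp add: image_image)
    show "(f, e) \<in> prod.swap ` B" using that by force
    show "u \<bullet> v = 1" if "(u, v) \<in> prod.swap ` B" for u v using that B1[of v u] by (auto simp: inner_commute)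
    show "u \<bullet> v' = 0" if "(u, v) \<in> prod.swap ` B" "(u', v') \<in> prod.swap ` B" "(u, v) \<noteq> (u', v')" for u v u' v'
      using that B0[of v' u' v u] by (auto simp: inner_commute)
  qed
  have Zrange: "Z *v x = 0" if "x \<in> range ((*v) X)" for x
    using that psd_null_vector[OF Z] inner_psd_zero_on[OF X subset_UNIV subspace_UNIV symZ psd_nonneg[OF Z]] XZ
      trace_prod_inner[OF symZ, of X] by (auto simp: inner_commute)
  \<comment> \<open>A pair in \<open>BX\<close> has its first component in the range of
    \<open>X\<close>, which \<open>Z\<close> annihilates.\<close>
  have disj: "BZ \<inter> BX = {}"
    using rangeX Zrange by (fastforce simp: BZ_def BX_def)
  have sub: "BZ \<subseteq> B" "BX \<subseteq> B" by (auto simp: BZ_def BX_def)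
  have idx: "(upper_idx (rank Z) :: 'n set) \<inter> lower_idx (rank X) = {}"
    by (rule upper_lower_idx_disjoint[OF rk])
  have card: "card (upper_idx (rank Z) :: 'n set) = card BZ" "card (lower_idx (rank X) :: 'n set) = card BX"
    using card_upper_idx[of "rank Z", where 'n = 'n] card_lower_idx[of "rank X", where 'n = 'n] cBZ cBX rk by simp_all
  obtain \<beta> where \<beta>: "bij_betw \<beta> (UNIV :: 'n set) B"
    "\<And>p. \<beta> p \<in> BZ \<longleftrightarrow> p \<in> upper_idx (rank Z)" "\<And>p. \<beta> p \<in> BX \<longleftrightarrow> p \<in> lower_idx (rank X)"
    by (rule bij_betw_prescribed[OF idx sub disj finB card cardB[symmetric]]; (assumption | rule that))
  \<comment> \<open>Rows of \<open>S\<close> are the dual vectors and columns of \<open>T\<close>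
    the basis vectors, so biorthogonality makes \<open>S\<close> the inverse of
    \<open>T\<close>.\<close>
  define S T :: "'n sqmat" where "S = (\<chi> p i. snd (\<beta> p) $ i)" and "T = (\<chi> i p. fst (\<beta> p) $ i)"
  have colT: "column p T = fst (\<beta> p)" and colS: "column p (transpose S) = snd (\<beta> p)" for p
    by (simp_all add: column_def S_def T_def transpose_def vec_eq_iff)
  have \<beta>B: "(fst (\<beta> p), snd (\<beta> p)) \<in> B" for p using \<beta>(1) by (auto simp: bij_betw_def)
  have \<beta>inj: "\<beta> p \<noteq> \<beta> q" if "p \<noteq> q" for p q using \<beta>(1) that by (auto simp: bij_betw_def inj_on_def)
  have neE: "fst (\<beta> p) \<noteq> fst (\<beta> q)" and neF: "snd (\<beta> p) \<noteq> snd (\<beta> q)" if "p \<noteq> q" for p q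
    using \<beta>inj[OF that] \<beta>B[of p] \<beta>B[of q] injE injF by (auto dest: inj_onD)
  show ?thesis
  proof (rule that[of S T])
    have "(S ** T) $ p $ q = fst (\<beta> q) \<bullet> snd (\<beta> p)" for p q
      by (simp add: S_def T_def matrix_matrix_mult_def inner_vec_def mult.commute)
    moreover have "fst (\<beta> q) \<bullet> snd (\<beta> p) = (if p = q then 1 else 0)" for p q
      using B1[OF \<beta>B[of p]] B0[OF \<beta>B[of q] \<beta>B[of p]] \<beta>inj[of p q] by auto
    ultimately show "S ** T = mat 1" by (simp add: vec_eq_iff mat_def)
    show *: "p \<in> upper_idx (rank Z) \<longleftrightarrow> Z *v column p T \<noteq> 0" for p
      using \<beta>(2)[of p] \<beta>B[of p] by (simp add: BZ_def colT)
    show **: "p \<in> lower_idx (rank X) \<longleftrightarrow> X *v column p (transpose S) \<noteq> 0" for p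
      using \<beta>(3)[of p] \<beta>B[of p] unfolding colS by (simp add: BX_def)
    show "p \<in> lower_idx (rank X) \<longleftrightarrow> column p T \<in> range ((*v) X)" for p
      using rangeX[OF \<beta>B[of p]] **[of p] unfolding colT colS by simp
    show "p \<in> upper_idx (rank Z) \<longleftrightarrow> column p (transpose S) \<in> range ((*v) Z)" for p
      using rangeZ[OF \<beta>B[of p]] *[of p] unfolding colT colS by simp
    fix i p q assume pq: "p \<noteq> (q :: 'n)"
    have mem: "fst (\<beta> p) \<in> fst ` B" "snd (\<beta> p) \<in> snd ` B" for p using \<beta>B[of p] by force+
    show "column p T \<bullet> (?As ! i *v column q T) = 0"
      if "i < length ?As" "column p T \<in> fr_space UNIV ?As i" "column q T \<in> fr_space UNIV ?As i"
      unfolding colT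
      by (rule adapted_orthogonal[OF adE that(1) mem(1) mem(1) that(2,3)[unfolded colT] neE[OF pq]])
    show "column p (transpose S) \<bullet> (?Cs ! i *v column q (transpose S)) = 0"
      if "i < length ?Cs" "column p (transpose S) \<in> fr_space UNIV ?Cs i" "column q (transpose S) \<in> fr_space UNIV ?Cs i"
      unfolding colS
      by (rule adapted_orthogonal[OF adF that(1) mem(2) mem(2) that(2,3)[unfolded colS] neF[OF pq]])
  qed
qed

text \<open>Used for \<open>Z\<close> with \<open>T\<close> and for \<open>X\<close> with
  \<open>transpose S\<close>. The sequence stops before the auxiliary identity, so the columns in
  the final space of the chain stay outside the structure.\<close>

lemma regular_fr_seq_rotated:
  fixes M T :: "real^'n^'n"
  assumes M: "psd M" and Ss: "fr_chain {x. M *v x = 0} Ss"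
    and ad: "\<And>i p q. i < length (M # Ss @ [mat 1]) \<Longrightarrow> p \<noteq> q \<Longrightarrow> column p T \<in> fr_space UNIV (M # Ss @ [mat 1]) i \<Longrightarrow>
      column q T \<in> fr_space UNIV (M # Ss @ [mat 1]) i \<Longrightarrow> column p T \<bullet> ((M # Ss @ [mat 1]) ! i *v column q T) = 0"
    and U: "\<And>p. p \<in> U \<longleftrightarrow> M *v column p T \<noteq> 0"
    and B: "\<And>i. i < length Ss \<Longrightarrow> B (Suc i) = transpose T ** Ss ! i ** T"
  shows "supported_on U (transpose T ** M ** T)" "diag_pd_block U (transpose T ** M ** T)"
    and "\<exists>Rs. regular_fr_seq (fr_seq (transpose T ** M ** T) B (length Ss)) Rs \<and>
      \<Union>(set Rs) = {p. column p T \<notin> fr_space {x. M *v x = 0} Ss (length Ss)}"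
proof -
  let ?S = "M # Ss @ [mat 1]"
  have sym: "symmetric_mat M" using M by (simp add: psd_def)
  have z: "column p T \<bullet> (M *v column q T) = 0" if "p \<notin> U \<or> q \<notin> U" for p q
    using that
  proof
    assume "p \<notin> U"
    then have "M *v column p T = 0" using U[of p] by blast
    then show ?thesis by (subst symmetric_inner_commute[OF sym]) simp
  next
    assume "q \<notin> U"
    then have "M *v column q T = 0" using U[of q] by blast
    then show ?thesis by simp
  qed
  then show "supported_on U (transpose T ** M ** T)"
    by (auto simp: supported_on_def congruence_component)
  have "column p T \<bullet> (M *v column q T) = 0" if "p \<noteq> q" for p q
    using ad[of 0 p q] that by simp
  moreover have "0 < column p T \<bullet> (M *v column p T)" if "p \<in> U" for p
  proof -
    have "column p T \<bullet> (M *v column p T) \<noteq> 0"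
      using psd_null_vector[OF M, of "column p T"] that U[of p] by blast
    then show ?thesis using psd_nonneg[OF M, of "column p T"] by linarith
  qed
  ultimately show "diag_pd_block U (transpose T ** M ** T)"
    by (simp add: diag_pd_block_iff congruence_component)
  note ch = null_space_chain[OF M Ss]
  have "\<exists>Rs. regular_fr_seq (fr_seq (transpose T ** M ** T) B (length Ss)) Rs \<and>
      \<Union>(set Rs) = {p. column p T \<notin> fr_space UNIV ?S (Suc (length Ss))}"
  proof (rule regular_fr_seq_adapted[OF ch(1)])
    show "fr_seq (transpose T ** M ** T) B (length Ss) ! i = transpose T ** ?S ! i ** T" if "i \<le> length Ss" for i
      using that B[of "i - 1"] by (cases i) (auto simp: fr_seq_nth nth_append)
    show "column p T \<bullet> (?S ! i *v column q T) = 0"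
      if "i \<le> length Ss" "p \<noteq> q" "column p T \<in> fr_space UNIV ?S i" "column q T \<in> fr_space UNIV ?S i" for i p q
      by (rule ad[OF _ that(2-4)]) (use that(1) in simp)
  qed simp_all
  then show "\<exists>Rs. regular_fr_seq (fr_seq (transpose T ** M ** T) B (length Ss)) Rs \<and>
      \<Union>(set Rs) = {p. column p T \<notin> fr_space {x. M *v x = 0} Ss (length Ss)}"
    by (simp only: ch(3)[OF order_refl])
qed

section \<open>The given problem as a reformulation of an output\<close>

text \<open>The value of the form at \<open>x\<close> is linear in the matrix; it is 0 for the
  earlier members and nonzero for this one.\<close>

lemma chain_not_in_span:
  fixes Ss :: "(real^'n^'n) list"
  assumes "x \<in> fr_space N Ss i" "x \<bullet> (Ss ! i *v x) \<noteq> 0" "i < length Ss"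
  shows "Ss ! i \<notin> span (set (take i Ss))"
proof
  assume "Ss ! i \<in> span (set (take i Ss))"
  moreover have "subspace {M :: real^'n^'n. x \<bullet> (M *v x) = 0}"
    by (auto simp: subspace_def matrix_vector_mult_add_rdistrib inner_add_right scaleR_matrix_vector_assoc[symmetric])
  moreover have "set (take i Ss) \<subseteq> {M. x \<bullet> (M *v x) = 0}"
    using assms(1,3) by (auto simp: fr_space_def in_set_conv_nth)
  ultimately show False using assms(2) span_minimal by blast
qed

text \<open>The exchange of constraints precedes the rotation. It preserves their span, so the
  second chain stays orthogonal to them and \<open>C - Z\<close> can be expanded in the new
  constraints.\<close>

lemma reformulation_of_output:
  fixes A :: "nat \<Rightarrow> ('n::{finite,linorder}) sqmat"
  assumes symA: "\<And>i. i \<in> {1..m} \<Longrightarrow> symmetric_mat (A i)"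
    and fails: "fails_strict_complementarity m A b C"
  shows "\<exists>r s k l X Z A0 b0 C0 Y. alg1_output m r s k l X Z A0 b0 C0 Y \<and> reformulation m A0 b0 C0 A b C"
proof -
  obtain X Z where pair: "optimal_pair m A b C X Z" and maxX: "max_rank_primal_optimal m A b C X"
    and maxZ: "max_rank_dual_optimal m A b C Z" and rk: "rank X + rank Z < CARD('n)"
    using fails by (auto simp: fails_strict_complementarity_def)
  obtain y where X: "psd X" and feasX: "\<forall>i\<in>{1..m}. trace_prod (A i) X = b i"
    and Z: "psd Z" "Z = slack m A C y" and XZ: "trace_prod X Z = 0"
    using pair by (auto simp: optimal_pair_def primal_feasible_def dual_feasible_def dual_feasible_vec_def)
  obtain Ss Ts where pos: "0 < rank X" "0 < rank Z" and ne: "Ss \<noteq> []" "Ts \<noteq> []"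
    and len: "length Ss \<le> CARD('n) - rank X - rank Z" "length Ts \<le> CARD('n) - rank X - rank Z"
    and Ss: "fr_chain {x. Z *v x = 0} Ss" "fr_space {x. Z *v x = 0} Ss (length Ss) = range ((*v) X)"
    and Ts: "fr_chain {x. X *v x = 0} Ts" "fr_space {x. X *v x = 0} Ts (length Ts) = range ((*v) Z)"
    and spS: "\<And>S. S \<in> set Ss \<Longrightarrow> S \<in> span (A ` {1..m})"
    and nz: "\<And>i. i < length Ss \<Longrightarrow> \<exists>x\<in>fr_space {x. Z *v x = 0} Ss i. x \<bullet> (Ss ! i *v x) \<noteq> 0"
    and orthT: "\<And>T h. T \<in> set Ts \<Longrightarrow> h \<in> span (A ` {1..m}) \<Longrightarrow> inner h T = 0"
    by (rule exists_certificate_chains[OF symA pair maxX maxZ rk]; (assumption | rule that))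
  have "Ss ! i \<in> span (A ` {1..m}) \<and> Ss ! i \<notin> span (set (take i Ss))" if "i < length Ss" for i
    using spS[OF nth_mem[OF that]] nz[OF that] chain_not_in_span[OF _ _ that] by blast
  from reformulation_prescribe_first[OF this, where b = b and C = C] obtain A1 b1
    where km: "length Ss \<le> m" and ref1: "reformulation m A b C A1 b1 C"
      and first: "\<And>i. i < length Ss \<Longrightarrow> A1 (Suc i) = Ss ! i"
      and span1: "span (A1 ` {1..m}) = span (A ` {1..m})"
      and b1: "\<And>i. i \<in> {1..m} \<Longrightarrow> trace_prod (A1 i) X = b1 i"
    using feasX by blast
  have A1span: "A1 i \<in> span (A ` {1..m})" if "i \<in> {1..m}" for i
    using span_base[of "A1 i" "A1 ` {1..m}"] that span1 by blast
  have "A ` {1..m} \<subseteq> {M. symmetric_mat M}" using symA by auto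
  then have symA1: "symmetric_mat (A1 i)" if "i \<in> {1..m}" for i
    using span_minimal[OF _ subspace_symmetric_mat] A1span[OF that] by blast
  have "C - Z = (\<Sum>i=1..m. y i *\<^sub>R A i)" by (simp add: Z(2) slack_def)
  also have "\<dots> \<in> span (A1 ` {1..m})"
    unfolding span1 by (intro span_sum span_scale span_base) auto
  finally obtain y1 where "C - Z = (\<Sum>i=1..m. y1 i *\<^sub>R A1 i)"
    using in_span_image[of "{1..m}" "C - Z" A1] by blast
  then have C: "C = Z + (\<Sum>i=1..m. y1 i *\<^sub>R A1 i)" by (simp add: algebra_simps)
  obtain S T :: "'n sqmat" where ST: "S ** T = mat 1"
    and upp: "\<And>p. p \<in> upper_idx (rank Z) \<longleftrightarrow> Z *v column p T \<noteq> 0"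
    and low: "\<And>p. p \<in> lower_idx (rank X) \<longleftrightarrow> X *v column p (transpose S) \<noteq> 0"
      "\<And>p. p \<in> lower_idx (rank X) \<longleftrightarrow> column p T \<in> range ((*v) X)"
    and upp': "\<And>p. p \<in> upper_idx (rank Z) \<longleftrightarrow> column p (transpose S) \<in> range ((*v) Z)"
    and adT: "\<And>i p q. i < length (Z # Ss @ [mat 1]) \<Longrightarrow> p \<noteq> q \<Longrightarrow> column p T \<in> fr_space UNIV (Z # Ss @ [mat 1]) i \<Longrightarrow>
      column q T \<in> fr_space UNIV (Z # Ss @ [mat 1]) i \<Longrightarrow> column p T \<bullet> ((Z # Ss @ [mat 1]) ! i *v column q T) = 0"
    and adS: "\<And>i p q. i < length (X # Ts @ [mat 1]) \<Longrightarrow> p \<noteq> q \<Longrightarrow> column p (transpose S) \<in> fr_space UNIV (X # Ts @ [mat 1]) i \<Longrightarrow>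
      column q (transpose S) \<in> fr_space UNIV (X # Ts @ [mat 1]) i \<Longrightarrow>
      column p (transpose S) \<bullet> ((X # Ts @ [mat 1]) ! i *v column q (transpose S)) = 0"
    by (rule exists_adapted_rotation[OF X Z(1) XZ less_imp_le[OF rk] Ss Ts]; (assumption | rule that))
  define r s k l where "r = rank X" and "s = rank Z" and "k = length Ss" and "l = length Ts"
  define A0 where "A0 = (\<lambda>i. transpose T ** A1 i ** T)"
  define C0 where "C0 = transpose T ** C ** T"
  define Z0 where "Z0 = transpose T ** Z ** T"
  define X0 where "X0 = S ** X ** transpose S"
  \<comment> \<open>Lists start at 0, families at 1.\<close>
  define Y0 where "Y0 = (\<lambda>j. S ** Ts ! (j - 1) ** transpose S)"
  have A0: "A0 (Suc i) = transpose T ** Ss ! i ** T" if "i < length Ss" for i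
    using first[OF that] by (simp add: A0_def)
  note P = regular_fr_seq_rotated[OF Z(1) Ss(1) adT upp A0]
  have Y0: "Y0 (Suc i) = transpose (transpose S) ** Ts ! i ** transpose S" for i by (simp add: Y0_def)
  note Q = regular_fr_seq_rotated[OF X Ts(1) adS low(1) Y0]
  have pr: "valid_pair r s X0 Z0"
    using P(1,2) Q(1,2) by (simp add: valid_pair_def r_def s_def X0_def Z0_def)
  obtain Ps where Ps: "regular_fr_seq (fr_seq Z0 A0 k) Ps" "\<Union>(set Ps) = {p. column p T \<notin> range ((*v) X)}"
    using P(3) unfolding Z0_def k_def Ss(2) by blast
  obtain Qs where Qs: "regular_fr_seq (fr_seq X0 Y0 l) Qs"
    "\<Union>(set Qs) = {p. column p (transpose S) \<notin> range ((*v) Z)}"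
    using Q(3) unfolding X0_def l_def Ts(2) transpose_transpose by blast
  have st: "valid_structure r s k l X0 Z0 Ps Qs A0 Y0"
    unfolding valid_structure_def
  proof (intro conjI Ps(1) Qs(1))
    show "\<Union>(set Ps) = - lower_idx r" unfolding Ps(2) r_def using low(2) by auto
    show "\<Union>(set Qs) = - upper_idx s" unfolding Qs(2) s_def using upp' by auto
  qed
  have sz: "valid_sizes TYPE('n) m r s k l"
    using pos rk ne len km by (auto simp: valid_sizes_def r_def s_def k_def l_def Suc_le_eq)
  have out: "alg1_output m r s k l X0 Z0 A0 b1 C0 Y0"
  proof (rule alg1_output_valid[OF sz pr st])
    fix i assume i: "i \<in> {1..m}"
    show "symmetric_mat (A0 i)" unfolding A0_def by (rule symmetric_congruence[OF symA1[OF i]])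
    show "b1 i = trace_prod (A0 i) X0"
      using b1[OF i] by (simp add: A0_def X0_def trace_prod_congruence[OF ST])
    fix j assume j: "j \<in> {1..l}"
    then have j': "j - 1 < length Ts" by (auto simp: l_def)
    have "trace_prod (A1 i) (Ts ! (j - 1)) = 0"
      using orthT[OF nth_mem[OF j'] A1span[OF i]] fr_chainD(1)[OF Ts(1) j'] by (simp add: trace_prod_inner)
    then show "trace_prod (A0 i) (Y0 j) = 0"
      by (simp add: A0_def Y0_def trace_prod_congruence[OF ST])
  next
    show "C0 = Z0 + (\<Sum>i=1..m. y1 i *\<^sub>R A0 i)"
      unfolding C0_def Z0_def A0_def by (subst C) (simp only: congruence_add congruence_sum congruence_scaleR)
  qed
  have "invertible T" using ST by (auto simp: invertible_def matrix_left_right_inverse)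
  from reformulation.rotate[OF ref1 this] have "reformulation m A b C A0 b1 C0"
    by (simp add: A0_def C0_def)
  \<comment> \<open>So far the output is a reformulation of the given problem; inverting the
    operations gives the required direction.\<close>
  from reformulation_sym[OF this] out show ?thesis by blast
qed

theorem theorem2:
  fixes m :: nat
  assumes n_ge: "CARD('n::{finite,linorder}) \<ge> 3" and m_ge: "m \<ge> 2"
  shows "(\<exists>impl :: 'n alg_state \<Rightarrow> 'n alg_state \<Rightarrow> bool.
            alg1_implementation m impl \<and>
            succeeds_in_every_run impl \<and>
            (\<forall>r s k l X Z A b C Y.
               impl\<^sup>*\<^sup>* Start (Output r s k l X Z A b C Y) \<longrightarrow>
               correct_output m r s k l X Z A b C Y)) \<and>
         (\<forall>(A :: nat \<Rightarrow> 'n sqmat) b C.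
            (\<forall>i\<in>{1..m}. symmetric_mat (A i)) \<and> symmetric_mat C \<and>
            inj_on A {1..m} \<and> independent (A ` {1..m}) \<and>
            fails_strict_complementarity m A b C \<longrightarrow>
            (\<exists>r s k l X Z A0 b0 C0 Y.
               alg1_output m r s k l X Z A0 b0 C0 Y \<and>
               reformulation m A0 b0 C0 A b C))"
proof (intro conjI exI[of _ "careful_step m"] allI impI)
  show "alg1_implementation m (careful_step m :: 'n alg_state \<Rightarrow> _)"
    by (rule careful_step_implementation)
  show "succeeds_in_every_run (careful_step m :: 'n alg_state \<Rightarrow> _)"
    by (rule careful_step_succeeds[OF n_ge m_ge])
  show "correct_output m r s k l X Z A b C Y"
    if "(careful_step m)\<^sup>*\<^sup>* Start (Output r s k l X Z A b C Y)"
    for r s k l and X Z :: "'n sqmat" and A b C Y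
    using that by (rule careful_step_correct)
  show "\<exists>r s k l X Z A0 b0 C0 Y. alg1_output m r s k l X Z A0 b0 C0 Y \<and> reformulation m A0 b0 C0 A b C"
    if "(\<forall>i\<in>{1..m}. symmetric_mat (A i)) \<and> symmetric_mat C \<and> inj_on A {1..m} \<and>
      independent (A ` {1..m}) \<and> fails_strict_complementarity m A b C"
    for A :: "nat \<Rightarrow> 'n sqmat" and b C
    using that by (intro reformulation_of_output) auto
qed

end
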